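(* If $\pi_1,\pi_2,\pi_3,\pi_4$ are $4$-point permutations such that $A_{\pi_1}+A_{\pi_2}-A_{\pi_3}-A_{\pi_4}$ is the zero matrix, then $\{\pi_1,\pi_2,\pi_3,\pi_4\}$ is not quasirandom-forcing.
   Context: $A_\pi$ is the $4\times4$ permutation matrix of $\pi$: entry $1$ in row $i$ and column $\pi(i)$, $0$ elsewhere. Pattern density $d(\sigma,\pi)$: probability that a uniformly random $|\sigma|$-subset of positions of $\pi$ induces the pattern $\sigma$. A set $S$ of permutations is quasirandom-forcing if every sequence of permutations with sizes tending to infinity and $d(\sigma,\pi_n)\to1/|\sigma|!$ for all $\sigma\in S$ has $d(\sigma,\pi_n)\to1/|\sigma|!$ for all permutations $\sigma$. *)

theory Defs
  imports Complex_Main "HOL-Combinatorics.Multiset_Permutations" "Jordan_Normal_Form.Matrix"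
begin

text \<open>A permutation of size n is written in one-line notation, as a list containing each of
  1, ..., n exactly once. Positions in the list are counted from 0, values from 1.\<close>

definition is_permutation :: "nat list \<Rightarrow> bool" where
  "is_permutation \<pi> \<longleftrightarrow> \<pi> \<in> permutations_of_set {1..length \<pi>}"

definition perm_matrix :: "nat list \<Rightarrow> real mat" where
  "perm_matrix \<pi> = mat (length \<pi>) (length \<pi>) (\<lambda>(i, j). if \<pi> ! i = Suc j then 1 else 0)"

definition order_isomorphic :: "nat list \<Rightarrow> nat list \<Rightarrow> bool" where
  "order_isomorphic xs ys \<longleftrightarrow> length xs = length ys \<and>
     (\<forall>i < length xs. \<forall>j < length xs. xs ! i < xs ! j \<longleftrightarrow> ys ! i < ys ! j)"

text \<open>If \<open>\<sigma>\<close> is longer than \<open>\<pi>\<close>, the binomial coefficient is 0 and so is the density.\<close>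

definition pattern_density :: "nat list \<Rightarrow> nat list \<Rightarrow> real" where
  "pattern_density \<sigma> \<pi> =
     real (card {I. I \<subseteq> {..<length \<pi>} \<and> card I = length \<sigma> \<and> order_isomorphic (nths \<pi> I) \<sigma>})
       / real (length \<pi> choose length \<sigma>)"

definition quasirandom_forcing :: "nat list set \<Rightarrow> bool" where
  "quasirandom_forcing S \<longleftrightarrow>
     (\<forall>\<pi> :: nat \<Rightarrow> nat list.
        (\<forall>n. is_permutation (\<pi> n)) \<longrightarrow>
        filterlim (\<lambda>n. length (\<pi> n)) at_top sequentially \<longrightarrow>
        (\<forall>\<sigma>\<in>S. (\<lambda>n. pattern_density \<sigma> (\<pi> n)) \<longlonglongrightarrow> 1 / fact (length \<sigma>)) \<longrightarrow>
        (\<forall>\<sigma>. is_permutation \<sigma> \<longrightarrow>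
           (\<lambda>n. pattern_density \<sigma> (\<pi> n)) \<longlonglongrightarrow> 1 / fact (length \<sigma>)))"

end

theory Submission
  imports Defs "HOL-Probability.Probability" "HOL-Real_Asymp.Real_Asymp"
begin

text \<open>
  Points drawn independently from a density \<open>w\<close> on the unit square induce random permutations in which
  the density of a pattern \<open>\<sigma>\<close> of size 4 concentrates at \<open>N(\<sigma>) / 24\<close>, where \<open>N(\<sigma>)\<close> is the expectation of
  \<open>\<Prod>i. w(X\<^sub>i, Y\<^sub>\<sigma>\<^sub>(\<^sub>i\<^sub>))\<close> for two independent systems \<open>X\<close>, \<open>Y\<close> of order statistics of four uniform points.
  Hence it suffices to find \<open>w\<close> with \<open>N = 1\<close> at the four given patterns but not at all patterns of size 4.

  Let \<open>w = 1 + e (g\<^sub>1(x) g\<^sub>1(y) + t g\<^sub>2(x) g\<^sub>2(y)) + e\<^sup>2 \<Sum>i j. X\<^sub>i\<^sub>j k\<^sub>i(x) k\<^sub>j(y)\<close> with \<open>g\<^sub>1\<close>, \<open>g\<^sub>2\<close> orthogonal to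
  all cubics and \<open>k\<^sub>i\<close> the cubics dual to the order statistics. The first-order term vanishes and
  \<open>N(\<sigma>) = 1 + e\<^sup>2 (\<Sum>i. X\<^sub>i\<^sub>\<sigma>\<^sub>(\<^sub>i\<^sub>) + Q\<^sub>\<sigma>(t)) + O(e\<^sup>3)\<close>. The matrix relation leaves two cases. If only two
  patterns occur, the matrix \<open>X\<close> alone adjusts both values of \<open>N\<close>. Otherwise the positions split into two
  pairs mapped onto two pairs of values, and the four patterns arise by flipping the images of the pairs;
  \<open>X\<close> adjusts three values, and \<open>N(\<pi>\<^sub>1) + N(\<pi>\<^sub>2) - N(\<pi>\<^sub>3) - N(\<pi>\<^sub>4)\<close> is, to second order, a quadratic
  polynomial in \<open>t\<close> that changes sign. The Poincare--Miranda theorem then yields exact solutions for small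
  \<open>e\<close>, and another alternating sum of the same kind stays away from zero, so that \<open>w\<close> is not uniform.
\<close>

section \<open>The Poincare--Miranda theorem\<close>

text \<open>The obstacle is the alternating sum of the four weights: the matrix relation cancels
  every contribution of X to it, so X cannot correct it. What remains at second order is the
  interaction of the first-order perturbation with itself, which factors into a constant for the
  split of the positions and one for the split of the values. A single product g(x) g(y) would leave
  a fixed number with nothing to tune; two products with variable ratio t leave a polynomial in t.

  The two polynomials are governed by the joint densities of pairs of order statistics. On symmetric
  functions, the alternating sum of these densities over a split is a polynomial of degree at most
  2, which orthogonality kills, plus a multiple of |x - y|: the factor is 0 for {0,2}, {1,3} and 36
  or -36 for the other splits. Integration by parts turns |x - y| into an inner product of
  antiderivatives. Hence the diagonal terms are multiples of squared norms. The antiderivatives of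
  P_4 + P_5 and P_5 + 2 P_6 are orthogonal, which is what the coefficient 2 achieves, so that mixed
  terms are purely antisymmetric.\<close>

no_notation scalar_prod (infix "\<bullet>" 70)

text \<open>Brouwer's theorem applied to x - f x, clamped to the box in each coordinate. If clamping
  is active at the fixed point, that coordinate lies on a face, and the sign condition there forces
  the corresponding component of f to vanish.\<close>

lemma poincare_miranda:
  fixes f :: "'a::euclidean_space \<Rightarrow> 'a"
  assumes ab: "\<And>i. i \<in> Basis \<Longrightarrow> a \<bullet> i \<le> b \<bullet> i"
    and cont: "continuous_on (cbox a b) f"
    and lower: "\<And>x i. x \<in> cbox a b \<Longrightarrow> i \<in> Basis \<Longrightarrow> x \<bullet> i = a \<bullet> i \<Longrightarrow> f x \<bullet> i \<le> 0"
    and upper: "\<And>x i. x \<in> cbox a b \<Longrightarrow> i \<in> Basis \<Longrightarrow> x \<bullet> i = b \<bullet> i \<Longrightarrow> f x \<bullet> i \<ge> 0"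
  obtains x where "x \<in> cbox a b" "f x = 0"
proof -
  define T where "T x = (\<Sum>i\<in>Basis. max (a \<bullet> i) (min (b \<bullet> i) (x \<bullet> i - f x \<bullet> i)) *\<^sub>R i)" for x
  have T_inner: "T x \<bullet> i = max (a \<bullet> i) (min (b \<bullet> i) (x \<bullet> i - f x \<bullet> i))" if "i \<in> Basis" for x i
    unfolding T_def by (rule inner_sum_left_Basis[OF that])
  have "continuous_on (cbox a b) T"
    unfolding T_def
    by (intro continuous_on_sum continuous_on_scaleR continuous_on_max continuous_on_min
        continuous_on_diff continuous_on_inner continuous_on_const continuous_on_id cont)
  moreover have "T \<in> cbox a b \<rightarrow> cbox a b"
    using ab by (simp add: mem_box T_inner Pi_iff)
  moreover have "cbox a b \<noteq> {}"
    using ab by (simp add: box_ne_empty)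
  ultimately obtain x where x: "x \<in> cbox a b" "T x = x"
    using brouwer[OF compact_cbox convex_box(1)] by metis
  have "f x \<bullet> i = 0" if i: "i \<in> Basis" for i
  proof -
    have "x \<bullet> i = max (a \<bullet> i) (min (b \<bullet> i) (x \<bullet> i - f x \<bullet> i))"
      using T_inner[OF i, of x] x by simp
    moreover have "a \<bullet> i \<le> x \<bullet> i" "x \<bullet> i \<le> b \<bullet> i"
      using x i by (auto simp: mem_box)
    ultimately show ?thesis
      using lower[OF x(1) i] upper[OF x(1) i] by linarith
  qed
  then have "f x = 0"
    by (simp add: euclidean_eq_iff[where x = "f x"])
  with x that show thesis by blast
qed

section \<open>The uniform law on [0, 1] and integrals of polynomials\<close>

definition unif :: "real measure" where
  "unif = uniform_measure lborel {0..1}"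

lemma sets_unif [simp, measurable_cong]: "sets unif = sets borel"
  by (simp add: unif_def)

lemma space_unif [simp]: "space unif = UNIV"
  by (simp add: unif_def)

lemma unif_eq_density: "unif = density lborel (\<lambda>x. ennreal (indicator {0..1} x))"
  unfolding unif_def uniform_measure_def
proof (rule density_cong)
  show "AE x in lborel. indicator {0..1} x / emeasure lborel {0..1::real} = ennreal (indicator {0..1::real} x)"
    by (rule AE_I2) (simp add: indicator_def)
qed simp_all

interpretation unif: prob_space unif
  unfolding unif_def by (rule prob_space_uniform_measure) simp_all

interpretation unif_prod: product_sigma_finite "\<lambda>_::nat. unif"
  by standard

abbreviation unit_ivl :: "real \<Rightarrow> bool" where
  "unit_ivl x \<equiv> 0 \<le> x \<and> x \<le> 1"

lemma AE_unif: "AE x in unif. unit_ivl x"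
  unfolding unif_eq_density by (subst AE_density) (auto simp: indicator_def)

lemma AE_unif_neq: "AE x in unif. x \<noteq> a"
  unfolding unif_eq_density using AE_lborel_singleton[of a] by (subst AE_density) (auto elim: eventually_mono)

lemma borel_measurable_poly [measurable]: "poly (p :: real poly) \<in> borel_measurable borel"
  by (intro borel_measurable_continuous_onI continuous_on_poly continuous_on_id)

text \<open>The antiderivative vanishing at 0, kept as a polynomial so that iterated integrals over
  a simplex become coefficient arithmetic that the simplifier can evaluate.\<close>

definition poly_int :: "real poly \<Rightarrow> real poly" where
  "poly_int p = pCons 0 (Poly (map (\<lambda>i. coeff p i / real (Suc i)) [0..<Suc (degree p)]))"

lemma pderiv_poly_int: "pderiv (poly_int p) = p"
proof (rule poly_eqI)
  fix n
  show "coeff (pderiv (poly_int p)) n = coeff p n"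
    by (auto simp: poly_int_def coeff_pderiv nth_default_def coeff_eq_0 simp del: upt_Suc)
qed

lemma poly_poly_int_0 [simp]: "poly (poly_int p) 0 = 0"
  by (simp add: poly_int_def)

lemma integral_unif_less:
  assumes t: "0 \<le> t" "t \<le> 1"
  shows "(\<integral>x. (if x < t then poly p x else 0) \<partial>unif) = poly (poly_int p) t"
proof -
  have "(\<integral>x. (if x < t then poly p x else 0) \<partial>unif)
      = (\<integral>x. indicator {0..1} x *\<^sub>R (if x < t then poly p x else 0) \<partial>lborel)"
    unfolding unif_eq_density by (subst integral_density) auto
  also have "\<dots> = (\<integral>x. indicator {0..t} x *\<^sub>R poly p x \<partial>lborel)"
  proof (intro integral_cong_AE)
    show "AE x in lborel. indicator {0..1} x *\<^sub>R (if x < t then poly p x else 0) = indicator {0..t} x *\<^sub>R poly p x"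
      using AE_lborel_singleton[of t] by eventually_elim (use t in \<open>auto simp: indicator_def\<close>)
  qed auto
  also have "\<dots> = poly (poly_int p) t - poly (poly_int p) 0"
  proof (rule integral_FTC_atLeastAtMost)
    show "(poly (poly_int p) has_vector_derivative poly p x) (at x within {0..t})" for x
      using poly_DERIV[of "poly_int p" x]
      by (auto simp: pderiv_poly_int has_real_derivative_iff_has_vector_derivative
          intro: has_vector_derivative_at_within)
    show "continuous_on {0..t} (poly p)"
      by (intro continuous_on_poly continuous_on_id)
  qed (use t in simp)
  finally show ?thesis by simp
qed

lemma integral_unif_poly: "(\<integral>x. poly p x \<partial>unif) = poly (poly_int p) 1"
proof -
  have "(\<integral>x. poly p x \<partial>unif) = (\<integral>x. (if x < 1 then poly p x else 0) \<partial>unif)"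
  proof (intro integral_cong_AE)
    show "AE x in unif. poly p x = (if x < 1 then poly p x else 0)"
      using AE_unif AE_unif_neq[of 1] by eventually_elim auto
  qed measurable
  then show ?thesis
    using integral_unif_less[of 1 p] by simp
qed

abbreviation cube :: "nat set \<Rightarrow> (nat \<Rightarrow> real) measure" where
  "cube I \<equiv> PiM I (\<lambda>_. unif)"

lemma AE_cube:
  assumes "finite I"
  shows "AE x in cube I. \<forall>i\<in>I. unit_ivl (x i)"
proof (rule AE_finite_allI[OF assms])
  fix i assume "i \<in> I"
  then show "AE x in cube I. unit_ivl (x i)"
    using AE_unif by (intro AE_PiM_component unif.prob_space_axioms)
qed

lemma prob_space_cube: "prob_space (cube I)"
  by (intro prob_space_PiM unif.prob_space_axioms)

lemma integrable_cube:
  fixes f :: "(nat \<Rightarrow> real) \<Rightarrow> real"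
  assumes "finite I" "f \<in> borel_measurable (cube I)"
    and bound: "\<And>x. (\<And>i. i \<in> I \<Longrightarrow> unit_ivl (x i)) \<Longrightarrow> \<bar>f x\<bar> \<le> B"
  shows "integrable (cube I) f"
proof (rule finite_measure.integrable_const_bound[where B = B])
  show "finite_measure (cube I)"
    by (rule prob_space.finite_measure[OF prob_space_cube])
  show "AE x in cube I. norm (f x) \<le> B"
    using AE_cube[OF assms(1)] by eventually_elim (use bound in auto)
qed (rule assms)

definition poly_bound :: "real poly \<Rightarrow> real" where
  "poly_bound p = 1 + (\<Sum>i\<le>degree p. \<bar>coeff p i\<bar>)"

lemma poly_bound:
  shows "poly_bound p \<ge> 1" and "0 \<le> x \<Longrightarrow> x \<le> 1 \<Longrightarrow> \<bar>poly p x\<bar> \<le> poly_bound p"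
proof -
  show "poly_bound p \<ge> 1"
    by (simp add: poly_bound_def sum_nonneg)
  assume x: "0 \<le> x" "x \<le> 1"
  have "\<bar>poly p x\<bar> \<le> (\<Sum>i\<le>degree p. \<bar>coeff p i * x ^ i\<bar>)"
    unfolding poly_altdef by (rule sum_abs)
  also have "\<dots> \<le> (\<Sum>i\<le>degree p. \<bar>coeff p i\<bar>)"
    using x by (intro sum_mono) (simp add: abs_mult power_le_one mult_left_le)
  finally show "\<bar>poly p x\<bar> \<le> poly_bound p"
    by (simp add: poly_bound_def)
qed

lemma measurable_cube_component:
  "i \<in> I \<Longrightarrow> (\<lambda>x. x i) \<in> borel_measurable (cube I)"
  using measurable_component_singleton[of i I "\<lambda>_. unif"]
  by (simp add: measurable_cong_sets[OF refl sets_unif])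

text \<open>One Fubini step. The coordinate i enters only through p and the constraint
  \<open>x i < x j\<close>, so integrating it out replaces p by its antiderivative at
  \<open>x j\<close>. The function h must be measurable on both cubes because it appears before and
  after coordinate i is removed.\<close>

lemma integral_smallest_coordinate:
  fixes h :: "(nat \<Rightarrow> real) \<Rightarrow> real"
  assumes I: "finite I" "i \<notin> I" "j \<in> I"
    and h: "h \<in> borel_measurable (cube I)" "\<And>x y. h (x(i := y)) = h x"
    and meas: "h \<in> borel_measurable (cube (insert i I))"
    and bound: "\<And>x. (\<And>i. i \<in> I \<Longrightarrow> unit_ivl (x i)) \<Longrightarrow> \<bar>h x\<bar> \<le> B"
  shows "(\<integral>x. (if x i < x j then poly p (x i) * h x else 0) \<partial>cube (insert i I))
    = (\<integral>x. poly (poly_int p) (x j) * h x \<partial>cube I)"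
proof -
  note C = poly_bound[where p = p]
  have ij: "i \<noteq> j" using I by auto
  define \<phi> where "\<phi> t = (\<integral>y. (if y < t then poly p y else 0) \<partial>unif)" for t
  have [measurable]: "\<phi> \<in> borel_measurable borel"
    unfolding \<phi>_def by (rule unif.borel_measurable_lebesgue_integral) measurable
  note meas[measurable] h(1)[measurable]
  have [measurable]: "(\<lambda>x. x i) \<in> borel_measurable (cube (insert i I))"
    "(\<lambda>x. x j) \<in> borel_measurable (cube (insert i I))"
    "(\<lambda>x. x j) \<in> borel_measurable (cube I)"
    by (rule measurable_cube_component, use I in simp)+
  have int: "integrable (cube (insert i I)) (\<lambda>x. if x i < x j then poly p (x i) * h x else 0)"
  proof (rule integrable_cube[where B = "poly_bound p * B"])
    fix x :: "nat \<Rightarrow> real" assume x: "\<And>k. k \<in> insert i I \<Longrightarrow> 0 \<le> x k \<and> x k \<le> 1"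
    then have "\<bar>h x\<bar> \<le> B" "\<bar>poly p (x i)\<bar> \<le> poly_bound p" using bound C by auto
    then have "\<bar>poly p (x i)\<bar> * \<bar>h x\<bar> \<le> poly_bound p * B" "0 \<le> poly_bound p * B"
      using C(1) by (auto intro: mult_mono mult_nonneg_nonneg order_trans[OF abs_ge_zero])
    then show "\<bar>if x i < x j then poly p (x i) * h x else 0\<bar> \<le> poly_bound p * B"
      by (simp add: abs_mult)
  next
    show "(\<lambda>x. if x i < x j then poly p (x i) * h x else 0) \<in> borel_measurable (cube (insert i I))"
      by measurable
  qed (use I in simp)
  have "(\<integral>x. (if x i < x j then poly p (x i) * h x else 0) \<partial>cube (insert i I))
    = (\<integral>x. (\<integral>y. (if y < x j then poly p y else 0) * h x \<partial>unif) \<partial>cube I)"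
    unfolding unif_prod.product_integral_insert[OF I(1,2) int]
    by (intro Bochner_Integration.integral_cong refl) (simp add: h(2) ij[symmetric])
  also have "\<dots> = (\<integral>x. \<phi> (x j) * h x \<partial>cube I)"
    unfolding \<phi>_def by (simp only: integral_mult_left_zero)
  also have "\<dots> = (\<integral>x. poly (poly_int p) (x j) * h x \<partial>cube I)"
  proof (rule integral_cong_AE)
    show "AE x in cube I. \<phi> (x j) * h x = poly (poly_int p) (x j) * h x"
      using AE_cube[OF I(1)] by eventually_elim (use I in \<open>simp add: integral_unif_less \<phi>_def\<close>)
  qed measurable
  finally show ?thesis .
qed

section \<open>Order statistics of four uniform points\<close>

definition ordered4 :: "(nat \<Rightarrow> real) \<Rightarrow> bool" where
  "ordered4 x \<longleftrightarrow> x 0 < x 1 \<and> x 1 < x 2 \<and> x 2 < x 3"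

text \<open>The iterated integral over x0 < x1 < x2 < x3 < 1; the innermost antiderivative belongs
  to the smallest coordinate.\<close>

definition simplex_int :: "real poly \<Rightarrow> real poly \<Rightarrow> real poly \<Rightarrow> real poly \<Rightarrow> real" where
  "simplex_int p0 p1 p2 p3 = poly (poly_int (p3 * poly_int (p2 * poly_int (p1 * poly_int p0)))) 1"

lemma lessThan_4: "{..<4::nat} = {0, 1, 2, 3}"
  by (auto simp: numeral_eq_Suc less_Suc_eq)

lemma integral_ordered4:
  "(\<integral>x. (if ordered4 x then poly p0 (x 0) * poly p1 (x 1) * poly p2 (x 2) * poly p3 (x 3) else 0)
      \<partial>cube {..<4}) = simplex_int p0 p1 p2 p3"
proof -
  note C1 = poly_bound[where p = p1]
  note C2 = poly_bound[where p = p2]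
  note C3 = poly_bound[where p = p3]
  let ?h1 = "\<lambda>x::nat \<Rightarrow> real. if x 1 < x 2 \<and> x 2 < x 3 then poly p1 (x 1) * poly p2 (x 2) * poly p3 (x 3) else 0"
  let ?h2 = "\<lambda>x::nat \<Rightarrow> real. if x 2 < x 3 then poly p2 (x 2) * poly p3 (x 3) else 0"
  let ?h3 = "\<lambda>x. poly p3 (x (3::nat))"
  let ?q1 = "p1 * poly_int p0"
  let ?q2 = "p2 * poly_int ?q1"
  let ?q3 = "p3 * poly_int ?q2"
  let ?U = "\<lambda>I. cube I"
  have "(\<integral>x. (if ordered4 x then poly p0 (x 0) * poly p1 (x 1) * poly p2 (x 2) * poly p3 (x 3) else 0) \<partial>?U {..<4})
      = (\<integral>x. (if x 0 < x 1 then poly p0 (x 0) * ?h1 x else 0) \<partial>?U (insert 0 {1,2,3}))"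
    unfolding lessThan_4 by (intro Bochner_Integration.integral_cong) (auto simp: ordered4_def)
  also have "\<dots> = (\<integral>x. poly (poly_int p0) (x 1) * ?h1 x \<partial>?U {1,2,3})"
  proof (rule integral_smallest_coordinate[where B = "poly_bound p1 * poly_bound p2 * poly_bound p3"])
    show "\<bar>?h1 x\<bar> \<le> poly_bound p1 * poly_bound p2 * poly_bound p3" if "\<And>i. i \<in> {1,2,3} \<Longrightarrow> unit_ivl (x i)" for x
      using that[of 1] that[of 2] that[of 3] C1 C2 C3 by (auto simp: abs_mult intro!: mult_mono)
    show "?h1 \<in> borel_measurable (?U {1,2,3})" "?h1 \<in> borel_measurable (?U (insert 0 {1,2,3}))"
      by measurable
  qed simp_all
  also have "\<dots> = (\<integral>x. (if x 1 < x 2 then poly ?q1 (x 1) * ?h2 x else 0) \<partial>?U (insert 1 {2,3}))"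
    by (intro Bochner_Integration.integral_cong) auto
  also have "\<dots> = (\<integral>x. poly (poly_int ?q1) (x 2) * ?h2 x \<partial>?U {2,3})"
  proof (rule integral_smallest_coordinate[where B = "poly_bound p2 * poly_bound p3"])
    show "\<bar>?h2 x\<bar> \<le> poly_bound p2 * poly_bound p3" if "\<And>i. i \<in> {2,3} \<Longrightarrow> unit_ivl (x i)" for x
      using that[of 2] that[of 3] C2 C3 by (auto simp: abs_mult intro!: mult_mono)
    show "?h2 \<in> borel_measurable (?U {2,3})" "?h2 \<in> borel_measurable (?U (insert 1 {2,3}))"
      by measurable
  qed simp_all
  also have "\<dots> = (\<integral>x. (if x 2 < x 3 then poly ?q2 (x 2) * ?h3 x else 0) \<partial>?U (insert 2 {3}))"
    by (intro Bochner_Integration.integral_cong) auto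
  also have "\<dots> = (\<integral>x. poly (poly_int ?q2) (x 3) * ?h3 x \<partial>?U {3})"
  proof (rule integral_smallest_coordinate[where B = "poly_bound p3"])
    show "\<bar>?h3 x\<bar> \<le> poly_bound p3" if "\<And>i. i \<in> {3} \<Longrightarrow> unit_ivl (x i)" for x
      using that[of 3] C3 by auto
    show "?h3 \<in> borel_measurable (?U {3})" "?h3 \<in> borel_measurable (?U (insert 2 {3}))"
      by measurable
  qed simp_all
  also have "\<dots> = (\<integral>x. poly ?q3 (x 3) \<partial>?U {3})"
    by (intro Bochner_Integration.integral_cong) auto
  also have "\<dots> = (\<integral>x. poly ?q3 x \<partial>unif)"
    by (rule unif_prod.product_integral_singleton) measurable
  also have "\<dots> = simplex_int p0 p1 p2 p3"
    unfolding integral_unif_poly simplex_int_def ..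
  finally show ?thesis .
qed

text \<open>The law of the order statistics is obtained by conditioning four independent uniform
  points on being listed in increasing order. By symmetry this agrees with sorting them, and it
  gives a density that is constant on a simplex.\<close>

definition order_stats :: "(nat \<Rightarrow> real) measure" where
  "order_stats = uniform_measure (cube {..<4}) {x \<in> space (cube {..<4}). ordered4 x}"

lemma pred_ordered4 [measurable]: "Measurable.pred (cube {..<4}) ordered4"
  unfolding ordered4_def by measurable

lemma measure_ordered4:
  "measure (cube {..<4}) {x \<in> space (cube {..<4}). ordered4 x} = 1 / 24"
proof -
  let ?M = "cube {..<4}"
  have "measure ?M {x \<in> space ?M. ordered4 x} = (\<integral>x. indicator {x \<in> space ?M. ordered4 x} x \<partial>?M)"
    by simp
  also have "\<dots> = (\<integral>x. (if ordered4 x then poly 1 (x 0) * poly 1 (x 1) * poly 1 (x 2) * poly 1 (x 3) else 0) \<partial>?M)"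
    by (intro Bochner_Integration.integral_cong) (auto simp: indicator_def)
  also have "\<dots> = simplex_int 1 1 1 1"
    by (rule integral_ordered4)
  also have "\<dots> = 1 / 24"
    by (simp add: simplex_int_def poly_int_def one_pCons numeral_eq_Suc)
  finally show ?thesis .
qed

lemma emeasure_ordered4:
  "emeasure (cube {..<4}) {x \<in> space (cube {..<4}). ordered4 x} = ennreal (1 / 24)"
  using prob_space.finite_measure[OF prob_space_cube]
  by (simp add: finite_measure.emeasure_eq_measure measure_ordered4)

lemma sets_order_stats [simp, measurable_cong]: "sets order_stats = sets (PiM {..<4} (\<lambda>_. borel))"
  by (simp add: order_stats_def cong: sets_PiM_cong)

interpretation order_stats: prob_space order_stats
  unfolding order_stats_def
  by (rule prob_space_uniform_measure) (simp_all add: emeasure_ordered4)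

lemma AE_order_stats: "AE x in order_stats. \<forall>i<4. unit_ivl (x i)"
  unfolding order_stats_def
proof (rule AE_uniform_measureI)
  show "AE x in cube {..<4}. x \<in> {x \<in> space (cube {..<4}). ordered4 x} \<longrightarrow>
      (\<forall>i<4. unit_ivl (x i))"
    using AE_cube[of "{..<4}"] by (auto elim: eventually_mono)
qed measurable

lemma order_stats_eq_density:
  "order_stats = density (cube {..<4}) (\<lambda>x. ennreal (if ordered4 x then 24 else 0))"
  unfolding order_stats_def uniform_measure_def emeasure_ordered4
proof (rule density_cong)
  show "AE x in cube {..<4}.
      indicator {x \<in> space (cube {..<4}). ordered4 x} x / ennreal (1 / 24)
        = ennreal (if ordered4 x then 24 else 0)"
    by (rule AE_I2) (auto simp: indicator_def divide_ennreal simp flip: ennreal_1)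
qed measurable

lemma integral_order_stats_poly:
  "(\<integral>x. poly p0 (x 0) * poly p1 (x 1) * poly p2 (x 2) * poly p3 (x 3) \<partial>order_stats)
    = 24 * simplex_int p0 p1 p2 p3"
proof -
  have "(\<integral>x. poly p0 (x 0) * poly p1 (x 1) * poly p2 (x 2) * poly p3 (x 3) \<partial>order_stats)
     = (\<integral>x. 24 * (if ordered4 x then poly p0 (x 0) * poly p1 (x 1) * poly p2 (x 2) * poly p3 (x 3) else 0)
          \<partial>cube {..<4})"
    unfolding order_stats_eq_density
  proof (subst integral_density)
    show "(\<integral>x. (if ordered4 x then 24 else 0) *\<^sub>R
          (poly p0 (x 0) * poly p1 (x 1) * poly p2 (x 2) * poly p3 (x 3)) \<partial>cube {..<4})
      = (\<integral>x. 24 * (if ordered4 x then poly p0 (x 0) * poly p1 (x 1) * poly p2 (x 2) * poly p3 (x 3) else 0)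
          \<partial>cube {..<4})"
      by (intro Bochner_Integration.integral_cong) auto
  qed simp_all
  then show ?thesis
    by (simp only: integral_mult_right_zero integral_ordered4)
qed

text \<open>In terms of shifted Legendre polynomials these are \<open>P\<^sub>4 + P\<^sub>5\<close> and \<open>P\<^sub>5 + 2 P\<^sub>6\<close>; this combination makes
  the discriminant condition in \<open>bil_table\<close> true for every split into two pairs.\<close>

definition high :: "nat \<Rightarrow> real poly" where
  "high k = (if k = 0 then [:0, 10, -120, 420, -560, 252:] else [:1, -54, 630, -2800, 5670, -5292, 1848:])"

text \<open>The cubics determined by \<open>mean_dual\<close>.\<close>

definition dual :: "nat \<Rightarrow> real poly" where
  "dual i = [[:4, -30, 60, -35:], [:-6, 70, -165, 105:], [:4, -55, 150, -105:], [:-1, 15, -45, 35:]] ! i"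

lemma order_stats_mean_poly:
  "(\<integral>x. poly p (x 0) \<partial>order_stats) = 24 * simplex_int p 1 1 1"
  "(\<integral>x. poly p (x 1) \<partial>order_stats) = 24 * simplex_int 1 p 1 1"
  "(\<integral>x. poly p (x 2) \<partial>order_stats) = 24 * simplex_int 1 1 p 1"
  "(\<integral>x. poly p (x 3) \<partial>order_stats) = 24 * simplex_int 1 1 1 p"
  using integral_order_stats_poly[of p 1 1 1] integral_order_stats_poly[of 1 p 1 1]
    integral_order_stats_poly[of 1 1 p 1] integral_order_stats_poly[of 1 1 1 p] by simp_all

lemma order_stats_mean_poly2:
  "(\<integral>x. poly p (x 0) * poly q (x 1) \<partial>order_stats) = 24 * simplex_int p q 1 1"
  "(\<integral>x. poly p (x 0) * poly q (x 2) \<partial>order_stats) = 24 * simplex_int p 1 q 1"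
  "(\<integral>x. poly p (x 0) * poly q (x 3) \<partial>order_stats) = 24 * simplex_int p 1 1 q"
  "(\<integral>x. poly p (x 1) * poly q (x 2) \<partial>order_stats) = 24 * simplex_int 1 p q 1"
  "(\<integral>x. poly p (x 1) * poly q (x 3) \<partial>order_stats) = 24 * simplex_int 1 p 1 q"
  "(\<integral>x. poly p (x 2) * poly q (x 3) \<partial>order_stats) = 24 * simplex_int 1 1 p q"
  using integral_order_stats_poly[of p q 1 1] integral_order_stats_poly[of p 1 q 1]
    integral_order_stats_poly[of p 1 1 q] integral_order_stats_poly[of 1 p q 1]
    integral_order_stats_poly[of 1 p 1 q] integral_order_stats_poly[of 1 1 p q] by simp_all

lemma less_4_cases: "i < 4 \<Longrightarrow> i = 0 \<or> i = 1 \<or> i = 2 \<or> i = (3::nat)"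
  by auto

text \<open>Each order statistic of four uniform points has a Bernstein polynomial of degree 3 as
  density (up to a factor), so these means vanish because \<open>high k\<close> is orthogonal to all
  cubics. The proof evaluates the simplex integrals directly.\<close>

lemma mean_high_table:
  "(\<integral>x. poly (high k) (x 0) \<partial>order_stats) = 0" "(\<integral>x. poly (high k) (x 1) \<partial>order_stats) = 0"
  "(\<integral>x. poly (high k) (x 2) \<partial>order_stats) = 0" "(\<integral>x. poly (high k) (x 3) \<partial>order_stats) = 0"
  unfolding order_stats_mean_poly
  by (cases "k = 0"; simp add: simplex_int_def poly_int_def one_pCons high_def numeral_eq_Suc)+

lemma mean_high: "i < 4 \<Longrightarrow> (\<integral>x. poly (high k) (x i) \<partial>order_stats) = 0"
  by (drule less_4_cases) (auto simp: mean_high_table[simplified])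

text \<open>The Bernstein polynomials of degree 3 are a basis of the cubics, so a dual basis exists.
  It makes each entry of X in \<open>low X\<close> an independent parameter, read off at exactly one
  pair of a position and a value.\<close>

lemma mean_dual_table:
  "(\<integral>x. poly (dual i) (x 0) \<partial>order_stats) = of_bool (i = 0)"
  "(\<integral>x. poly (dual i) (x 1) \<partial>order_stats) = of_bool (i = 1)"
  "(\<integral>x. poly (dual i) (x 2) \<partial>order_stats) = of_bool (i = 2)"
  "(\<integral>x. poly (dual i) (x 3) \<partial>order_stats) = of_bool (i = 3)" if "i = 0 \<or> i = 1 \<or> i = 2 \<or> i = (3::nat)"
  unfolding order_stats_mean_poly using that
  by (elim disjE; simp add: simplex_int_def poly_int_def one_pCons dual_def numeral_eq_Suc)+

lemma mean_dual: "i < 4 \<Longrightarrow> j < 4 \<Longrightarrow> (\<integral>x. poly (dual i) (x j) \<partial>order_stats) = of_bool (i = j)"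
  using mean_dual_table[OF less_4_cases, of i] by (drule_tac i = j in less_4_cases) auto

definition mom :: "nat \<Rightarrow> nat \<Rightarrow> nat \<Rightarrow> nat \<Rightarrow> real" where
  "mom k l i j = (\<integral>x. poly (high k) (x i) * poly (high l) (x j) \<partial>order_stats)"

lemma mom_swap: "mom k l i j = mom l k j i"
  by (simp add: mom_def mult.commute)

text \<open>The pairs i < j suffice: \<open>mom_swap\<close> gives i > j, and the second-order term
  only ever combines two different points.\<close>

lemma mom_table:
  shows "mom 0 0 0 1 = 5 / 1001"
    and "mom 0 0 0 2 = - 10 / 1001"
    and "mom 0 0 0 3 = 0"
    and "mom 0 0 1 2 = 40 / 3003"
    and "mom 0 0 1 3 = - 50 / 3003"
    and "mom 0 0 2 3 = 25 / 3003"
    and "mom 0 1 0 1 = 263 / 15015"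
    and "mom 0 1 0 2 = 82 / 15015"
    and "mom 0 1 0 3 = - 29 / 15015"
    and "mom 0 1 1 2 = 24 / 455"
    and "mom 0 1 1 3 = - 8 / 5005"
    and "mom 0 1 2 3 = 362 / 5005"
    and "mom 1 0 0 1 = - 316 / 15015"
    and "mom 1 0 0 2 = 8 / 5005"
    and "mom 1 0 0 3 = 29 / 15015"
    and "mom 1 0 1 2 = - 24 / 455"
    and "mom 1 0 1 3 = - 82 / 15015"
    and "mom 1 0 2 3 = - 1033 / 15015"
    and "mom 1 1 0 1 = 1 / 165"
    and "mom 1 1 0 2 = - 2 / 165"
    and "mom 1 1 0 3 = 0"
    and "mom 1 1 1 2 = 34 / 2145"
    and "mom 1 1 1 3 = - 14 / 715"
    and "mom 1 1 2 3 = 7 / 715"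
  unfolding mom_def order_stats_mean_poly2
  by (simp_all add: simplex_int_def poly_int_def one_pCons high_def numeral_eq_Suc)

section \<open>The perturbed densities\<close>

abbreviation order_stats2 :: "((nat \<Rightarrow> real) \<times> (nat \<Rightarrow> real)) measure" where
  "order_stats2 \<equiv> order_stats \<Otimes>\<^sub>M order_stats"

interpretation order_stats2: pair_prob_space order_stats order_stats
  by standard

lemma AE_order_stats2:
  "AE z in order_stats2. \<forall>i<4. 0 \<le> fst z i \<and> fst z i \<le> 1 \<and> 0 \<le> snd z i \<and> snd z i \<le> 1"
proof (rule order_stats2.AE_pair_measure)
  have "{z \<in> space order_stats2. \<forall>i\<in>{..<4}. 0 \<le> fst z i \<and> fst z i \<le> 1 \<and> 0 \<le> snd z i \<and> snd z i \<le> 1}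
      \<in> sets order_stats2"
  proof (rule sets.sets_Collect_finite_All)
    fix i :: nat assume [measurable]: "i \<in> {..<4}"
    show "{z \<in> space order_stats2. 0 \<le> fst z i \<and> fst z i \<le> 1 \<and> 0 \<le> snd z i \<and> snd z i \<le> 1}
        \<in> sets order_stats2"
      by measurable
  next
    show "finite {..<4::nat}" by simp
  qed
  then show "{z \<in> space order_stats2. \<forall>i<4. 0 \<le> fst z i \<and> fst z i \<le> 1 \<and> 0 \<le> snd z i \<and> snd z i \<le> 1}
      \<in> sets order_stats2"
    unfolding Ball_def lessThan_iff .
  show "AE x in order_stats. AE y in order_stats. \<forall>i<4. 0 \<le> fst (x, y) i \<and> fst (x, y) i \<le> 1
      \<and> 0 \<le> snd (x, y) i \<and> snd (x, y) i \<le> 1"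
    using AE_order_stats
  proof eventually_elim
    case (elim x)
    note x = this
    show ?case
      using AE_order_stats
    proof eventually_elim
      case (elim y)
      with x show ?case
        unfolding fst_conv snd_conv by blast
    qed
  qed
qed

lemma integrable_order_stats2:
  fixes f :: "_ \<Rightarrow> real"
  assumes "f \<in> borel_measurable order_stats2"
    and bound: "\<And>x y. (\<And>i. i < 4 \<Longrightarrow> unit_ivl (x i)) \<Longrightarrow> (\<And>i. i < 4 \<Longrightarrow> unit_ivl (y i))
      \<Longrightarrow> \<bar>f (x, y)\<bar> \<le> B"
  shows "integrable order_stats2 f"
proof (rule order_stats2.integrable_const_bound[where B = B])
  show "AE z in order_stats2. norm (f z) \<le> B"
    using AE_order_stats2
  proof eventually_elim
    case (elim z)
    then show ?case using bound[of "fst z" "snd z"] unfolding prod.collapse real_norm_def by blast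
  qed
qed (rule assms)

lemma integral_order_stats2_mult:
  fixes f g :: "_ \<Rightarrow> real"
  assumes "integrable order_stats2 (\<lambda>z. f (fst z) * g (snd z))"
  shows "(\<integral>z. f (fst z) * g (snd z) \<partial>order_stats2) = (\<integral>x. f x \<partial>order_stats) * (\<integral>y. g y \<partial>order_stats)"
proof -
  have "(\<integral>z. f (fst z) * g (snd z) \<partial>order_stats2)
      = (\<integral>x. (\<integral>y. f x * g y \<partial>order_stats) \<partial>order_stats)"
    using order_stats2.integral_fst'[OF assms] by simp
  also have "\<dots> = (\<integral>x. f x \<partial>order_stats) * (\<integral>y. g y \<partial>order_stats)"
    by (simp only: integral_mult_right_zero integral_mult_left_zero)
  finally show ?thesis .
qed

text \<open>The quantity N of the overview. The pattern is a function on {0, 1, 2, 3} rather than a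
  list, so that it can index the order statistics; \<open>idx\<close> translates from lists.\<close>

definition pattern_wt :: "(nat \<Rightarrow> nat) \<Rightarrow> (real \<Rightarrow> real \<Rightarrow> real) \<Rightarrow> real" where
  "pattern_wt s w = (\<integral>z. (\<Prod>i<4. w (fst z i) (snd z (s i))) \<partial>order_stats2)"

definition base :: "real \<Rightarrow> real \<Rightarrow> real \<Rightarrow> real" where
  "base t x y = poly (high 0) x * poly (high 0) y + t * (poly (high 1) x * poly (high 1) y)"

definition low :: "(nat \<Rightarrow> nat \<Rightarrow> real) \<Rightarrow> real \<Rightarrow> real \<Rightarrow> real" where
  "low X x y = (\<Sum>i<4. \<Sum>j<4. X i j * (poly (dual i) x * poly (dual j) y))"

text \<open>The factor of \<open>low\<close> is the square of e because this is the first order at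
  which \<open>base\<close> has an effect on the weights; both effects then enter the same
  equation.\<close>

definition kern :: "real \<Rightarrow> real \<Rightarrow> (nat \<Rightarrow> nat \<Rightarrow> real) \<Rightarrow> real \<Rightarrow> real \<Rightarrow> real" where
  "kern e t X x y = 1 + e * base t x y + e\<^sup>2 * low X x y"

text \<open>The mean of \<open>base t\<close> at (X_i, Y_a) times \<open>base t\<close> at (X_j,
  Y_b). Independence of the two systems splits each term into a moment of positions times a moment
  of values.\<close>

definition corr :: "real \<Rightarrow> nat \<Rightarrow> nat \<Rightarrow> nat \<Rightarrow> nat \<Rightarrow> real" where
  "corr t i j a b = mom 0 0 i j * mom 0 0 a b + t * (mom 0 1 i j * mom 0 1 a b + mom 1 0 i j * mom 1 0 a b)
     + t\<^sup>2 * (mom 1 1 i j * mom 1 1 a b)"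

text \<open>The contribution of \<open>base t\<close> to the coefficient of \<open>e\<^sup>2\<close> in \<open>pattern_wt s (kern e t X)\<close>.\<close>

definition quad :: "(nat \<Rightarrow> nat) \<Rightarrow> real \<Rightarrow> real" where
  "quad s t = corr t 0 1 (s 0) (s 1) + corr t 0 2 (s 0) (s 2) + corr t 0 3 (s 0) (s 3)
     + corr t 1 2 (s 1) (s 2) + corr t 1 3 (s 1) (s 3) + corr t 2 3 (s 2) (s 3)"

definition kern_const :: "real \<Rightarrow> real" where
  "kern_const R = 1 + (poly_bound (high 0) * poly_bound (high 0) + \<bar>R\<bar> * (poly_bound (high 1) * poly_bound (high 1)))
     + (\<Sum>i<4. \<Sum>j<4. \<bar>R\<bar> * (poly_bound (dual i) * poly_bound (dual j)))"

lemma kern_const: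
  shows "kern_const R \<ge> 1"
    and "\<bar>t\<bar> \<le> R \<Longrightarrow> unit_ivl x \<Longrightarrow> unit_ivl y \<Longrightarrow> \<bar>base t x y\<bar> \<le> kern_const R"
    and "(\<And>i j. i < 4 \<Longrightarrow> j < 4 \<Longrightarrow> \<bar>X i j\<bar> \<le> R) \<Longrightarrow> unit_ivl x \<Longrightarrow> unit_ivl y
      \<Longrightarrow> \<bar>low X x y\<bar> \<le> kern_const R"
proof -
  let ?A = "poly_bound (high 0) * poly_bound (high 0) + \<bar>R\<bar> * (poly_bound (high 1) * poly_bound (high 1))" and ?B = "\<Sum>i<4. \<Sum>j<4. \<bar>R\<bar> * (poly_bound (dual i) * poly_bound (dual j))"
  have H0: "0 \<le> poly_bound (high k)" "0 \<le> poly_bound (dual k)" for k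
    using poly_bound(1)[of "high k"] poly_bound(1)[of "dual k"] by auto
  have nn: "0 \<le> ?A" "0 \<le> ?B"
    using H0 by (auto intro!: add_nonneg_nonneg mult_nonneg_nonneg sum_nonneg)
  have mult: "\<bar>a * b\<bar> \<le> A * B" if "\<bar>a\<bar> \<le> A" "\<bar>b\<bar> \<le> B" for a b A B :: real
    using that by (simp add: abs_mult mult_mono')
  have C: "kern_const R = 1 + ?A + ?B"
    unfolding kern_const_def ..
  show "kern_const R \<ge> 1" using nn C by simp
  show "\<bar>base t x y\<bar> \<le> kern_const R" if "\<bar>t\<bar> \<le> R" "unit_ivl x" "unit_ivl y"
  proof -
    have "\<bar>base t x y\<bar> \<le> \<bar>poly (high 0) x * poly (high 0) y\<bar> + \<bar>t * (poly (high 1) x * poly (high 1) y)\<bar>"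
      unfolding base_def by (rule abs_triangle_ineq)
    also have "\<dots> \<le> ?A"
      using that by (intro add_mono mult poly_bound) auto
    finally show ?thesis using nn C by linarith
  qed
  show "\<bar>low X x y\<bar> \<le> kern_const R"
    if "\<And>i j. i < 4 \<Longrightarrow> j < 4 \<Longrightarrow> \<bar>X i j\<bar> \<le> R" "unit_ivl x" "unit_ivl y"
  proof -
    have "\<bar>low X x y\<bar> \<le> (\<Sum>i<4. \<Sum>j<4. \<bar>X i j * (poly (dual i) x * poly (dual j) y)\<bar>)"
      unfolding low_def by (intro order_trans[OF sum_abs] sum_mono sum_abs)
    also have "\<dots> \<le> ?B"
      using that by (intro sum_mono mult order_trans[OF _ abs_ge_self] poly_bound) auto
    finally show ?thesis using nn C by linarith
  qed
qed

text \<open>Each factor is 1 + e u with u = b + e l and |u| at most 2 C. In the expansion by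
  elementary symmetric polynomials of the u's, the four triples and the single quadruple are already
  of third order. Each of the six pairs is \<open>b i * b j\<close> plus e times a remainder
  \<open>c i j\<close> of size at most 3 times the square of C, which gives the 18.\<close>

lemma prod4_expansion_bound:
  fixes b l :: "nat \<Rightarrow> real"
  assumes C: "C \<ge> 1" and b: "\<And>i. i < 4 \<Longrightarrow> \<bar>b i\<bar> \<le> C" and l: "\<And>i. i < 4 \<Longrightarrow> \<bar>l i\<bar> \<le> C"
    and e: "0 \<le> e" "e \<le> 1"
  shows "\<bar>(\<Prod>i<4. 1 + e * b i + e\<^sup>2 * l i) - (1 + e * (b 0 + b 1 + b 2 + b 3)
      + e\<^sup>2 * (l 0 + l 1 + l 2 + l 3 + (b 0 * b 1 + b 0 * b 2 + b 0 * b 3 + b 1 * b 2 + b 1 * b 3 + b 2 * b 3)))\<bar>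
    \<le> e ^ 3 * (18 * C\<^sup>2 + 4 * (2 * C) ^ 3 + (2 * C) ^ 4)" (is "\<bar>?L\<bar> \<le> _")
proof -
  define u where "u i = b i + e * l i" for i
  define c where "c i j = b i * l j + l i * b j + e * (l i * l j)" for i j
  define E3 where "E3 = u 0 * u 1 * u 2 + u 0 * u 1 * u 3 + u 0 * u 2 * u 3 + u 1 * u 2 * u 3"
  define E4 where "E4 = u 0 * u 1 * u 2 * u 3"
  have mult: "\<bar>a * b\<bar> \<le> A * B" if "\<bar>a\<bar> \<le> A" "\<bar>b\<bar> \<le> B" for a b A B :: real
    using that by (simp add: abs_mult mult_mono')
  have el: "\<bar>e * x\<bar> \<le> A" if "\<bar>x\<bar> \<le> A" for x A
    using mult[of e 1 x A] that e by simp
  have u: "\<bar>u i\<bar> \<le> 2 * C" if "i < 4" for i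
    using b[OF that] el[OF l[OF that]] unfolding u_def by linarith
  have c: "\<bar>c i j\<bar> \<le> 3 * C\<^sup>2" if "i < 4" "j < 4" for i j
    using mult[OF b[OF that(1)] l[OF that(2)]] mult[OF l[OF that(1)] b[OF that(2)]]
      el[OF mult[OF l[OF that(1)] l[OF that(2)]]]
    unfolding c_def power2_eq_square by linarith
  have su: "u 0 + u 1 + u 2 + u 3 = b 0 + b 1 + b 2 + b 3 + e * (l 0 + l 1 + l 2 + l 3)"
    unfolding u_def by (simp add: algebra_simps)
  have uu: "u i * u j = b i * b j + e * c i j" for i j
    unfolding u_def c_def by (simp add: algebra_simps power2_eq_square power3_eq_cube)
  have u3: "\<bar>u i * u j * u k\<bar> \<le> (2 * C) ^ 3" if "i < 4" "j < 4" "k < 4" for i j k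
    using mult[OF mult[OF u[OF that(1)] u[OF that(2)]] u[OF that(3)]] by (simp add: power3_eq_cube)
  have E3: "\<bar>E3\<bar> \<le> 4 * (2 * C) ^ 3"
  proof -
    have "\<bar>u 0 * u 1 * u 2\<bar> \<le> (2 * C) ^ 3" "\<bar>u 0 * u 1 * u 3\<bar> \<le> (2 * C) ^ 3"
      "\<bar>u 0 * u 2 * u 3\<bar> \<le> (2 * C) ^ 3" "\<bar>u 1 * u 2 * u 3\<bar> \<le> (2 * C) ^ 3"
      by (rule u3; simp)+
    then show ?thesis unfolding E3_def abs_le_iff by linarith
  qed
  have "\<bar>u 0 * u 1 * u 2 * u 3\<bar> \<le> (2 * C) ^ 3 * (2 * C)"
    by (rule mult; rule u3 u; simp)
  then have "\<bar>E4\<bar> \<le> (2 * C) ^ 4"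
    unfolding E4_def by (simp only: power4_eq_xxxx power3_eq_cube mult.assoc)
  then have E4: "\<bar>e * E4\<bar> \<le> (2 * C) ^ 4"
    by (rule el)
  have "(\<Prod>i<4. 1 + e * b i + e\<^sup>2 * l i) = (\<Prod>i<4. 1 + e * u i)"
    by (intro prod.cong) (simp_all add: u_def power2_eq_square algebra_simps)
  also have "\<dots> = (1 + e * u 0) * (1 + e * u 1) * (1 + e * u 2) * (1 + e * u 3)"
    by (simp add: lessThan_4 mult.assoc)
  also have "\<dots> = 1 + e * (u 0 + u 1 + u 2 + u 3)
      + e\<^sup>2 * (u 0 * u 1 + u 0 * u 2 + u 0 * u 3 + u 1 * u 2 + u 1 * u 3 + u 2 * u 3) + e ^ 3 * E3 + e ^ 3 * (e * E4)"
    unfolding E3_def E4_def by (simp add: algebra_simps power2_eq_square power3_eq_cube)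
  finally have "?L = e ^ 3 * ((c 0 1 + c 0 2 + c 0 3 + c 1 2 + c 1 3 + c 2 3) + E3 + e * E4)"
    unfolding uu su by (simp add: algebra_simps power2_eq_square power3_eq_cube)
  moreover have "\<bar>(c 0 1 + c 0 2 + c 0 3 + c 1 2 + c 1 3 + c 2 3) + E3 + e * E4\<bar> \<le> 18 * C\<^sup>2 + 4 * (2 * C) ^ 3 + (2 * C) ^ 4"
  proof -
    have "\<bar>c 0 1\<bar> \<le> 3 * C\<^sup>2" "\<bar>c 0 2\<bar> \<le> 3 * C\<^sup>2" "\<bar>c 0 3\<bar> \<le> 3 * C\<^sup>2"
      "\<bar>c 1 2\<bar> \<le> 3 * C\<^sup>2" "\<bar>c 1 3\<bar> \<le> 3 * C\<^sup>2" "\<bar>c 2 3\<bar> \<le> 3 * C\<^sup>2"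
      by (rule c; simp)+
    then show ?thesis using E3 E4 unfolding abs_le_iff by linarith
  qed
  ultimately show ?thesis
    using e by (simp only: abs_mult) (auto intro: mult_left_mono)
qed

lemma integrable_order_stats2_prod:
  fixes f :: "nat \<Rightarrow> real \<Rightarrow> real \<Rightarrow> real"
  assumes I: "finite I" "I \<subseteq> {..<4}" and s: "\<And>i. i < 4 \<Longrightarrow> s i < 4"
    and meas: "\<And>i. i \<in> I \<Longrightarrow> (\<lambda>(x, y). f i x y) \<in> borel_measurable (borel \<Otimes>\<^sub>M borel)"
    and bound: "\<And>i x y. i \<in> I \<Longrightarrow> unit_ivl x \<Longrightarrow> unit_ivl y \<Longrightarrow> \<bar>f i x y\<bar> \<le> C"
  shows "integrable order_stats2 (\<lambda>z. \<Prod>i\<in>I. f i (fst z i) (snd z (s i)))"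
proof (rule integrable_order_stats2[where B = "\<Prod>i\<in>I. C"])
  show "(\<lambda>z. \<Prod>i\<in>I. f i (fst z i) (snd z (s i))) \<in> borel_measurable order_stats2"
  proof (rule borel_measurable_prod)
    fix i assume i: "i \<in> I"
    then have [measurable]: "i \<in> {..<4}" "s i \<in> {..<4}" using I s by auto
    have "(\<lambda>z. (fst z i, snd z (s i))) \<in> order_stats2 \<rightarrow>\<^sub>M borel \<Otimes>\<^sub>M borel"
      by measurable
    from measurable_compose[OF this meas[OF i]]
    show "(\<lambda>z. f i (fst z i) (snd z (s i))) \<in> borel_measurable order_stats2"
      by simp
  qed
next
  fix x y :: "nat \<Rightarrow> real"
  assume xy: "\<And>i. i < 4 \<Longrightarrow> unit_ivl (x i)" "\<And>i. i < 4 \<Longrightarrow> unit_ivl (y i)"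
  have "\<bar>f i (x i) (y (s i))\<bar> \<le> C" if "i \<in> I" for i
    using that I s by (intro bound xy) auto
  then show "\<bar>\<Prod>i\<in>I. f i (fst (x, y) i) (snd (x, y) (s i))\<bar> \<le> (\<Prod>i\<in>I. C)"
    unfolding abs_prod fst_conv snd_conv by (intro prod_mono) auto
qed

lemma measurable_base [measurable]: "(\<lambda>(x, y). base t x y) \<in> borel_measurable (borel \<Otimes>\<^sub>M borel)"
  unfolding base_def by measurable

lemma measurable_low [measurable]: "(\<lambda>(x, y). low X x y) \<in> borel_measurable (borel \<Otimes>\<^sub>M borel)"
  unfolding low_def by measurable

lemma measurable_kern [measurable]: "(\<lambda>(x, y). kern e t X x y) \<in> borel_measurable (borel \<Otimes>\<^sub>M borel)"
  unfolding kern_def by measurable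

lemma integral_poly_order_stats2:
  fixes p p' q q' :: "real poly"
  assumes ij: "i < 4" "j < 4" "a < 4" "b < 4"
  defines "f \<equiv> \<lambda>x. poly p (x i) * poly p' (x j)" and "g \<equiv> \<lambda>y. poly q (y a) * poly q' (y b)"
  shows "integrable order_stats2 (\<lambda>z. f (fst z) * g (snd z))"
    and "(\<integral>z. f (fst z) * g (snd z) \<partial>order_stats2) = (\<integral>x. f x \<partial>order_stats) * (\<integral>y. g y \<partial>order_stats)"
proof -
  have [measurable]: "i \<in> {..<4}" "j \<in> {..<4}" "a \<in> {..<4}" "b \<in> {..<4}"
    using ij by auto
  note B1 = poly_bound[where p = p]
  note B2 = poly_bound[where p = p']
  note B3 = poly_bound[where p = q]
  note B4 = poly_bound[where p = q']
  have mult: "\<bar>a * b\<bar> \<le> A * B" if "\<bar>a\<bar> \<le> A" "\<bar>b\<bar> \<le> B" for a b A B :: real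
    using that by (simp add: abs_mult mult_mono')
  show int: "integrable order_stats2 (\<lambda>z. f (fst z) * g (snd z))"
  proof (rule integrable_order_stats2[where B = "(poly_bound p * poly_bound p') * (poly_bound q * poly_bound q')"])
    show "(\<lambda>z. f (fst z) * g (snd z)) \<in> borel_measurable order_stats2"
      unfolding f_def g_def by measurable
    fix x y :: "nat \<Rightarrow> real"
    assume xy: "\<And>i. i < 4 \<Longrightarrow> unit_ivl (x i)" "\<And>i. i < 4 \<Longrightarrow> unit_ivl (y i)"
    show "\<bar>f (fst (x, y)) * g (snd (x, y))\<bar> \<le> poly_bound p * poly_bound p' * (poly_bound q * poly_bound q')"
      unfolding f_def g_def fst_conv snd_conv
      using xy ij by (intro mult B1 B2 B3 B4) blast+
  qed
  show "(\<integral>z. f (fst z) * g (snd z) \<partial>order_stats2) = (\<integral>x. f x \<partial>order_stats) * (\<integral>y. g y \<partial>order_stats)"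
    by (rule integral_order_stats2_mult[OF int])
qed

lemma integral_base:
  assumes "i < 4" "a < 4"
  shows "integrable order_stats2 (\<lambda>z. base t (fst z i) (snd z a))"
    and "(\<integral>z. base t (fst z i) (snd z a) \<partial>order_stats2) = 0"
proof -
  note I = integral_poly_order_stats2[where p' = 1 and q' = 1, OF assms(1,1,2,2), simplified]
  show "integrable order_stats2 (\<lambda>z. base t (fst z i) (snd z a))"
    unfolding base_def by (intro Bochner_Integration.integrable_add integrable_mult_right I(1))
  show "(\<integral>z. base t (fst z i) (snd z a) \<partial>order_stats2) = 0"
    unfolding base_def
    by (subst Bochner_Integration.integral_add)
      (simp_all only: I(1) integrable_mult_right integral_mult_right_zero I(2) mean_high[OF assms(1)] mult_zero_left mult_zero_right add_0)
qed

lemma integral_low: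
  assumes "i < 4" "a < 4"
  shows "integrable order_stats2 (\<lambda>z. low X (fst z i) (snd z a))"
    and "(\<integral>z. low X (fst z i) (snd z a) \<partial>order_stats2) = X i a"
proof -
  note I = integral_poly_order_stats2[where p' = 1 and q' = 1, OF assms(1,1,2,2), simplified]
  show "integrable order_stats2 (\<lambda>z. low X (fst z i) (snd z a))"
    unfolding low_def by (intro Bochner_Integration.integrable_sum integrable_mult_right I(1))
  have "(\<integral>z. low X (fst z i) (snd z a) \<partial>order_stats2)
      = (\<Sum>k<4. \<Sum>l<4. X k l * ((\<integral>x. poly (dual k) (x i) \<partial>order_stats) * (\<integral>y. poly (dual l) (y a) \<partial>order_stats)))"
    unfolding low_def
    by (subst Bochner_Integration.integral_sum, intro Bochner_Integration.integrable_sum integrable_mult_right I(1),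
        subst Bochner_Integration.integral_sum, intro integrable_mult_right I(1),
        simp only: integral_mult_right_zero I(2))
  also have "\<dots> = (\<Sum>k<4. \<Sum>l<4. X k l * (of_bool (k = i) * of_bool (l = a)))"
    by (intro sum.cong refl) (simp add: mean_dual assms)
  also have "\<dots> = (\<Sum>k<4. if k = i then X k a else 0)"
  proof (intro sum.cong refl)
    fix k
    have "(\<Sum>l<4. X k l * (of_bool (k = i) * of_bool (l = a))) = (\<Sum>l<4. if l = a then X k l * of_bool (k = i) else 0)"
      by (intro sum.cong) auto
    also have "\<dots> = (if k = i then X k a else 0)"
      using assms by (subst sum.delta) auto
    finally show "(\<Sum>l<4. X k l * (of_bool (k = i) * of_bool (l = a))) = (if k = i then X k a else 0)" .
  qed
  also have "\<dots> = X i a"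
    using assms by (subst sum.delta) auto
  finally show "(\<integral>z. low X (fst z i) (snd z a) \<partial>order_stats2) = X i a" .
qed

lemma integral_base_base:
  assumes ij: "i < 4" "j < 4" "a < 4" "b < 4"
  shows "integrable order_stats2 (\<lambda>z. base t (fst z i) (snd z a) * base t (fst z j) (snd z b))"
    and "(\<integral>z. base t (fst z i) (snd z a) * base t (fst z j) (snd z b) \<partial>order_stats2) = corr t i j a b"
proof -
  let ?h = "\<lambda>k l z. poly (high k) (fst z i) * poly (high l) (fst z j) * (poly (high k) (snd z a) * poly (high l) (snd z b))"
  note I = integral_poly_order_stats2[OF ij]
  have eq: "(\<lambda>z. base t (fst z i) (snd z a) * base t (fst z j) (snd z b))
     = (\<lambda>z. ?h 0 0 z + t * (?h 0 1 z + ?h 1 0 z) + t\<^sup>2 * ?h 1 1 z)"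
    by (rule ext) (simp add: base_def algebra_simps power2_eq_square)
  show "integrable order_stats2 (\<lambda>z. base t (fst z i) (snd z a) * base t (fst z j) (snd z b))"
    unfolding eq by (intro Bochner_Integration.integrable_add integrable_mult_right I(1))
  have h: "(\<integral>z. ?h k l z \<partial>order_stats2) = mom k l i j * mom k l a b" for k l
    unfolding mom_def by (rule I(2))
  have int: "integrable order_stats2 (\<lambda>z. ?h k l z)" for k l
    by (rule I(1))
  show "(\<integral>z. base t (fst z i) (snd z a) * base t (fst z j) (snd z b) \<partial>order_stats2) = corr t i j a b"
    unfolding eq corr_def h[symmetric]
    by (simp only: Bochner_Integration.integral_add Bochner_Integration.integrable_add
        integrable_mult_right int integral_mult_right_zero)
qed

text \<open>The constant K depends on R alone, so one choice of e works for all parameters in a box.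
  Integrating the pointwise expansion, the terms linear in \<open>base\<close> drop out, those
  linear in \<open>low\<close> give the entries of X along s, and the products of two
  \<open>base\<close> factors give \<open>quad\<close>.\<close>

lemma pattern_wt_expansion:
  obtains K where "K \<ge> 0"
    "\<And>e t X s. 0 \<le> e \<Longrightarrow> e \<le> 1 \<Longrightarrow> \<bar>t\<bar> \<le> R \<Longrightarrow> (\<And>i j. i < 4 \<Longrightarrow> j < 4 \<Longrightarrow> \<bar>X i j\<bar> \<le> R) \<Longrightarrow>
      (\<And>i. i < 4 \<Longrightarrow> s i < 4) \<Longrightarrow>
      \<bar>pattern_wt s (kern e t X) - 1 - e\<^sup>2 * ((\<Sum>i<4. X i (s i)) + quad s t)\<bar> \<le> K * e ^ 3"
proof -
  define C where "C = kern_const R"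
  note C = kern_const[where R = R, folded C_def]
  define K where "K = 18 * C\<^sup>2 + 4 * (2 * C) ^ 3 + (2 * C) ^ 4"
  have "\<bar>pattern_wt s (kern e t X) - 1 - e\<^sup>2 * ((\<Sum>i<4. X i (s i)) + quad s t)\<bar> \<le> K * e ^ 3"
    if e: "0 \<le> e" "e \<le> 1" and t: "\<bar>t\<bar> \<le> R" and X: "\<And>i j. i < 4 \<Longrightarrow> j < 4 \<Longrightarrow> \<bar>X i j\<bar> \<le> R"
      and s: "\<And>i. i < 4 \<Longrightarrow> s i < 4" for e t X s
  proof -
    define b where "b z i = base t (fst z i) (snd z (s i))" for z i
    define l where "l z i = low X (fst z i) (snd z (s i))" for z i
    define G where "G z = 1 + e * (b z 0 + b z 1 + b z 2 + b z 3) + e\<^sup>2 * (l z 0 + l z 1 + l z 2 + l z 3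
        + (b z 0 * b z 1 + b z 0 * b z 2 + b z 0 * b z 3 + b z 1 * b z 2 + b z 1 * b z 3 + b z 2 * b z 3))" for z
    define P where "P z = (\<Prod>i<4. kern e t X (fst z i) (snd z (s i)))" for z
    have kern_eq: "kern e t X (fst z i) (snd z (s i)) = 1 + e * b z i + e\<^sup>2 * l z i" for z i
      by (simp add: kern_def b_def l_def)
    have low_bound: "\<bar>low X x y\<bar> \<le> C" if "unit_ivl x" "unit_ivl y" for x y
      by (rule C(3)) (use X that in auto)
    have kern_bound: "\<bar>kern e t X x y\<bar> \<le> 1 + C + C" if "unit_ivl x" "unit_ivl y" for x y
    proof -
      have "\<bar>e * base t x y\<bar> \<le> 1 * C" "\<bar>e\<^sup>2 * low X x y\<bar> \<le> 1 * C"
        unfolding abs_mult using C(2)[OF t that] low_bound[OF that] e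
        by (intro mult_mono; simp add: power_le_one)+
      then show ?thesis unfolding kern_def by linarith
    qed
    have intP: "integrable order_stats2 P"
      unfolding P_def using s kern_bound
      by (intro integrable_order_stats2_prod[where C = "1 + C + C"]) (auto intro: measurable_kern)
    have intb: "integrable order_stats2 (\<lambda>z. b z i)" "(\<integral>z. b z i \<partial>order_stats2) = 0" if "i < 4" for i
      unfolding b_def using integral_base[OF that s[OF that]] by auto
    have intl: "integrable order_stats2 (\<lambda>z. l z i)" "(\<integral>z. l z i \<partial>order_stats2) = X i (s i)" if "i < 4" for i
      unfolding l_def using integral_low[OF that s[OF that]] by auto
    have intbb: "integrable order_stats2 (\<lambda>z. b z i * b z j)"
      "(\<integral>z. b z i * b z j \<partial>order_stats2) = corr t i j (s i) (s j)" if "i < 4" "j < 4" for i j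
      unfolding b_def using integral_base_base[OF that s[OF that(1)] s[OF that(2)]] by auto
    have four: "0 < (4::nat)" "1 < (4::nat)" "2 < (4::nat)" "3 < (4::nat)" by simp_all
    have one: "integrable order_stats2 (\<lambda>z. 1 :: real)" by simp
    note ints = one intb(1)[OF four(1)] intb(1)[OF four(2)] intb(1)[OF four(3)] intb(1)[OF four(4)]
      intl(1)[OF four(1)] intl(1)[OF four(2)] intl(1)[OF four(3)] intl(1)[OF four(4)]
      intbb(1)[OF four(1) four(2)] intbb(1)[OF four(1) four(3)] intbb(1)[OF four(1) four(4)]
      intbb(1)[OF four(2) four(3)] intbb(1)[OF four(2) four(4)] intbb(1)[OF four(3) four(4)]
    have intG: "integrable order_stats2 G"
      unfolding G_def by (intro Bochner_Integration.integrable_add integrable_mult_right ints)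
    have "(\<integral>z. G z \<partial>order_stats2) = 1 + e\<^sup>2 * ((\<Sum>i<4. X i (s i)) + quad s t)"
      unfolding G_def
      by (simp only: Bochner_Integration.integral_add Bochner_Integration.integrable_add
          integrable_mult_right integral_mult_right_zero ints intb(2)[OF four(1)] intb(2)[OF four(2)]
          intb(2)[OF four(3)] intb(2)[OF four(4)] intl(2)[OF four(1)] intl(2)[OF four(2)] intl(2)[OF four(3)]
          intl(2)[OF four(4)] intbb(2)[OF four(1) four(2)] intbb(2)[OF four(1) four(3)]
          intbb(2)[OF four(1) four(4)] intbb(2)[OF four(2) four(3)] intbb(2)[OF four(2) four(4)]
          intbb(2)[OF four(3) four(4)])
        (simp add: quad_def lessThan_4 order_stats2.prob_space)
    then have "pattern_wt s (kern e t X) - 1 - e\<^sup>2 * ((\<Sum>i<4. X i (s i)) + quad s t) = (\<integral>z. P z - G z \<partial>order_stats2)"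
      unfolding pattern_wt_def P_def[symmetric] Bochner_Integration.integral_diff[OF intP intG] by simp
    also have "\<bar>\<dots>\<bar> \<le> (\<integral>z. \<bar>P z - G z\<bar> \<partial>order_stats2)"
      by (rule integral_abs_bound)
    also have "\<dots> \<le> K * e ^ 3"
    proof (rule order_stats2.integral_le_const)
      show "integrable order_stats2 (\<lambda>z. \<bar>P z - G z\<bar>)"
        by (intro integrable_abs Bochner_Integration.integrable_diff intP intG)
      show "AE z in order_stats2. \<bar>P z - G z\<bar> \<le> K * e ^ 3"
        using AE_order_stats2
      proof eventually_elim
        case (elim z)
        have "\<bar>b z i\<bar> \<le> C" "\<bar>l z i\<bar> \<le> C" if "i < 4" for i
          unfolding b_def l_def using elim that s[OF that] by (intro C(2)[OF t] low_bound; blast)+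
        from prod4_expansion_bound[OF C(1) this e]
        show ?case
          unfolding P_def kern_eq G_def K_def by (simp only: mult.commute)
      qed
    qed
    finally show ?thesis .
  qed
  moreover have "K \<ge> 0"
    using C(1) by (simp add: K_def)
  ultimately show thesis
    using that by blast
qed

section \<open>The second-order terms\<close>

lemmas mom_swaps = mom_swap[of _ _ 1 0] mom_swap[of _ _ 2 0] mom_swap[of _ _ 3 0]
  mom_swap[of _ _ 2 1] mom_swap[of _ _ 3 1] mom_swap[of _ _ 3 2]

text \<open>The mean of (g_k(x_a) - g_k(x_b)) (g_l(x_c) - g_l(x_d)) under the order statistics,
  where g is \<open>high\<close>; exchanging a with b, or c with d, only changes its sign.\<close>

definition bil :: "nat \<Rightarrow> nat \<Rightarrow> nat \<Rightarrow> nat \<Rightarrow> nat \<Rightarrow> nat \<Rightarrow> real" where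
  "bil k l a b c d = mom k l a c - mom k l a d - mom k l b c + mom k l b d"

text \<open>The factor 2 in the middle term merges the contributions of \<open>bil 0 1\<close> and
  \<open>bil 1 0\<close>, whose products over positions and values coincide by
  \<open>bil_antisym\<close>.\<close>

definition quad_diff :: "nat \<Rightarrow> nat \<Rightarrow> nat \<Rightarrow> nat \<Rightarrow> nat \<Rightarrow> nat \<Rightarrow> nat \<Rightarrow> nat \<Rightarrow> real \<Rightarrow> real" where
  "quad_diff a b c d A B C D t = bil 0 0 a b c d * bil 0 0 A B C D
     + 2 * (bil 0 1 a b c d * bil 0 1 A B C D) * t + bil 1 1 a b c d * bil 1 1 A B C D * t\<^sup>2"

lemma corr_swap: "corr t i j a b = corr t j i b a"
  unfolding corr_def by (simp add: mom_swap[of _ _ i j] mom_swap[of _ _ a b])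

lemma distinct4_cases:
  assumes "distinct [a, b, c, d]" "a < 4" "b < 4" "c < 4" "d < (4::nat)"
  shows "(a, b, c, d) \<in> {(0, 1, 2, 3), (0, 1, 3, 2), (0, 2, 1, 3), (0, 2, 3, 1), (0, 3, 1, 2), (0, 3, 2, 1),
    (1, 0, 2, 3), (1, 0, 3, 2), (1, 2, 0, 3), (1, 2, 3, 0), (1, 3, 0, 2), (1, 3, 2, 0),
    (2, 0, 1, 3), (2, 0, 3, 1), (2, 1, 0, 3), (2, 1, 3, 0), (2, 3, 0, 1), (2, 3, 1, 0),
    (3, 0, 1, 2), (3, 0, 2, 1), (3, 1, 0, 2), (3, 1, 2, 0), (3, 2, 0, 1), (3, 2, 1, 0)}"
proof -
  have "d = 6 - a - b - c"
    using assms by (auto dest!: less_4_cases)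
  then show ?thesis
    using assms(1) less_4_cases[OF assms(2)] less_4_cases[OF assms(3)] less_4_cases[OF assms(4)]
    by (elim disjE) simp_all
qed

text \<open>Since \<open>corr_swap\<close> makes \<open>corr\<close> a function of unordered pairs
  of points, the six pairs may be listed along any ordering of the positions.\<close>

lemma quad_reorder:
  assumes "distinct [a, b, c, d]" "a < 4" "b < 4" "c < 4" "d < 4"
  shows "quad s t = corr t a b (s a) (s b) + corr t a c (s a) (s c) + corr t a d (s a) (s d)
     + corr t b c (s b) (s c) + corr t b d (s b) (s d) + corr t c d (s c) (s d)"
proof -
  note swaps = corr_swap[of t 1 0] corr_swap[of t 2 0] corr_swap[of t 3 0] corr_swap[of t 2 1]
    corr_swap[of t 3 1] corr_swap[of t 3 2]
  show ?thesis
    using distinct4_cases[OF assms] unfolding insert_iff empty_iff prod.inject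
    by (elim disjE conjE FalseE; hypsubst; simp add: quad_def swaps del: One_nat_def)
qed

text \<open>The sum of the two sides' \<open>bil\<close> terms sees only the symmetric part of the
  mixed moments. That part is a multiple of the inner product of the antiderivatives of
  \<open>high 0\<close> and \<open>high 1\<close>, which is 0. The proof confirms this from
  \<open>mom_table\<close>, split by split.\<close>

lemma bil_antisym:
  assumes "distinct [a, b, c, d]" "a < 4" "b < 4" "c < 4" "d < 4"
  shows "bil 1 0 a b c d = - bil 0 1 a b c d"
  using distinct4_cases[OF assms] unfolding insert_iff empty_iff prod.inject
  by (elim disjE conjE FalseE; hypsubst; simp add: bil_def mom_table mom_swaps del: One_nat_def)

text \<open>For the split \<open>{0,2}, {1,3}\<close> the diagonal terms vanish; for the other two splits the off-diagonal term dominates.\<close>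

lemma bil_table:
  assumes "distinct [a, b, c, d]" "a < 4" "b < 4" "c < 4" "d < 4"
  shows "bil 0 1 a b c d \<noteq> 0"
    and "bil 0 0 a b c d = 0 \<and> bil 1 1 a b c d = 0 \<or>
      bil 0 0 a b c d * bil 1 1 a b c d > 0 \<and> bil 0 0 a b c d * bil 1 1 a b c d < (bil 0 1 a b c d)\<^sup>2"
  using distinct4_cases[OF assms] unfolding insert_iff empty_iff prod.inject
  by (elim disjE conjE FalseE; hypsubst; simp add: bil_def mom_table mom_swaps power2_eq_square del: One_nat_def)+

text \<open>Pairs inside a block cancel: s1 and s3 send (a, b) to (A, B) while s2 and s4 send it to
  (B, A), and (c, d) behaves alike with s1, s4 against s2, s3. Each of the four cross pairs leaves
  an alternating sum over the pairs of values, and the whole factors into a \<open>bil\<close> of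
  positions and a \<open>bil\<close> of values.\<close>

lemma quad_diff_eq:
  assumes abcd: "distinct [a, b, c, d]" "a < 4" "b < 4" "c < 4" "d < 4"
    and ABCD: "distinct [A, B, C, D]" "A < 4" "B < 4" "C < 4" "D < 4"
    and s1: "s1 a = A" "s1 b = B" "s1 c = C" "s1 d = D"
    and s2: "s2 a = B" "s2 b = A" "s2 c = D" "s2 d = C"
    and s3: "s3 a = A" "s3 b = B" "s3 c = D" "s3 d = C"
    and s4: "s4 a = B" "s4 b = A" "s4 c = C" "s4 d = D"
  shows "quad s1 t + quad s2 t - quad s3 t - quad s4 t = quad_diff a b c d A B C D t"
proof -
  have "quad s1 t + quad s2 t - quad s3 t - quad s4 t
      = corr t a c A C - corr t a c A D - corr t a c B C + corr t a c B D
      - (corr t a d A C - corr t a d A D - corr t a d B C + corr t a d B D)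
      - (corr t b c A C - corr t b c A D - corr t b c B C + corr t b c B D)
      + (corr t b d A C - corr t b d A D - corr t b d B C + corr t b d B D)"
    unfolding quad_reorder[OF abcd] s1 s2 s3 s4 by (simp add: algebra_simps)
  also have "\<dots> = bil 0 0 a b c d * bil 0 0 A B C D
     + t * (bil 0 1 a b c d * bil 0 1 A B C D + bil 1 0 a b c d * bil 1 0 A B C D)
     + t\<^sup>2 * (bil 1 1 a b c d * bil 1 1 A B C D)"
    unfolding corr_def bil_def by (simp add: algebra_simps)
  also have "\<dots> = quad_diff a b c d A B C D t"
    unfolding quad_diff_def bil_antisym[OF abcd] bil_antisym[OF ABCD] by (simp add: algebra_simps)
  finally show ?thesis .
qed

text \<open>Dominated convergence along sequences: the uniform bounds on T and X bound the integrand
  by a constant, and for fixed points of the square the kernel depends continuously on T and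
  X.\<close>

lemma continuous_on_pattern_wt:
  fixes T :: "'a::metric_space \<Rightarrow> real" and X :: "'a \<Rightarrow> nat \<Rightarrow> nat \<Rightarrow> real"
  assumes T: "continuous_on S T" and X: "\<And>i j. i < 4 \<Longrightarrow> j < 4 \<Longrightarrow> continuous_on S (\<lambda>u. X u i j)"
    and TR: "\<And>u. u \<in> S \<Longrightarrow> \<bar>T u\<bar> \<le> R" and XR: "\<And>u i j. u \<in> S \<Longrightarrow> i < 4 \<Longrightarrow> j < 4 \<Longrightarrow> \<bar>X u i j\<bar> \<le> R"
    and e: "0 \<le> e" "e \<le> 1" and s: "\<And>i. i < 4 \<Longrightarrow> s i < 4"
  shows "continuous_on S (\<lambda>u. pattern_wt s (kern e (T u) (X u)))"
  unfolding continuous_on_sequentially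
proof (intro allI impI ballI, elim conjE)
  fix u a assume a: "a \<in> S" and u: "\<forall>n. u n \<in> S" "u \<longlonglongrightarrow> a"
  define C where "C = kern_const R"
  note C = kern_const[where R = R, folded C_def]
  have kern_bound: "\<bar>kern e (T v) (X v) x y\<bar> \<le> 1 + C + C"
    if v: "v \<in> S" and xy: "unit_ivl x" "unit_ivl y" for v x y
  proof -
    have "\<bar>low (X v) x y\<bar> \<le> C"
      by (rule C(3)) (use XR v xy in auto)
    then have "\<bar>e * base (T v) x y\<bar> \<le> 1 * C" "\<bar>e\<^sup>2 * low (X v) x y\<bar> \<le> 1 * C"
      unfolding abs_mult using C(2)[OF TR[OF v] xy] e by (intro mult_mono; simp add: power_le_one)+
    then show ?thesis unfolding kern_def by linarith
  qed
  have meas: "(\<lambda>z. \<Prod>i<4. kern e (T v) (X v) (fst z i) (snd z (s i))) \<in> borel_measurable order_stats2" if "v \<in> S" for v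
    using integrable_order_stats2_prod[of "{..<4}" s "\<lambda>_. kern e (T v) (X v)" "1 + C + C"] s kern_bound[OF that]
    by (intro borel_measurable_integrable) (auto intro: measurable_kern)
  have Tlim: "(\<lambda>n. T (u n)) \<longlonglongrightarrow> T a"
    using continuous_on_tendsto_compose[OF T u(2) a] u(1) by simp
  have Xlim: "(\<lambda>n. X (u n) i j) \<longlonglongrightarrow> X a i j" if "i < 4" "j < 4" for i j
    using continuous_on_tendsto_compose[OF X[OF that] u(2) a] u(1) by simp
  show "((\<lambda>u. pattern_wt s (kern e (T u) (X u))) \<circ> u) \<longlonglongrightarrow> pattern_wt s (kern e (T a) (X a))"
    unfolding pattern_wt_def o_def
  proof (rule integral_dominated_convergence[where w = "\<lambda>_. (1 + C + C) ^ 4"])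
    show "AE z in order_stats2. (\<lambda>n. \<Prod>i<4. kern e (T (u n)) (X (u n)) (fst z i) (snd z (s i)))
        \<longlonglongrightarrow> (\<Prod>i<4. kern e (T a) (X a) (fst z i) (snd z (s i)))"
      unfolding kern_def base_def low_def
      by (intro AE_I2 tendsto_intros Tlim Xlim) auto
    show "AE z in order_stats2. norm (\<Prod>i<4. kern e (T (u n)) (X (u n)) (fst z i) (snd z (s i))) \<le> (1 + C + C) ^ 4" for n
      using AE_order_stats2
    proof eventually_elim
      case (elim z)
      have "(\<Prod>i<4. \<bar>kern e (T (u n)) (X (u n)) (fst z i) (snd z (s i))\<bar>) \<le> (\<Prod>i<4::nat. 1 + C + C)"
      proof (intro prod_mono conjI abs_ge_zero)
        fix i :: nat assume "i \<in> {..<4}"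
        then have "i < 4" "s i < 4" using s by auto
        then show "\<bar>kern e (T (u n)) (X (u n)) (fst z i) (snd z (s i))\<bar> \<le> 1 + C + C"
          using elim u(1) by (intro kern_bound) blast+
      qed
      then show ?case by (simp add: abs_prod)
    qed
  qed (use meas a u in auto)
qed

section \<open>Densities with prescribed pattern weights\<close>

text \<open>A density rather than a permuton: only the total mass is normalized, since the sampled
  permutation depends on relative orders alone. Sign and upper bound are imposed on the unit square
  only, because the kernels are polynomials on the whole plane.\<close>

definition square_density :: "(real \<Rightarrow> real \<Rightarrow> real) \<Rightarrow> bool" where
  "square_density w \<longleftrightarrow> (\<lambda>(x, y). w x y) \<in> borel_measurable (borel \<Otimes>\<^sub>M borel) \<and>
     (\<forall>x y. 0 \<le> x \<longrightarrow> x \<le> 1 \<longrightarrow> 0 \<le> y \<longrightarrow> y \<le> 1 \<longrightarrow> 0 \<le> w x y) \<and>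
     (\<exists>C. \<forall>x y. 0 \<le> x \<longrightarrow> x \<le> 1 \<longrightarrow> 0 \<le> y \<longrightarrow> y \<le> 1 \<longrightarrow> w x y \<le> C) \<and>
     (\<integral>x. (\<integral>y. w x y \<partial>unif) \<partial>unif) = 1"

lemma integrable_unif_poly: "integrable unif (poly p)"
proof -
  note B = poly_bound[where p = p]
  show ?thesis
  proof (rule unif.integrable_const_bound[where B = "poly_bound p"])
    show "AE x in unif. norm (poly p x) \<le> poly_bound p"
      using AE_unif by eventually_elim (use B in auto)
  qed measurable
qed

lemma unif_mean_high: "(\<integral>x. poly (high k) x \<partial>unif) = 0"
  unfolding integral_unif_poly
  by (cases "k = 0"; simp add: poly_int_def high_def numeral_eq_Suc)

text \<open>The uniform law is the average of the laws of the four order statistics, so this is the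
  average of the values 1, 0, 0, 0 from \<open>mean_dual\<close>.\<close>

lemma unif_mean_dual: "i < 4 \<Longrightarrow> (\<integral>x. poly (dual i) x \<partial>unif) = 1 / 4"
  unfolding integral_unif_poly
  by (drule less_4_cases, elim disjE; simp add: poly_int_def dual_def numeral_eq_Suc)

text \<open>The base part integrates to 0 over the square, and \<open>low X\<close> to one sixteenth
  of the sum of the entries of X; a zero sum therefore preserves mass 1. A perturbation of size at
  most 1 keeps the kernel between 0 and 2.\<close>

lemma square_density_kern:
  assumes sum0: "(\<Sum>i<4. \<Sum>j<4. X i j) = 0"
    and nonneg: "\<And>x y. unit_ivl x \<Longrightarrow> unit_ivl y \<Longrightarrow> \<bar>kern e t X x y - 1\<bar> \<le> 1"
  shows "square_density (kern e t X)"
  unfolding square_density_def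
proof (intro conjI allI impI exI[of _ 2])
  show "(\<lambda>(x, y). kern e t X x y) \<in> borel_measurable (borel \<Otimes>\<^sub>M borel)"
    by (rule measurable_kern)
  show "0 \<le> kern e t X x y" "kern e t X x y \<le> 2" if "0 \<le> x" "x \<le> 1" "0 \<le> y" "y \<le> 1" for x y
    using nonneg[of x y] that by auto
  note I = integrable_unif_poly
  have inner: "(\<integral>y. kern e t X x y \<partial>unif) = 1 + e\<^sup>2 * (\<Sum>i<4. \<Sum>j<4. X i j * (poly (dual i) x * (1 / 4)))" for x
  proof -
    have b: "integrable unif (base t x)" "(\<integral>y. base t x y \<partial>unif) = 0"
    proof -
      show "integrable unif (base t x)"
        unfolding base_def by (intro Bochner_Integration.integrable_add integrable_mult_right I)
      show "(\<integral>y. base t x y \<partial>unif) = 0"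
        unfolding base_def
        by (subst Bochner_Integration.integral_add)
          (simp_all only: I integrable_mult_right integral_mult_right_zero unif_mean_high mult_zero_right add_0)
    qed
    have l: "integrable unif (low X x)"
      "(\<integral>y. low X x y \<partial>unif) = (\<Sum>i<4. \<Sum>j<4. X i j * (poly (dual i) x * (1 / 4)))"
    proof -
      show "integrable unif (low X x)"
        unfolding low_def by (intro Bochner_Integration.integrable_sum integrable_mult_right I)
      have "(\<integral>y. low X x y \<partial>unif) = (\<Sum>i<4. \<Sum>j<4. X i j * (poly (dual i) x * (\<integral>y. poly (dual j) y \<partial>unif)))"
        unfolding low_def
        by (subst Bochner_Integration.integral_sum, intro Bochner_Integration.integrable_sum integrable_mult_right I,
            subst Bochner_Integration.integral_sum, intro integrable_mult_right I,
            simp only: integral_mult_right_zero)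
      then show "(\<integral>y. low X x y \<partial>unif) = (\<Sum>i<4. \<Sum>j<4. X i j * (poly (dual i) x * (1 / 4)))"
        by (simp add: unif_mean_dual)
    qed
    have one: "integrable unif (\<lambda>y. 1 :: real)" by simp
    show ?thesis
      unfolding kern_def
      by (simp only: Bochner_Integration.integral_add Bochner_Integration.integrable_add one b l
          integrable_mult_right integral_mult_right_zero) (simp add: unif.prob_space[simplified])
  qed
  have lx: "integrable unif (\<lambda>x. \<Sum>i<4. \<Sum>j<4. X i j * (poly (dual i) x * (1 / 4)))"
    by (intro Bochner_Integration.integrable_sum integrable_mult_right integrable_mult_left I)
  have "(\<integral>x. (\<Sum>i<4. \<Sum>j<4. X i j * (poly (dual i) x * (1 / 4))) \<partial>unif)
      = (\<Sum>i<4. \<Sum>j<4. X i j * ((\<integral>x. poly (dual i) x \<partial>unif) * (1 / 4)))"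
    by (subst Bochner_Integration.integral_sum,
        intro Bochner_Integration.integrable_sum integrable_mult_right integrable_mult_left I,
        subst Bochner_Integration.integral_sum, intro integrable_mult_right integrable_mult_left I,
        simp only: integral_mult_right_zero integral_mult_left_zero)
  also have "\<dots> = (\<Sum>i<4. \<Sum>j<4. X i j) * (1 / 16)"
    by (simp add: unif_mean_dual sum_distrib_right)
  finally have low0: "(\<integral>x. (\<Sum>i<4. \<Sum>j<4. X i j * (poly (dual i) x * (1 / 4))) \<partial>unif) = 0"
    using sum0 by simp
  have one: "integrable unif (\<lambda>x. 1 :: real)" by simp
  show "(\<integral>x. (\<integral>y. kern e t X x y \<partial>unif) \<partial>unif) = 1"
    unfolding inner
    by (simp only: Bochner_Integration.integral_add one lx integrable_mult_right integral_mult_right_zero low0)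
      (simp add: unif.prob_space[simplified])
qed

section \<open>Zero-based patterns and sums over single cells\<close>

text \<open>Values of a permutation start at 1, so the truncated subtraction loses nothing and
  values are numbered like positions, from 0.\<close>

definition idx :: "nat list \<Rightarrow> nat \<Rightarrow> nat" where
  "idx \<sigma> i = \<sigma> ! i - 1"

lemma distinct4_eq:
  assumes "distinct [a, b, c, d]" "a < 4" "b < 4" "c < 4" "d < (4::nat)"
  shows "{..<4} = {a, b, c, d}"
  by (rule card_subset_eq[symmetric]) (use assms in auto)

lemma sum_distinct4:
  fixes f :: "nat \<Rightarrow> real"
  assumes "distinct [a, b, c, d]" "a < 4" "b < 4" "c < 4" "d < 4"
  shows "(\<Sum>i<4. f i) = f a + f b + f c + f d"
  unfolding distinct4_eq[OF assms] using assms(1) by simp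

lemma all_less_4_distinct:
  assumes "distinct [a, b, c, d]" "a < 4" "b < 4" "c < 4" "d < 4"
    and "P a" "P b" "P c" "P d" "i < (4::nat)"
  shows "P i"
  using assms(6-10) distinct4_eq[OF assms(1-5)] by (metis insert_iff empty_iff lessThan_iff)

lemma sum_cell:
  assumes "a < 4"
  shows "(\<Sum>i<4::nat. r * of_bool (i = a \<and> f i = A)) = (r * of_bool (f a = A) :: real)"
proof -
  have "(\<Sum>i<4. r * of_bool (i = a \<and> f i = A)) = (\<Sum>i<4. if i = a then r * of_bool (f i = A) else 0)"
    by (intro sum.cong) auto
  then show ?thesis
    using assms by (subst (asm) sum.delta) auto
qed

lemma sum_cell_total:
  assumes "a < 4" "A < 4"
  shows "(\<Sum>i<4::nat. \<Sum>j<4::nat. r * of_bool (i = a \<and> j = A)) = (r :: real)"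
proof -
  have "(\<Sum>j<4::nat. r * of_bool (i = a \<and> j = A)) = r * of_bool (i = a \<and> True)" for i
  proof -
    have "(\<Sum>j<4::nat. r * of_bool (i = a \<and> j = A)) = (\<Sum>j<4. if j = A then r * of_bool (i = a) else 0)"
      by (intro sum.cong) auto
    then show ?thesis
      using assms by (subst (asm) sum.delta) auto
  qed
  then have "(\<Sum>i<4::nat. \<Sum>j<4::nat. r * of_bool (i = a \<and> j = A)) = (\<Sum>i<4::nat. r * of_bool (i = a \<and> True))"
    by (intro sum.cong refl)
  also have "\<dots> = r"
    using sum_cell[OF assms(1), of r "\<lambda>_. True" True] by (simp only: simp_thms of_bool_eq mult_1_right)
  finally show ?thesis .
qed

section \<open>Sign changes and certificates of non-uniformity\<close>

text \<open>If X = Z = 0, the polynomial 2 Y t changes sign at 0. Otherwise, at p = -X / (2 Y) the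
  first two terms cancel and the sign is that of Z, while at the vertex q = -Y / Z the positive
  discriminant gives the opposite sign; moreover p q = X / (2 Z) > 0. So the interval between p and
  q either avoids 0 or lies close to it, which are the two situations that
  \<open>witness_quadruple\<close> can certify.\<close>

lemma quadratic_sign_change:
  fixes X Y Z :: real
  assumes "Y \<noteq> 0" "X = 0 \<and> Z = 0 \<or> X * Z > 0 \<and> X * Z < Y\<^sup>2" "r > 0"
  obtains p q where "(X + 2 * Y * p + Z * p\<^sup>2) * (X + 2 * Y * q + Z * q\<^sup>2) < 0"
    "p * q > 0 \<or> \<bar>p\<bar> \<le> r \<and> \<bar>q\<bar> \<le> r"
proof (cases "X = 0")
  case True
  then have "Z = 0" using assms by auto
  then have "(X + 2 * Y * (-r) + Z * (-r)\<^sup>2) * (X + 2 * Y * r + Z * r\<^sup>2) = - (4 * (Y * Y) * (r * r))"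
    using True by simp
  also have "\<dots> < 0"
  proof -
    have "0 < Y * Y" using assms(1) by (metis not_square_less_zero mult_eq_0_iff not_less_iff_gr_or_eq)
    then show ?thesis using assms(3) by simp
  qed
  finally show ?thesis
    using assms(3) by (intro that[of "-r" r]) auto
next
  case False
  then have XZ: "X * Z > 0" "X * Z < Y\<^sup>2" and Z: "Z \<noteq> 0" using assms by auto
  let ?p = "- X / (2 * Y)" and ?q = "- Y / Z"
  have p: "X + 2 * Y * ?p + Z * ?p\<^sup>2 = Z * (X\<^sup>2 / (4 * Y\<^sup>2))"
    using assms(1) by (simp add: field_simps power2_eq_square)
  have q: "X + 2 * Y * ?q + Z * ?q\<^sup>2 = (X * Z - Y\<^sup>2) / Z"
    using Z by (simp add: field_simps power2_eq_square)
  have "(X + 2 * Y * ?p + Z * ?p\<^sup>2) * (X + 2 * Y * ?q + Z * ?q\<^sup>2) = (X\<^sup>2 / (4 * Y\<^sup>2)) * (X * Z - Y\<^sup>2)"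
    unfolding p q using Z by simp
  also have "\<dots> < 0"
    using XZ assms(1) False by (intro mult_pos_neg) auto
  finally have 1: "(X + 2 * Y * ?p + Z * ?p\<^sup>2) * (X + 2 * Y * ?q + Z * ?q\<^sup>2) < 0" .
  have "?p * ?q = X * Z / (2 * Z\<^sup>2)"
    using assms(1) Z by (simp add: power2_eq_square)
  also have "\<dots> > 0" using XZ Z by simp
  finally show ?thesis using 1 by (intro that[of ?p ?q]) auto
qed

text \<open>With the split {0,2}, {1,3} on both sides the diagonal terms vanish, so this alternating
  sum measures t itself and is a certificate as long as t stays away from 0.\<close>

lemma witness_alternating:
  "quad_diff 0 2 1 3 0 2 1 3 t = 2 * (bil 0 1 0 2 1 3)\<^sup>2 * t"
  "bil 0 1 0 2 1 3 \<noteq> 0"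
proof -
  show "quad_diff 0 2 1 3 0 2 1 3 t = 2 * (bil 0 1 0 2 1 3)\<^sup>2 * t"
    by (simp add: quad_diff_def bil_def mom_table mom_swaps power2_eq_square del: One_nat_def)
  show "bil 0 1 0 2 1 3 \<noteq> 0"
    by (rule bil_table) auto
qed

text \<open>The value at t = 0 is 1600/1002001, about 0.0016. For |t| at most 1/10 the linear term
  takes away at most 8/15210, about 0.00053, and the quadratic term is a square; this leaves more
  than 1/1000.\<close>

lemma witness_nested:
  assumes "\<bar>t\<bar> \<le> 1 / 10"
  shows "quad_diff 0 3 1 2 0 3 1 2 t \<ge> 1 / 1000"
proof -
  have "(bil 0 0 0 3 1 2)\<^sup>2 = 1600 / 1002001" "(bil 0 1 0 3 1 2)\<^sup>2 = 4 / 1521"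
    by (simp_all add: bil_def mom_table mom_swaps power2_eq_square del: One_nat_def)
  then have "quad_diff 0 3 1 2 0 3 1 2 t = 1600 / 1002001 + 2 * (4 / 1521) * t + (bil 1 1 0 3 1 2 * t)\<^sup>2"
    unfolding quad_diff_def power_mult_distrib by (simp only: power2_eq_square)
  moreover have "(bil 1 1 0 3 1 2 * t)\<^sup>2 \<ge> 0" by simp
  ultimately show ?thesis
    using assms by linarith
qed

lemma basis_real4: "(Basis :: (real \<times> real \<times> real \<times> real) set) = {(1, 0, 0, 0), (0, 1, 0, 0), (0, 0, 1, 0), (0, 0, 0, 1)}"
  by (simp add: Basis_prod_def zero_prod_def insert_commute)

lemma continuous_quad: "continuous_on S (quad s)"
  unfolding quad_def corr_def
  by (intro continuous_on_add continuous_on_mult continuous_on_power continuous_on_const continuous_on_id)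

lemma quad_bounded:
  obtains M where "M \<ge> 0" "\<And>t. t \<in> {t1..t2} \<Longrightarrow> \<bar>quad s t\<bar> \<le> M"
proof -
  have "compact (quad s ` {t1..t2})"
    by (intro compact_continuous_image continuous_quad) auto
  then obtain B where "\<forall>y\<in>quad s ` {t1..t2}. norm y \<le> B"
    using compact_imp_bounded bounded_iff by metis
  then show thesis
    by (intro that[of "max 0 B"]) (auto simp: le_max_iff_disj)
qed

text \<open>Both sides visit the same cells with the same multiplicities, so a correction by X never
  changes the alternating sum.\<close>

lemma sum_swapped_blocks:
  fixes Y :: "nat \<Rightarrow> nat \<Rightarrow> real"
  assumes abcd: "distinct [a, b, c, d]" "a < 4" "b < 4" "c < 4" "d < 4"
    and s1: "s1 a = A" "s1 b = B" "s1 c = C" "s1 d = D"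
    and s2: "s2 a = B" "s2 b = A" "s2 c = D" "s2 d = C"
    and s3: "s3 a = A" "s3 b = B" "s3 c = D" "s3 d = C"
    and s4: "s4 a = B" "s4 b = A" "s4 c = C" "s4 d = D"
  shows "(\<Sum>j<4. Y j (s1 j)) + (\<Sum>j<4. Y j (s2 j)) = (\<Sum>j<4. Y j (s3 j)) + (\<Sum>j<4. Y j (s4 j))"
  unfolding sum_distinct4[OF abcd] s1 s2 s3 s4 by simp

lemma is_permutation_4:
  "is_permutation \<sigma> \<Longrightarrow> length \<sigma> = 4 \<Longrightarrow> distinct \<sigma> \<and> set \<sigma> = {1..4}"
  by (simp add: is_permutation_def permutations_of_set_def)

lemma is_permutationI:
  "distinct \<sigma> \<Longrightarrow> set \<sigma> = {1..length \<sigma>} \<Longrightarrow> is_permutation \<sigma>"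
  by (simp add: is_permutation_def permutations_of_set_def)

lemma atLeastAtMost_1_4: "{1..4::nat} = {1, 2, 3, 4}"
  by auto

lemma witness_permutations:
  "is_permutation [1, 2, 3, 4]" "is_permutation [3, 4, 1, 2]" "is_permutation [1, 4, 3, 2]"
  "is_permutation [3, 2, 1, 4]" "is_permutation [4, 3, 2, 1]" "is_permutation [1, 3, 2, 4]"
  "is_permutation [4, 2, 3, 1]"
  by (rule is_permutationI; force simp: atLeastAtMost_1_4)+

text \<open>Two alternating sums certify non-uniformity: one is a nonzero multiple of \<open>t\<close>, the other is
  positive near \<open>t = 0\<close>.\<close>

lemma witness_quadruple:
  fixes T :: "'a \<Rightarrow> real"
  assumes "\<delta> > 0" "(\<forall>u\<in>S. \<bar>T u\<bar> \<ge> \<delta>) \<or> (\<forall>u\<in>S. \<bar>T u\<bar> \<le> 1 / 10)"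
  obtains \<eta> \<sigma>1 \<sigma>2 \<sigma>3 \<sigma>4 where "\<eta> > 0"
    "is_permutation \<sigma>1" "is_permutation \<sigma>2" "is_permutation \<sigma>3" "is_permutation \<sigma>4"
    "length \<sigma>1 = 4" "length \<sigma>2 = 4" "length \<sigma>3 = 4" "length \<sigma>4 = 4"
    "\<And>i. i < 4 \<Longrightarrow> idx \<sigma>1 i < 4 \<and> idx \<sigma>2 i < 4 \<and> idx \<sigma>3 i < 4 \<and> idx \<sigma>4 i < 4"
    "\<And>Y :: nat \<Rightarrow> nat \<Rightarrow> real. (\<Sum>j<4. Y j (idx \<sigma>1 j)) + (\<Sum>j<4. Y j (idx \<sigma>2 j))
      = (\<Sum>j<4. Y j (idx \<sigma>3 j)) + (\<Sum>j<4. Y j (idx \<sigma>4 j))"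
    "\<And>u. u \<in> S \<Longrightarrow> \<bar>quad (idx \<sigma>1) (T u) + quad (idx \<sigma>2) (T u) - quad (idx \<sigma>3) (T u) - quad (idx \<sigma>4) (T u)\<bar> \<ge> \<eta>"
  using assms(2)
proof
  assume T: "\<forall>u\<in>S. \<bar>T u\<bar> \<ge> \<delta>"
  let ?q = "\<lambda>t. quad (idx [1, 2, 3, 4]) t + quad (idx [3, 4, 1, 2]) t - quad (idx [1, 4, 3, 2]) t - quad (idx [3, 2, 1, 4]) t"
  have q: "?q t = 2 * (bil 0 1 0 2 1 3)\<^sup>2 * t" for t
    unfolding witness_alternating(1)[symmetric] by (rule quad_diff_eq) (simp_all add: idx_def)
  have f1: "\<bar>?q (T u)\<bar> \<ge> 2 * (bil 0 1 0 2 1 3)\<^sup>2 * \<delta>" if "u \<in> S" for u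
    unfolding q abs_mult using T that assms(1) by (intro mult_mono) auto
  have f2: "2 * (bil 0 1 0 2 1 3)\<^sup>2 * \<delta> > 0"
    using assms(1) witness_alternating(2) by simp
  have f3: "idx [1, 2, 3, 4] i < 4 \<and> idx [3, 4, 1, 2] i < 4 \<and> idx [1, 4, 3, 2] i < 4 \<and> idx [3, 2, 1, 4] i < 4"
    if "i < 4" for i
    using less_4_cases[OF that] by (auto simp: idx_def)
  have f4: "(\<Sum>j<4. Y j (idx [1, 2, 3, 4] j)) + (\<Sum>j<4. Y j (idx [3, 4, 1, 2] j))
      = (\<Sum>j<4. Y j (idx [1, 4, 3, 2] j)) + (\<Sum>j<4. Y j (idx [3, 2, 1, 4] j))" for Y :: "nat \<Rightarrow> nat \<Rightarrow> real"
    by (rule sum_swapped_blocks[of 0 2 1 3 _ 0 2 1 3]) (simp_all add: idx_def)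
  show thesis
  proof (rule that[OF _ witness_permutations(1-4), of "2 * (bil 0 1 0 2 1 3)\<^sup>2 * \<delta>"])
  qed (fact f1 | fact f2 | fact f3 | fact f4 | simp)+
next
  assume T: "\<forall>u\<in>S. \<bar>T u\<bar> \<le> 1 / 10"
  let ?q = "\<lambda>t. quad (idx [1, 2, 3, 4]) t + quad (idx [4, 3, 2, 1]) t - quad (idx [1, 3, 2, 4]) t - quad (idx [4, 2, 3, 1]) t"
  have q: "?q t = quad_diff 0 3 1 2 0 3 1 2 t" for t
    by (rule quad_diff_eq) (simp_all add: idx_def)
  have f1: "\<bar>?q (T u)\<bar> \<ge> 1 / 1000" if "u \<in> S" for u
    unfolding q using T that by (intro order_trans[OF witness_nested abs_ge_self]) auto
  have f3: "idx [1, 2, 3, 4] i < 4 \<and> idx [4, 3, 2, 1] i < 4 \<and> idx [1, 3, 2, 4] i < 4 \<and> idx [4, 2, 3, 1] i < 4"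
    if "i < 4" for i
    using less_4_cases[OF that] by (auto simp: idx_def)
  have f4: "(\<Sum>j<4. Y j (idx [1, 2, 3, 4] j)) + (\<Sum>j<4. Y j (idx [4, 3, 2, 1] j))
      = (\<Sum>j<4. Y j (idx [1, 3, 2, 4] j)) + (\<Sum>j<4. Y j (idx [4, 2, 3, 1] j))" for Y :: "nat \<Rightarrow> nat \<Rightarrow> real"
    by (rule sum_swapped_blocks[of 0 3 1 2 _ 0 3 1 2]) (simp_all add: idx_def)
  show thesis
  proof (rule that[OF _ witness_permutations(1,5,6,7), of "1 / 1000"])
  qed (fact f1 | fact f3 | fact f4 | simp)+
qed

section \<open>Exact solutions for small \<open>e\<close>\<close>

definition nonuniform_density :: "(real \<Rightarrow> real \<Rightarrow> real) \<Rightarrow> bool" where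
  "nonuniform_density w \<longleftrightarrow> square_density w \<and>
     (\<exists>\<sigma>. is_permutation \<sigma> \<and> length \<sigma> = 4 \<and> pattern_wt (idx \<sigma>) w \<noteq> 1)"

lemma nonuniform_densityI:
  assumes "square_density w"
    "is_permutation \<sigma>1" "is_permutation \<sigma>2" "is_permutation \<sigma>3" "is_permutation \<sigma>4"
    "length \<sigma>1 = 4" "length \<sigma>2 = 4" "length \<sigma>3 = 4" "length \<sigma>4 = 4"
    "pattern_wt (idx \<sigma>1) w + pattern_wt (idx \<sigma>2) w - pattern_wt (idx \<sigma>3) w - pattern_wt (idx \<sigma>4) w \<noteq> 0"
  shows "nonuniform_density w"
proof -
  have "pattern_wt (idx \<sigma>1) w \<noteq> 1 \<or> pattern_wt (idx \<sigma>2) w \<noteq> 1 \<or> pattern_wt (idx \<sigma>3) w \<noteq> 1 \<or> pattern_wt (idx \<sigma>4) w \<noteq> 1"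
    using assms(10) by auto
  then show ?thesis
    using assms(1-9) unfolding nonuniform_density_def by blast
qed

text \<open>The conditions to be solved are \<open>e\<^sup>2 \<Phi> + O(e\<^sup>3) = 0\<close> uniformly on the box, so for small \<open>e\<close> the strict signs of
  \<open>\<Phi>\<close> on the faces allow the Poincare--Miranda theorem to be applied.\<close>

lemma exists_nonuniform_density:
  fixes a b :: "'a::euclidean_space" and T :: "'a \<Rightarrow> real" and X :: "'a \<Rightarrow> nat \<Rightarrow> nat \<Rightarrow> real"
    and c :: "'a \<Rightarrow> nat \<Rightarrow> real" and s :: "nat \<Rightarrow> nat \<Rightarrow> nat"
    and m :: nat
  defines "\<Phi> \<equiv> \<lambda>i u. \<Sum>k<m. c i k * ((\<Sum>j<4. X u j (s k j)) + quad (s k) (T u))"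
  assumes ab: "\<And>i. i \<in> Basis \<Longrightarrow> a \<bullet> i \<le> b \<bullet> i"
    and T: "continuous_on (cbox a b) T"
    and X: "\<And>i j. i < 4 \<Longrightarrow> j < 4 \<Longrightarrow> continuous_on (cbox a b) (\<lambda>u. X u i j)"
    and TR: "\<And>u. u \<in> cbox a b \<Longrightarrow> \<bar>T u\<bar> \<le> R"
    and XR: "\<And>u i j. u \<in> cbox a b \<Longrightarrow> i < 4 \<Longrightarrow> j < 4 \<Longrightarrow> \<bar>X u i j\<bar> \<le> R"
    and sum0: "\<And>u. (\<Sum>i<4. \<Sum>j<4. X u i j) = 0"
    and s: "\<And>k i. k < m \<Longrightarrow> i < 4 \<Longrightarrow> s k i < 4"
    and \<eta>0: "\<eta>0 > 0"
    and lower0: "\<And>u i. u \<in> cbox a b \<Longrightarrow> i \<in> Basis \<Longrightarrow> u \<bullet> i = a \<bullet> i \<Longrightarrow> \<Phi> i u \<le> - \<eta>0"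
    and upper0: "\<And>u i. u \<in> cbox a b \<Longrightarrow> i \<in> Basis \<Longrightarrow> u \<bullet> i = b \<bullet> i \<Longrightarrow> \<Phi> i u \<ge> \<eta>0"
    and \<delta>: "\<delta> > 0" "(\<forall>u\<in>cbox a b. \<bar>T u\<bar> \<ge> \<delta>) \<or> (\<forall>u\<in>cbox a b. \<bar>T u\<bar> \<le> 1 / 10)"
  obtains w where "nonuniform_density w"
    "\<And>i. i \<in> Basis \<Longrightarrow> (\<Sum>k<m. c i k * (pattern_wt (s k) w - 1)) = 0"
proof -
  obtain \<eta>1 \<sigma>1 \<sigma>2 \<sigma>3 \<sigma>4 where \<eta>1: "\<eta>1 > 0"
    and perms: "is_permutation \<sigma>1" "is_permutation \<sigma>2" "is_permutation \<sigma>3" "is_permutation \<sigma>4"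
      "length \<sigma>1 = 4" "length \<sigma>2 = 4" "length \<sigma>3 = 4" "length \<sigma>4 = 4"
    and v: "\<And>i. i < 4 \<Longrightarrow> idx \<sigma>1 i < 4 \<and> idx \<sigma>2 i < 4 \<and> idx \<sigma>3 i < 4 \<and> idx \<sigma>4 i < 4"
    and vsum: "\<And>Y :: nat \<Rightarrow> nat \<Rightarrow> real. (\<Sum>j<4. Y j (idx \<sigma>1 j)) + (\<Sum>j<4. Y j (idx \<sigma>2 j))
      = (\<Sum>j<4. Y j (idx \<sigma>3 j)) + (\<Sum>j<4. Y j (idx \<sigma>4 j))"
    and vq1: "\<And>u. u \<in> cbox a b \<Longrightarrow>
      \<bar>quad (idx \<sigma>1) (T u) + quad (idx \<sigma>2) (T u) - quad (idx \<sigma>3) (T u) - quad (idx \<sigma>4) (T u)\<bar> \<ge> \<eta>1"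
    by (rule witness_quadruple[OF \<delta>]) blast
  define \<eta> where "\<eta> = min \<eta>0 \<eta>1"
  have \<eta>: "\<eta> > 0" "\<eta> \<le> \<eta>0" "\<eta> \<le> \<eta>1"
    using \<eta>0 \<eta>1 by (auto simp: \<eta>_def)
  obtain K where K: "K \<ge> 0"
    "\<And>e t X s. 0 \<le> e \<Longrightarrow> e \<le> 1 \<Longrightarrow> \<bar>t\<bar> \<le> R \<Longrightarrow> (\<And>i j. i < 4 \<Longrightarrow> j < 4 \<Longrightarrow> \<bar>X i j\<bar> \<le> R) \<Longrightarrow>
      (\<And>i. i < 4 \<Longrightarrow> s i < 4) \<Longrightarrow>
      \<bar>pattern_wt s (kern e t X) - 1 - e\<^sup>2 * ((\<Sum>i<4. X i (s i)) + quad s t)\<bar> \<le> K * e ^ 3"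
    using pattern_wt_expansion[of R] by blast
  define C where "C = kern_const R"
  note C = kern_const[where R = R, folded C_def]
  define M where "M = (\<Sum>i\<in>Basis. \<Sum>k<m. \<bar>c i k\<bar>)"
  have M: "(\<Sum>k<m. \<bar>c i k\<bar>) \<le> M" "0 \<le> M" if "i \<in> Basis" for i
    unfolding M_def using that by (auto intro!: member_le_sum sum_nonneg)
  \<comment> \<open>The first bound keeps each of the two perturbation terms at most 1/2, for
    nonnegativity of the density. The second makes (M + 4) K e smaller than \<eta>: M accounts for
    the coefficients of the equations to be solved, 4 for the four weights in the certificate, and K
    + 1 avoids a zero denominator.\<close>
  define e where "e = min (1 / (2 * C)) (\<eta> / (2 * ((M + 4) * (K + 1))))"
  have M0: "0 \<le> M" unfolding M_def by (auto intro!: sum_nonneg)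
  have den: "0 < (M + 4) * (K + 1)" using M0 K(1) by (intro mult_pos_pos) auto
  have e0: "0 < e" using C(1) \<eta>(1) den by (simp add: e_def)
  have eC: "e \<le> 1 / (2 * C)" unfolding e_def by simp
  have eC': "e * C \<le> 1 / 2"
    using mult_right_mono[OF eC, of C] C(1) by simp
  have e1: "e \<le> 1"
    using eC C(1) by (auto intro: order_trans simp: divide_le_eq)
  have small: "(M + 4) * K * e < \<eta>"
  proof -
    have "(M + 4) * K * e \<le> (M + 4) * (K + 1) * e"
      using M0 e0 by (intro mult_right_mono mult_left_mono) auto
    also have "\<dots> \<le> (M + 4) * (K + 1) * (\<eta> / (2 * ((M + 4) * (K + 1))))"
      using den by (intro mult_left_mono) (auto simp: e_def)
    also have "\<dots> = \<eta> / 2" using den by (simp add: field_simps)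
    finally show ?thesis using \<eta>(1) by simp
  qed
  have approx: "\<bar>pattern_wt q (kern e (T u) (X u)) - 1 - e\<^sup>2 * ((\<Sum>i<4. X u i (q i)) + quad q (T u))\<bar> \<le> K * e ^ 3"
    if "u \<in> cbox a b" "\<And>i. i < 4 \<Longrightarrow> q i < 4" for u q
    using e0 e1 by (intro K(2) TR XR that) auto
  define \<Psi> where "\<Psi> i u = (\<Sum>k<m. c i k * (pattern_wt (s k) (kern e (T u) (X u)) - 1))" for i u
  have \<Psi>: "\<bar>\<Psi> i u - e\<^sup>2 * \<Phi> i u\<bar> \<le> e\<^sup>2 * \<eta>" if u: "u \<in> cbox a b" and i: "i \<in> Basis" for i u
  proof -
    have "\<Psi> i u - e\<^sup>2 * \<Phi> i u = (\<Sum>k<m. c i k * (pattern_wt (s k) (kern e (T u) (X u)) - 1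
        - e\<^sup>2 * ((\<Sum>j<4. X u j (s k j)) + quad (s k) (T u))))"
      unfolding \<Psi>_def \<Phi>_def sum_distrib_left sum_subtractf[symmetric]
      by (intro sum.cong) (simp_all add: algebra_simps)
    also have "\<bar>\<dots>\<bar> \<le> (\<Sum>k<m. \<bar>c i k\<bar> * (K * e ^ 3))"
      using u s by (intro order_trans[OF sum_abs] sum_mono) (auto simp: abs_mult intro!: mult_left_mono approx)
    also have "\<dots> = (\<Sum>k<m. \<bar>c i k\<bar>) * (K * e ^ 3)"
      by (simp add: sum_distrib_right)
    also have "\<dots> \<le> (M + 4) * (K * e ^ 3)"
      using M[OF i] K(1) e0 by (intro mult_right_mono) auto
    also have "\<dots> = e\<^sup>2 * ((M + 4) * K * e)"
      by (simp add: power2_eq_square power3_eq_cube)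
    also have "\<dots> \<le> e\<^sup>2 * \<eta>"
      using small by (intro mult_left_mono) auto
    finally show ?thesis .
  qed
  obtain u where u: "u \<in> cbox a b" "(\<Sum>i\<in>Basis. \<Psi> i u *\<^sub>R i) = 0"
  proof (rule poincare_miranda[of a b "\<lambda>u. \<Sum>i\<in>Basis. \<Psi> i u *\<^sub>R i"])
    show "continuous_on (cbox a b) (\<lambda>u. \<Sum>i\<in>Basis. \<Psi> i u *\<^sub>R i)"
      unfolding \<Psi>_def using e0 e1 s
      by (intro continuous_on_sum continuous_on_scaleR continuous_on_mult continuous_on_diff continuous_on_const
          continuous_on_pattern_wt[OF T X TR XR]) auto
    fix u i assume ui: "u \<in> cbox a b" "i \<in> (Basis :: 'a set)"
    have eq: "(\<Sum>i\<in>Basis. \<Psi> i u *\<^sub>R i) \<bullet> i = \<Psi> i u"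
      by (rule inner_sum_left_Basis[OF ui(2)])
    have e2: "0 \<le> e\<^sup>2" by simp
    show "(\<Sum>i\<in>Basis. \<Psi> i u *\<^sub>R i) \<bullet> i \<le> 0" if "u \<bullet> i = a \<bullet> i"
      unfolding eq using \<Psi>[OF ui] mult_left_mono[OF order_trans[OF lower0[OF ui that] le_imp_neg_le[OF \<eta>(2)]] e2] by (simp add: abs_le_iff)
    show "(\<Sum>i\<in>Basis. \<Psi> i u *\<^sub>R i) \<bullet> i \<ge> 0" if "u \<bullet> i = b \<bullet> i"
      unfolding eq using \<Psi>[OF ui] mult_left_mono[OF order_trans[OF \<eta>(2) upper0[OF ui that]] e2] by (simp add: abs_le_iff)
  qed (use ab in auto)
  let ?w = "kern e (T u) (X u)"
  show thesis
  proof (rule that[of ?w])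
    have density: "square_density ?w"
    proof (rule square_density_kern[OF sum0])
      fix x y :: real assume xy: "unit_ivl x" "unit_ivl y"
      have "\<bar>low (X u) x y\<bar> \<le> C"
        by (rule C(3)) (use XR u xy in auto)
      then have "\<bar>e * base (T u) x y\<bar> \<le> e * C" "\<bar>e\<^sup>2 * low (X u) x y\<bar> \<le> e * C"
        unfolding abs_mult using C e0 e1 C(2)[OF TR[OF u(1)] xy]
        by (intro mult_mono; simp add: power2_eq_square mult_left_le)+
      then show "\<bar>kern e (T u) (X u) x y - 1\<bar> \<le> 1"
        using eC' unfolding kern_def by linarith
    qed
    show "(\<Sum>k<m. c i k * (pattern_wt (s k) (kern e (T u) (X u)) - 1)) = 0" if "i \<in> Basis" for i
      using inner_sum_left_Basis[OF that, of "\<lambda>i. \<Psi> i u"] u(2) by (simp add: \<Psi>_def)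
    define N where "N q = pattern_wt q (kern e (T u) (X u))" for q
    define Q where "Q q = (\<Sum>i<4. X u i (q i)) + quad q (T u)" for q
    have N: "\<bar>N q - 1 - e\<^sup>2 * Q q\<bar> \<le> K * e ^ 3" if "\<And>i. i < 4 \<Longrightarrow> q i < 4" for q
      unfolding N_def Q_def using u(1) that by (rule approx)
    have Qdiff: "Q (idx \<sigma>1) + Q (idx \<sigma>2) - Q (idx \<sigma>3) - Q (idx \<sigma>4) = quad (idx \<sigma>1) (T u) + quad (idx \<sigma>2) (T u) - quad (idx \<sigma>3) (T u) - quad (idx \<sigma>4) (T u)"
      using vsum[of "X u"] by (simp add: Q_def)
    have "\<bar>(N (idx \<sigma>1) + N (idx \<sigma>2) - N (idx \<sigma>3) - N (idx \<sigma>4)) - e\<^sup>2 * (Q (idx \<sigma>1) + Q (idx \<sigma>2) - Q (idx \<sigma>3) - Q (idx \<sigma>4))\<bar> \<le> 4 * (K * e ^ 3)"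
    proof -
      have "\<bar>N (idx \<sigma>1) - 1 - e\<^sup>2 * Q (idx \<sigma>1)\<bar> \<le> K * e ^ 3" "\<bar>N (idx \<sigma>2) - 1 - e\<^sup>2 * Q (idx \<sigma>2)\<bar> \<le> K * e ^ 3"
        "\<bar>N (idx \<sigma>3) - 1 - e\<^sup>2 * Q (idx \<sigma>3)\<bar> \<le> K * e ^ 3" "\<bar>N (idx \<sigma>4) - 1 - e\<^sup>2 * Q (idx \<sigma>4)\<bar> \<le> K * e ^ 3"
        by (rule N; use v in blast)+
      then show ?thesis
        unfolding abs_le_iff right_diff_distrib distrib_left by linarith
    qed
    also have "4 * (K * e ^ 3) \<le> (M + 4) * (K * e ^ 3)"
      using M0 K(1) e0 by (intro mult_right_mono) auto
    also have "\<dots> = e\<^sup>2 * ((M + 4) * K * e)"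
      by (simp add: power2_eq_square power3_eq_cube)
    also have "\<dots> < e\<^sup>2 * \<eta>"
      using small e0 by (intro mult_strict_left_mono) auto
    also have "\<dots> \<le> e\<^sup>2 * \<bar>Q (idx \<sigma>1) + Q (idx \<sigma>2) - Q (idx \<sigma>3) - Q (idx \<sigma>4)\<bar>"
      unfolding Qdiff using \<eta>(3) vq1[OF u(1)] by (intro mult_left_mono) auto
    also have "\<dots> = \<bar>e\<^sup>2 * (Q (idx \<sigma>1) + Q (idx \<sigma>2) - Q (idx \<sigma>3) - Q (idx \<sigma>4))\<bar>"
      by (simp add: abs_mult)
    finally have "N (idx \<sigma>1) + N (idx \<sigma>2) - N (idx \<sigma>3) - N (idx \<sigma>4) \<noteq> 0"
      by auto
    with density perms show "nonuniform_density ?w"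
      unfolding N_def by (rule nonuniform_densityI)
  qed
qed

text \<open>Here t = 0 throughout, which falls under the small-t certificate. In a row k where s and
  s' differ, the cells \<open>s k\<close> and \<open>s' k\<close> tune the two weights
  independently, and a third cell z of that row, which neither pattern uses, restores total mass
  zero.\<close>

lemma density_for_pair:
  assumes s: "\<And>i. i < 4 \<Longrightarrow> s i < 4" and s': "\<And>i. i < 4 \<Longrightarrow> s' i < 4" and k: "k < 4" "s k \<noteq> s' k"
  obtains w where "nonuniform_density w" "pattern_wt s w = 1" "pattern_wt s' w = 1"
proof -
  obtain z where z: "z < 4" "z \<noteq> s k" "z \<noteq> s' k"
  proof -
    have "card {s k, s' k} < card {..<4::nat}"
      by (simp add: card_insert_if)
    then have "\<not> {..<4} \<subseteq> {s k, s' k}"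
      by (metis card_mono finite.emptyI finite_insert not_less)
    then show ?thesis using that by auto
  qed
  \<comment> \<open>One more than the two second-order offsets, so that on the faces at -M and M the
    sign is certain with margin 1.\<close>
  define M where "M = max \<bar>quad s 0\<bar> \<bar>quad s' 0\<bar> + 1"
  \<comment> \<open>total mass zero, and the sums along \<open>s\<close> and \<open>s'\<close> are the two coordinates\<close>
  define X where "X u i j = fst u * of_bool (i = k \<and> j = s k) + snd u * of_bool (i = k \<and> j = s' k)
      + (- (fst u + snd u)) * of_bool (i = k \<and> j = z)" for u :: "real \<times> real" and i j :: nat
  define S where "S = (\<lambda>n::nat. if n = 0 then s else s')"
  define c where "c = (\<lambda>i (n::nat). if n = 0 then fst i else snd (i :: real \<times> real))"
  let ?a = "(- M, - M)" and ?b = "(M, M)"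
  have M: "M \<ge> 1" "\<bar>quad s 0\<bar> \<le> M - 1" "\<bar>quad s' 0\<bar> \<le> M - 1"
    by (auto simp: M_def)
  have box: "cbox ?a ?b = {-M..M} \<times> {-M..M}"
    by (simp only: cbox_Pair_eq) (simp add: cbox_interval)
  have Xs: "(\<Sum>j<4. X u j (s j)) = fst u" "(\<Sum>j<4. X u j (s' j)) = snd u" for u
    unfolding X_def sum.distrib using k z by (simp_all only: sum_cell) auto
  have sum0: "(\<Sum>i<4. \<Sum>j<4. X u i j) = 0" for u
    unfolding X_def sum.distrib using k(1) s[OF k(1)] s'[OF k(1)] z(1) by (simp only: sum_cell_total)
  have \<Phi>: "(\<Sum>n<2::nat. c i n * ((\<Sum>j<4. X u j (S n j)) + quad (S n) 0)) = fst i * (fst u + quad s 0) + snd i * (snd u + quad s' 0)"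
    for i u
    by (simp add: numeral_2_eq_2 c_def S_def Xs)
  have Basis2: "(Basis :: (real \<times> real) set) = {(1, 0), (0, 1)}"
    by (simp add: Basis_prod_def insert_commute)
  have cell: "\<bar>r * of_bool P\<bar> \<le> \<bar>r\<bar>" for r :: real and P by simp
  have XR: "\<bar>X u i j\<bar> \<le> 4 * M" if "u \<in> cbox ?a ?b" for u i j
  proof -
    have u: "\<bar>fst u\<bar> \<le> M" "\<bar>snd u\<bar> \<le> M" using that unfolding box by auto
    have "\<bar>X u i j\<bar> \<le> \<bar>fst u\<bar> + \<bar>snd u\<bar> + \<bar>- (fst u + snd u)\<bar>"
      unfolding X_def by (intro order_trans[OF abs_triangle_ineq] add_mono cell)
    then show ?thesis using u by linarith
  qed
  show thesis
  proof (rule exists_nonuniform_density[of ?a ?b "\<lambda>_. 0" X "4 * M" 2 S 1 c 1])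
    show "?a \<bullet> i \<le> ?b \<bullet> i" if "i \<in> Basis" for i
      using that M unfolding Basis2 by auto
    show "continuous_on (cbox ?a ?b) (\<lambda>u. X u i j)" for i j
      unfolding X_def by (intro continuous_intros)
    show "S n i < 4" if "i < 4" for n i
      using that s s' by (simp add: S_def)
    show "(\<Sum>n<2::nat. c i n * ((\<Sum>j<4. X u j (S n j)) + quad (S n) 0)) \<le> - 1"
      if "u \<in> cbox ?a ?b" "i \<in> Basis" "u \<bullet> i = ?a \<bullet> i" for u i
      using that(2,3) M unfolding \<Phi> Basis2 by (cases u) (auto simp: abs_le_iff)
    show "1 \<le> (\<Sum>n<2::nat. c i n * ((\<Sum>j<4. X u j (S n j)) + quad (S n) 0))"
      if "u \<in> cbox ?a ?b" "i \<in> Basis" "u \<bullet> i = ?b \<bullet> i" for u i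
      using that(2,3) M unfolding \<Phi> Basis2 by (cases u) (auto simp: abs_le_iff)
    fix w assume w: "nonuniform_density w"
      "\<And>i :: real \<times> real. i \<in> Basis \<Longrightarrow> (\<Sum>n<2::nat. c i n * (pattern_wt (S n) w - 1)) = 0"
    have eq: "(\<Sum>n<2::nat. c i n * (pattern_wt (S n) w - 1)) = fst i * (pattern_wt s w - 1) + snd i * (pattern_wt s' w - 1)" for i
      by (simp add: numeral_2_eq_2 c_def S_def)
    have "pattern_wt s w = 1" "pattern_wt s' w = 1"
      using w(2)[of "(1, 0)"] w(2)[of "(0, 1)"] unfolding eq Basis2 by auto
    with w(1) show thesis using that by blast
  qed (use M XR sum0 in auto)
qed

text \<open>Three coordinates shift the weights of s1, s2, s3 through X; the fourth is t itself. In
  suitable linear combinations of the four equations the second-order system separates: each of the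
  first three components involves its own shift plus a bounded offset, and the fourth depends on t
  alone. The cell (a, C), which none of the four patterns uses, balances the total mass.\<close>

lemma density_for_quadruple:
  assumes abcd: "distinct [a, b, c, d]" "a < 4" "b < 4" "c < 4" "d < 4"
    and ABCD: "distinct [A, B, C, D]" "A < 4" "B < 4" "C < 4" "D < 4"
    and s1: "s1 a = A" "s1 b = B" "s1 c = C" "s1 d = D"
    and s2: "s2 a = B" "s2 b = A" "s2 c = D" "s2 d = C"
    and s3: "s3 a = A" "s3 b = B" "s3 c = D" "s3 d = C"
    and s4: "s4 a = B" "s4 b = A" "s4 c = C" "s4 d = D"
  obtains w where "nonuniform_density w"
    "pattern_wt s1 w = 1" "pattern_wt s2 w = 1" "pattern_wt s3 w = 1" "pattern_wt s4 w = 1"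
proof -
  let ?F = "quad_diff a b c d A B C D"
  define Xc where "Xc = bil 0 0 a b c d * bil 0 0 A B C D"
  define Yc where "Yc = bil 0 1 a b c d * bil 0 1 A B C D"
  define Zc where "Zc = bil 1 1 a b c d * bil 1 1 A B C D"
  have F: "?F t = Xc + 2 * Yc * t + Zc * t\<^sup>2" for t
    by (simp add: quad_diff_def Xc_def Yc_def Zc_def)
  note tab = bil_table[OF abcd] bil_table[OF ABCD]
  have Y0: "Yc \<noteq> 0"
    using tab by (simp add: Yc_def)
  have XZ: "Xc = 0 \<and> Zc = 0 \<or> Xc * Zc > 0 \<and> Xc * Zc < Yc\<^sup>2"
  \<comment> \<open>A zero means that the positions or the values are split as {0,2}, {1,3}, and
    then both diagonal products vanish. Otherwise the two discriminant inequalities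
    multiply.\<close>
  proof (cases "bil 0 0 a b c d = 0 \<or> bil 0 0 A B C D = 0")
    case True
    then have "Xc = 0 \<and> Zc = 0" using tab by (auto simp: Xc_def Zc_def)
    then show ?thesis by blast
  next
    case False
    define P Q where "P = bil 0 0 a b c d * bil 1 1 a b c d" and "Q = bil 0 0 A B C D * bil 1 1 A B C D"
    have PQ: "P > 0" "P < (bil 0 1 a b c d)\<^sup>2" "Q > 0" "Q < (bil 0 1 A B C D)\<^sup>2"
      using tab False by (auto simp: P_def Q_def)
    have "Xc * Zc = P * Q" by (simp add: Xc_def Zc_def P_def Q_def)
    moreover have "P * Q > 0" using PQ by simp
    moreover have "P * Q < Yc\<^sup>2"
      unfolding Yc_def power_mult_distrib using PQ by (intro mult_strict_mono) auto
    ultimately show ?thesis by simp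
  qed
  obtain p q where pq: "?F p * ?F q < 0" "p * q > 0 \<or> \<bar>p\<bar> \<le> 1 / 10 \<and> \<bar>q\<bar> \<le> 1 / 10"
    using quadratic_sign_change[OF Y0 XZ, of "1 / 10"] unfolding F by auto
  define t1 t2 where "t1 = min p q" and "t2 = max p q"
  \<comment> \<open>Orients the fourth equation so that it is negative at t1 and positive at t2, as
    the sign conditions on the faces demand.\<close>
  define \<theta> where "\<theta> = sgn (?F t2)"
  define \<eta>0 where "\<eta>0 = min \<bar>?F p\<bar> \<bar>?F q\<bar>"
  have Fpq: "?F p \<noteq> 0" "?F q \<noteq> 0" using pq(1) by auto
  then have \<eta>0: "\<eta>0 > 0" by (simp add: \<eta>0_def)
  have t12: "t1 \<le> t2" by (simp add: t1_def t2_def)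
  have ends: "?F t1 * ?F t2 < 0" "\<bar>?F t1\<bar> \<ge> \<eta>0" "\<bar>?F t2\<bar> \<ge> \<eta>0"
    using pq(1) by (auto simp: t1_def t2_def min_def max_def \<eta>0_def mult.commute)
  have \<theta>2: "\<theta> * ?F t2 \<ge> \<eta>0" and \<theta>1: "\<theta> * ?F t1 \<le> - \<eta>0"
    using ends by (auto simp: \<theta>_def sgn_if mult_less_0_iff split: if_splits)
  have \<theta>: "\<theta> \<noteq> 0" using ends(1) by (auto simp: \<theta>_def sgn_if)

  \<comment> \<open>If p and q have the same sign, every t between them has absolute value at least
    the smaller of |p| and |q|. In the other case t stays within 1/10 of 0 and the value 1 is
    arbitrary.\<close>
  define \<delta>' where "\<delta>' = (if p * q > 0 then min \<bar>p\<bar> \<bar>q\<bar> else 1)"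
  have dich: "\<delta>' > 0 \<and> ((\<forall>t\<in>{t1..t2}. \<bar>t\<bar> \<ge> \<delta>') \<or> (\<forall>t\<in>{t1..t2}. \<bar>t\<bar> \<le> 1 / 10))"
  proof (cases "p * q > 0")
    case True
    then have "(p > 0 \<and> q > 0) \<or> (p < 0 \<and> q < 0)"
      by (simp add: zero_less_mult_iff)
    then show ?thesis
      using True by (auto simp: t1_def t2_def \<delta>'_def)
  next
    case False
    then have "\<bar>p\<bar> \<le> 1 / 10" "\<bar>q\<bar> \<le> 1 / 10" using pq(2) by auto
    then show ?thesis
      using False by (auto simp: t1_def t2_def abs_le_iff \<delta>'_def)
  qed

  obtain M1 where M1: "M1 \<ge> 0" "\<And>t. t \<in> {t1..t2} \<Longrightarrow> \<bar>quad s1 t\<bar> \<le> M1"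
    using quad_bounded[of t1 t2 s1] by blast
  obtain M2 where M2: "M2 \<ge> 0" "\<And>t. t \<in> {t1..t2} \<Longrightarrow> \<bar>quad s2 t\<bar> \<le> M2"
    using quad_bounded[of t1 t2 s2] by blast
  obtain M3 where M3: "M3 \<ge> 0" "\<And>t. t \<in> {t1..t2} \<Longrightarrow> \<bar>quad s3 t\<bar> \<le> M3"
    using quad_bounded[of t1 t2 s3] by blast
  define M where "M = M1 + M2 + M3 + 1"
  have M: "M \<ge> 1" "\<And>t. t \<in> {t1..t2} \<Longrightarrow> \<bar>quad s1 t\<bar> \<le> M - 1" "\<And>t. t \<in> {t1..t2} \<Longrightarrow> \<bar>quad s2 t\<bar> \<le> M - 1"
    "\<And>t. t \<in> {t1..t2} \<Longrightarrow> \<bar>quad s3 t\<bar> \<le> M - 1"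
    using M1 M2 M3 by (force simp: M_def)+

  define y1 y2 y3 tt where "y1 u = fst u" and "y2 u = fst (snd u)" and "y3 u = fst (snd (snd u))"
    and "tt u = snd (snd (snd u))" for u :: "real \<times> real \<times> real \<times> real"
  \<comment> \<open>total mass zero, and the sums along \<open>s1\<close>, \<open>s2\<close>, \<open>s3\<close> are \<open>y1\<close>, \<open>y2\<close>, \<open>y3\<close>\<close>
  define X where "X u i j = y3 u * of_bool (i = a \<and> j = A) + y2 u * of_bool (i = a \<and> j = B)
      + (y1 u - y3 u) * of_bool (i = c \<and> j = C) + (- (y1 u + y2 u)) * of_bool (i = a \<and> j = C)"
    for u and i j :: nat
  define S where "S = (\<lambda>n::nat. if n = 0 then s1 else if n = 1 then s2 else if n = 2 then s3 else s4)"
  \<comment> \<open>Linear in i, so that the four basis vectors select the conditions for s1, s2, s3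
    one at a time and finally \<theta> times the alternating sum; the latter yields the condition
    for s4.\<close>
  define cf where "cf = (\<lambda>i (n::nat). if n = 0 then y1 i + \<theta> * tt i else if n = 1 then y2 i + \<theta> * tt i
      else if n = 2 then y3 i - \<theta> * tt i else - \<theta> * tt i)"
  let ?a = "(- M, - M, - M, t1)" and ?b = "(M, M, M, t2)"
  have box: "cbox ?a ?b = {-M..M} \<times> {-M..M} \<times> {-M..M} \<times> {t1..t2}"
    by (simp only: cbox_Pair_eq) (simp add: cbox_interval)
  have u_box: "\<bar>y1 u\<bar> \<le> M" "\<bar>y2 u\<bar> \<le> M" "\<bar>y3 u\<bar> \<le> M" "tt u \<in> {t1..t2}" if "u \<in> cbox ?a ?b" for u
    using that unfolding box y1_def y2_def y3_def tt_def by auto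
  have dist: "A \<noteq> B" "A \<noteq> C" "A \<noteq> D" "B \<noteq> C" "B \<noteq> D" "C \<noteq> D" using ABCD(1) by auto
  have Xs: "(\<Sum>j<4. X u j (s1 j)) = y1 u" "(\<Sum>j<4. X u j (s2 j)) = y2 u" "(\<Sum>j<4. X u j (s3 j)) = y3 u"
    "(\<Sum>j<4. X u j (s4 j)) = y1 u + y2 u - y3 u" for u
    unfolding X_def sum.distrib sum_cell[OF abcd(2)] sum_cell[OF abcd(4)] s1 s2 s3 s4 using dist by simp_all
  have sum0: "(\<Sum>i<4. \<Sum>j<4. X u i j) = 0" for u
    unfolding X_def sum.distrib sum_cell_total[OF abcd(2) ABCD(2)] sum_cell_total[OF abcd(2) ABCD(3)]
      sum_cell_total[OF abcd(2) ABCD(4)] sum_cell_total[OF abcd(4) ABCD(4)] by simp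
  have four: "(\<Sum>n<4::nat. f n) = f 0 + f 1 + f 2 + f 3" for f :: "nat \<Rightarrow> real"
    by (simp add: lessThan_4)
  have Fq: "quad s1 t + quad s2 t - quad s3 t - quad s4 t = ?F t" for t
    by (rule quad_diff_eq[OF abcd ABCD s1 s2 s3 s4])
  have \<Phi>: "(\<Sum>n<4::nat. cf i n * ((\<Sum>j<4. X u j (S n j)) + quad (S n) (tt u)))
      = y1 i * (y1 u + quad s1 (tt u)) + y2 i * (y2 u + quad s2 (tt u)) + y3 i * (y3 u + quad s3 (tt u))
        + tt i * (\<theta> * ?F (tt u))" for i u
    unfolding Fq[symmetric] by (subst four) (simp add: cf_def S_def Xs algebra_simps)
  define \<eta>' where "\<eta>' = min \<eta>0 1"
  have \<eta>': "\<eta>' > 0" "\<eta>' \<le> \<eta>0" "\<eta>' \<le> 1"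
    using \<eta>0 by (auto simp: \<eta>'_def)
  define R where "R = 6 * M + \<bar>t1\<bar> + \<bar>t2\<bar>"
  have cell: "\<bar>r * of_bool P\<bar> \<le> \<bar>r\<bar>" for r :: real and P by simp
  have XR: "\<bar>X u i j\<bar> \<le> R" if "u \<in> cbox ?a ?b" for u i j
  proof -
    have "\<bar>X u i j\<bar> \<le> \<bar>y3 u\<bar> + \<bar>y2 u\<bar> + \<bar>y1 u - y3 u\<bar> + \<bar>- (y1 u + y2 u)\<bar>"
      unfolding X_def by (intro order_trans[OF abs_triangle_ineq] add_mono cell)
    also have "\<dots> \<le> 6 * M" using u_box(1-3)[OF that] by linarith
    finally show ?thesis by (simp add: R_def)
  qed
  have TR: "\<bar>tt u\<bar> \<le> R" if "u \<in> cbox ?a ?b" for u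
    using u_box(4)[OF that] M(1) by (auto simp: R_def)
  show thesis
  proof (rule exists_nonuniform_density[of ?a ?b tt X R 4 S \<eta>' cf \<delta>'])
    show "?a \<bullet> i \<le> ?b \<bullet> i" if "i \<in> Basis" for i
      using that M(1) t12 unfolding basis_real4 by auto
    show "continuous_on (cbox ?a ?b) tt"
      unfolding tt_def by (intro continuous_intros)
    show "continuous_on (cbox ?a ?b) (\<lambda>u. X u i j)" for i j
      unfolding X_def y1_def y2_def y3_def by (intro continuous_intros)
    show "S n i < 4" if "i < 4" for n i
    proof -
      have "s1 i < 4 \<and> s2 i < 4 \<and> s3 i < 4 \<and> s4 i < 4"
        by (rule all_less_4_distinct[OF abcd _ _ _ _ that]) (simp_all add: s1 s2 s3 s4 ABCD(2-5))
      then show ?thesis by (simp add: S_def)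
    qed
    show "(\<Sum>n<4. cf i n * ((\<Sum>j<4. X u j (S n j)) + quad (S n) (tt u))) \<le> - \<eta>'"
      if u: "u \<in> cbox ?a ?b" and i: "i \<in> Basis" "u \<bullet> i = ?a \<bullet> i" for u i
      using i M(2-4)[OF u_box(4)[OF u]] \<theta>1 \<eta>' unfolding \<Phi> basis_real4
      by (cases u) (auto simp: y1_def y2_def y3_def tt_def abs_le_iff)
    show "\<eta>' \<le> (\<Sum>n<4. cf i n * ((\<Sum>j<4. X u j (S n j)) + quad (S n) (tt u)))"
      if u: "u \<in> cbox ?a ?b" and i: "i \<in> Basis" "u \<bullet> i = ?b \<bullet> i" for u i
      using i M(2-4)[OF u_box(4)[OF u]] \<theta>2 \<eta>' unfolding \<Phi> basis_real4
      by (cases u) (auto simp: y1_def y2_def y3_def tt_def abs_le_iff)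
    show "\<delta>' > 0" using dich by blast
    show "(\<forall>u\<in>cbox ?a ?b. \<delta>' \<le> \<bar>tt u\<bar>) \<or> (\<forall>u\<in>cbox ?a ?b. \<bar>tt u\<bar> \<le> 1 / 10)"
      using dich u_box(4) by blast
    fix w assume w: "nonuniform_density w"
      "\<And>i :: real \<times> real \<times> real \<times> real. i \<in> Basis \<Longrightarrow> (\<Sum>n<4. cf i n * (pattern_wt (S n) w - 1)) = 0"
    have eq: "(\<Sum>n<4::nat. cf i n * (pattern_wt (S n) w - 1)) = y1 i * (pattern_wt s1 w - 1) + y2 i * (pattern_wt s2 w - 1)
        + y3 i * (pattern_wt s3 w - 1)
        + tt i * (\<theta> * (pattern_wt s1 w + pattern_wt s2 w - pattern_wt s3 w - pattern_wt s4 w))" for i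
      unfolding four by (simp add: cf_def S_def algebra_simps)
    have "pattern_wt s1 w = 1" "pattern_wt s2 w = 1" "pattern_wt s3 w = 1"
      "\<theta> * (pattern_wt s1 w + pattern_wt s2 w - pattern_wt s3 w - pattern_wt s4 w) = 0"
      using w(2)[of "(1, 0, 0, 0)"] w(2)[of "(0, 1, 0, 0)"] w(2)[of "(0, 0, 1, 0)"] w(2)[of "(0, 0, 0, 1)"]
      unfolding eq basis_real4 by (auto simp: y1_def y2_def y3_def tt_def)
    moreover from this have "pattern_wt s4 w = 1" using \<theta> by simp
    ultimately show thesis using w(1) that by blast
  qed (use sum0 XR TR \<eta>' in auto)
qed

section \<open>Permutations sampled from a density\<close>

text \<open>The four points are required to be listed by increasing first coordinate, so among the
  orderings of a set of four points at most one satisfies the event, and counting tuples counts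
  sets.\<close>

definition pattern_event :: "nat list \<Rightarrow> (nat \<Rightarrow> real \<times> real) \<Rightarrow> bool" where
  "pattern_event \<sigma> z \<longleftrightarrow> ordered4 (\<lambda>i. fst (z i)) \<and>
     (\<forall>i<4. \<forall>j<4. snd (z i) < snd (z j) \<longleftrightarrow> \<sigma> ! i < \<sigma> ! j)"

lemma nths_eq_map_sorted_list_of_set:
  assumes "I \<subseteq> {..<length xs}"
  shows "nths xs I = map ((!) xs) (sorted_list_of_set I)"
proof -
  have fin: "finite I" using assms finite_subset by blast
  have "filter (\<lambda>i. i \<in> I) [0..<length xs] = sorted_list_of_set I"
    using assms fin by (intro sorted_distinct_set_unique) (auto simp: sorted_wrt_filter)
  moreover have "nths [0..<length xs] I = filter (\<lambda>i. i \<in> I) [0..<length xs]"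
    unfolding filter_eq_nths using assms by (intro arg_cong[where f = "nths [0..<length xs]"]) auto
  moreover have "nths xs I = nths (map ((!) xs) [0..<length xs]) I"
    by (simp only: map_nth)
  ultimately show ?thesis
    by (simp only: nths_map)
qed

text \<open>Reading the points from left to right, \<open>xs\<close> holds their indices and \<pi>
  the ranks of their heights. Injectivity of both coordinates excludes ties.\<close>

lemma permutation_of_points:
  fixes z :: "nat \<Rightarrow> real \<times> real"
  assumes inj: "inj_on (\<lambda>i. fst (z i)) {..<n}" "inj_on (\<lambda>i. snd (z i)) {..<n}"
  obtains \<pi> xs where "is_permutation \<pi>" "length \<pi> = n"
    "bij_betw ((!) xs) {..<n} {..<n}"
    "\<And>i j. i < n \<Longrightarrow> j < n \<Longrightarrow> fst (z (xs ! i)) < fst (z (xs ! j)) \<longleftrightarrow> i < j"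
    "\<And>i j. i < n \<Longrightarrow> j < n \<Longrightarrow> \<pi> ! i < \<pi> ! j \<longleftrightarrow> snd (z (xs ! i)) < snd (z (xs ! j))"
proof -
  define xs where "xs = sort_key (\<lambda>i. fst (z i)) [0..<n]"
  have xs: "set xs = {..<n}" "distinct xs" "length xs = n"
    by (auto simp: xs_def)
  have bij: "bij_betw ((!) xs) {..<n} {..<n}"
    using bij_betw_nth[OF xs(2)] xs by auto
  have lt: "xs ! i < n" if "i < n" for i
    using bij that by (auto simp: bij_betw_def)
  have sorted: "sorted (map (\<lambda>i. fst (z i)) xs)"
    by (simp add: xs_def)
  have key: "fst (z (xs ! i)) < fst (z (xs ! j))" if "i < j" "j < n" for i j
  proof -
    have "fst (z (xs ! i)) \<le> fst (z (xs ! j))"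
      using sorted_nth_mono[OF sorted, of i j] that xs by simp
    moreover have "fst (z (xs ! i)) \<noteq> fst (z (xs ! j))"
      using inj_onD[OF inj(1), of "xs ! i" "xs ! j"] lt[of i] lt[of j] that xs nth_eq_iff_index_eq[OF xs(2), of i j] by auto
    ultimately show ?thesis by simp
  qed
  have key_iff: "fst (z (xs ! i)) < fst (z (xs ! j)) \<longleftrightarrow> i < j" if "i < n" "j < n" for i j
    using key[of i j] key[of j i] that by (cases i j rule: linorder_cases) auto
  \<comment> \<open>The non-strict comparison counts the point itself, so ranks start at 1 as values
    of a permutation do.\<close>
  define rank where "rank i = card {j. j < n \<and> snd (z j) \<le> snd (z i)}" for i
  have rank_iff: "rank i < rank j \<longleftrightarrow> snd (z i) < snd (z j)" if "i < n" "j < n" for i j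
  proof
    assume "snd (z i) < snd (z j)"
    then have "{k. k < n \<and> snd (z k) \<le> snd (z i)} \<subseteq> {k. k < n \<and> snd (z k) \<le> snd (z j)}"
      "j \<in> {k. k < n \<and> snd (z k) \<le> snd (z j)}" "j \<notin> {k. k < n \<and> snd (z k) \<le> snd (z i)}"
      using that by (auto intro: order_trans less_imp_le)
    then show "rank i < rank j"
      unfolding rank_def by (intro psubset_card_mono) (simp, blast)
  next
    assume lt: "rank i < rank j"
    show "snd (z i) < snd (z j)"
    proof (rule ccontr)
      assume "\<not> snd (z i) < snd (z j)"
      then have "rank j \<le> rank i"
        unfolding rank_def by (intro card_mono) auto
      with lt show False by simp
    qed
  qed
  have rank_range: "rank i \<in> {1..n}" if "i < n" for i
  proof -
    have "rank i \<le> card {..<n}"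
      unfolding rank_def by (intro card_mono) auto
    moreover have "rank i > 0"
      unfolding rank_def using that by (subst card_gt_0_iff) auto
    ultimately show ?thesis by simp
  qed
  have rank_inj: "inj_on rank {..<n}"
  proof (rule inj_onI)
    fix i j assume ij: "i \<in> {..<n}" "j \<in> {..<n}" "rank i = rank j"
    then have "snd (z i) = snd (z j)"
      using rank_iff[of i j] rank_iff[of j i] by auto
    with ij inj_onD[OF inj(2)] show "i = j" by auto
  qed
  define \<pi> where "\<pi> = map rank xs"
  have len: "length \<pi> = n" by (simp add: \<pi>_def xs)
  have "distinct \<pi>"
    using xs rank_inj by (simp add: \<pi>_def distinct_map)
  moreover have "set \<pi> = {1..n}"
  proof (rule card_subset_eq)
    show "card (set \<pi>) = card {1..n}"
      using distinct_card[OF \<open>distinct \<pi>\<close>] len by simp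
  qed (use xs rank_range in \<open>auto simp: \<pi>_def\<close>)
  ultimately have "is_permutation \<pi>"
    using len by (intro is_permutationI) auto
  moreover have "\<pi> ! i < \<pi> ! j \<longleftrightarrow> snd (z (xs ! i)) < snd (z (xs ! j))" if "i < n" "j < n" for i j
    using that xs rank_iff[OF lt lt] by (simp add: \<pi>_def)
  ultimately show thesis
    using that[OF _ len bij key_iff] by blast
qed

abbreviation occurrences :: "nat \<Rightarrow> nat list \<Rightarrow> nat list \<Rightarrow> nat set set" where
  "occurrences n \<pi> \<sigma> \<equiv> {I. I \<subseteq> {..<n} \<and> card I = 4 \<and> order_isomorphic (nths \<pi> I) \<sigma>}"

text \<open>A set of four positions corresponds to the tuple of point indices found there from left
  to right. Conversely, a tuple satisfying the event is sorted by first coordinate, so its positions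
  increase and it arises from the set of these positions.\<close>

lemma pattern_count_of_points:
  fixes z :: "nat \<Rightarrow> real \<times> real"
  assumes inj: "inj_on (\<lambda>i. fst (z i)) {..<n}" "inj_on (\<lambda>i. snd (z i)) {..<n}"
  obtains \<pi> where "is_permutation \<pi>" "length \<pi> = n"
    "\<And>\<sigma>. length \<sigma> = 4 \<Longrightarrow>
      card (occurrences n \<pi> \<sigma>)
        = card {e \<in> {..<4} \<rightarrow>\<^sub>E {..<n}. pattern_event \<sigma> (\<lambda>k. z (e k))}"
proof -
  obtain \<pi> xs where \<pi>: "is_permutation \<pi>" "length \<pi> = n"
    and bij: "bij_betw ((!) xs) {..<n} {..<n}"
    and key: "\<And>i j. i < n \<Longrightarrow> j < n \<Longrightarrow> fst (z (xs ! i)) < fst (z (xs ! j)) \<longleftrightarrow> i < j"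
    and val: "\<And>i j. i < n \<Longrightarrow> j < n \<Longrightarrow> \<pi> ! i < \<pi> ! j \<longleftrightarrow> snd (z (xs ! i)) < snd (z (xs ! j))"
    using permutation_of_points[OF inj] by blast
  have nth_inj: "inj_on ((!) xs) {..<n}" and nth_img: "(!) xs ` {..<n} = {..<n}"
    using bij by (auto simp: bij_betw_def)
  define h where "h I = (\<lambda>k\<in>{..<4}. xs ! (sorted_list_of_set I ! k))" for I
  have list: "length (sorted_list_of_set I) = 4" "set (sorted_list_of_set I) = I"
    "\<And>k. k < 4 \<Longrightarrow> sorted_list_of_set I ! k < n"
    "\<And>k l. k < 4 \<Longrightarrow> l < 4 \<Longrightarrow> k < l \<Longrightarrow> sorted_list_of_set I ! k < sorted_list_of_set I ! l"
    if I: "I \<subseteq> {..<n}" "card I = 4" for I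
  proof -
    have fin: "finite I" using I finite_subset by blast
    show len: "length (sorted_list_of_set I) = 4" and set: "set (sorted_list_of_set I) = I"
      using fin I by auto
    show "sorted_list_of_set I ! k < n" if "k < 4" for k
      using nth_mem[of k "sorted_list_of_set I"] that len set I by auto
    show "sorted_list_of_set I ! k < sorted_list_of_set I ! l" if "k < 4" "l < 4" "k < l" for k l
      using sorted_wrt_nth_less[OF strict_sorted_list_of_set[of I], of k l] that len by simp
  qed
  have event_iff: "order_isomorphic (nths \<pi> I) \<sigma> \<longleftrightarrow> pattern_event \<sigma> (\<lambda>k. z (h I k))"
    if I: "I \<subseteq> {..<n}" "card I = 4" and \<sigma>: "length \<sigma> = 4" for I \<sigma>
  proof -
    let ?l = "sorted_list_of_set I"
    have nths: "nths \<pi> I = map ((!) \<pi>) ?l"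
      using I \<pi>(2) by (intro nths_eq_map_sorted_list_of_set) auto
    have "ordered4 (\<lambda>k. fst (z (h I k)))"
      using key list(3,4)[OF I] by (simp add: ordered4_def h_def)
    moreover have "nths \<pi> I ! i < nths \<pi> I ! j \<longleftrightarrow> snd (z (h I i)) < snd (z (h I j))" if "i < 4" "j < 4" for i j
      unfolding nths h_def using that val[OF list(3)[OF I that(1)] list(3)[OF I that(2)]] list(1)[OF I] by simp
    moreover have "length (nths \<pi> I) = 4"
      using nths list(1)[OF I] by simp
    ultimately show ?thesis
      unfolding order_isomorphic_def pattern_event_def using \<sigma> by auto
  qed
  have h_mem: "h I \<in> {..<4} \<rightarrow>\<^sub>E {..<n}" if I: "I \<subseteq> {..<n}" "card I = 4" for I
    using list(3)[OF I] nth_img unfolding h_def by auto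
  have h_image: "h I ` {..<4} = (!) xs ` I" if I: "I \<subseteq> {..<n}" "card I = 4" for I
  proof -
    have "h I ` {..<4} = (!) xs ` ((!) (sorted_list_of_set I) ` {..<length (sorted_list_of_set I)})"
      unfolding list(1)[OF I] image_image by (intro image_cong) (auto simp: h_def)
    then show ?thesis
      using list(2)[OF I] by (simp only: nth_image[OF order_refl] take_all[OF order_refl] lessThan_atLeast0)
  qed
  have "card (occurrences n \<pi> \<sigma>)
        = card {e \<in> {..<4} \<rightarrow>\<^sub>E {..<n}. pattern_event \<sigma> (\<lambda>k. z (e k))}" if \<sigma>: "length \<sigma> = 4" for \<sigma>
  proof (rule bij_betw_same_card[of h], rule bij_betw_imageI)
    show "inj_on h (occurrences n \<pi> \<sigma>)"
    proof (rule inj_onI)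
      fix I J assume I: "I \<in> (occurrences n \<pi> \<sigma>)"
        and J: "J \<in> (occurrences n \<pi> \<sigma>)" and eq: "h I = h J"
      have "(!) xs ` I = (!) xs ` J"
        using h_image[of I] h_image[of J] I J eq by auto
      then show "I = J"
        using inj_on_image_eq_iff[OF nth_inj, of I J] I J by auto
    qed
    show "h ` (occurrences n \<pi> \<sigma>)
        = {e \<in> {..<4} \<rightarrow>\<^sub>E {..<n}. pattern_event \<sigma> (\<lambda>k. z (e k))}"
    proof (intro equalityI subsetI)
      fix e assume "e \<in> h ` (occurrences n \<pi> \<sigma>)"
      then show "e \<in> {e \<in> {..<4} \<rightarrow>\<^sub>E {..<n}. pattern_event \<sigma> (\<lambda>k. z (e k))}"
        using h_mem event_iff \<sigma> by auto
    next
      fix e assume e: "e \<in> {e \<in> {..<4} \<rightarrow>\<^sub>E {..<n}. pattern_event \<sigma> (\<lambda>k. z (e k))}"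
      define t where "t k = inv_into {..<n} ((!) xs) (e k)" for k
      have ek: "e k \<in> (!) xs ` {..<n}" if "k < 4" for k
        using e that nth_img by (auto simp: PiE_iff)
      have t: "t k < n" "xs ! t k = e k" if "k < 4" for k
        using inv_into_into[OF ek[OF that]] f_inv_into_f[OF ek[OF that]] by (auto simp: t_def)
      have "fst (z (xs ! t k)) < fst (z (xs ! t (Suc k)))" if "k < 3" for k
      proof -
        have "k = 0 \<or> k = 1 \<or> k = 2" using that by auto
        then show ?thesis
          using e t(2)[of k] t(2)[of "Suc k"] that
          by (auto simp: pattern_event_def ordered4_def numeral_2_eq_2 numeral_3_eq_3)
      qed
      then have inc: "t k < t (Suc k)" if "k < 3" for k
        using key[of "t k" "t (Suc k)"] t(1)[of k] t(1)[of "Suc k"] that by auto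
      have t_inc: "t 0 < t 1" "t 1 < t 2" "t 2 < t 3"
        using inc[of 0] inc[of 1] inc[of 2] by (simp_all add: numeral_2_eq_2 numeral_3_eq_3)
      define I where "I = {t 0, t 1, t 2, t 3}"
      have I: "I \<subseteq> {..<n}" "card I = 4"
        using t(1)[of 0] t(1)[of 1] t(1)[of 2] t(1)[of 3] t_inc by (auto simp: I_def)
      have l: "sorted_list_of_set I = [t 0, t 1, t 2, t 3]"
        using I t_inc by (intro sorted_distinct_set_unique) (auto simp: I_def)
      have he: "h I = e"
      proof (rule ext)
        fix k
        show "h I k = e k"
        proof (cases "k < 4")
          case True
          then show ?thesis
            using less_4_cases[OF True] t(2)[OF True] unfolding h_def l by auto
        next
          case False
          then show ?thesis
            using e by (auto simp: h_def PiE_def extensional_def)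
        qed
      qed
      then have "order_isomorphic (nths \<pi> I) \<sigma>"
        using event_iff[OF I \<sigma>] e by auto
      then show "e \<in> h ` (occurrences n \<pi> \<sigma>)"
        using I he by blast
    qed
  qed
  then show thesis
    using that[OF \<pi>] by blast
qed

section \<open>Independent points with density w\<close>

definition sample_measure :: "(real \<Rightarrow> real \<Rightarrow> real) \<Rightarrow> (real \<times> real) measure" where
  "sample_measure w = density (unif \<Otimes>\<^sub>M unif) (\<lambda>(x, y). ennreal (w x y))"

lemma sets_sample_measure [simp, measurable_cong]: "sets (sample_measure w) = sets (borel \<Otimes>\<^sub>M borel)"
  by (simp add: sample_measure_def cong: sets_pair_measure_cong)

interpretation unif2: pair_prob_space unif unif
  by standard

lemma square_densityD:
  assumes "square_density w"
  shows "(\<lambda>(x, y). w x y) \<in> borel_measurable (borel \<Otimes>\<^sub>M borel)"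
    and "\<And>x y. 0 \<le> x \<Longrightarrow> x \<le> 1 \<Longrightarrow> 0 \<le> y \<Longrightarrow> y \<le> 1 \<Longrightarrow> 0 \<le> w x y"
    and "(\<integral>x. (\<integral>y. w x y \<partial>unif) \<partial>unif) = 1"
    and "\<exists>C. \<forall>x y. 0 \<le> x \<longrightarrow> x \<le> 1 \<longrightarrow> 0 \<le> y \<longrightarrow> y \<le> 1 \<longrightarrow> w x y \<le> C"
  using assms by (auto simp: square_density_def)

lemma AE_unif2: "AE z in unif \<Otimes>\<^sub>M unif. 0 \<le> fst z \<and> fst z \<le> 1 \<and> 0 \<le> snd z \<and> snd z \<le> 1"
proof (rule unif2.AE_pair_measure)
  show "{z \<in> space (unif \<Otimes>\<^sub>M unif). 0 \<le> fst z \<and> fst z \<le> 1 \<and> 0 \<le> snd z \<and> snd z \<le> 1} \<in> sets (unif \<Otimes>\<^sub>M unif)"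
    by measurable
  show "AE x in unif. AE y in unif. 0 \<le> fst (x, y) \<and> fst (x, y) \<le> 1 \<and> 0 \<le> snd (x, y) \<and> snd (x, y) \<le> 1"
    using AE_unif
  proof eventually_elim
    case (elim x)
    note x = this
    show ?case
      using AE_unif by eventually_elim (use x in simp)
  qed
qed

lemma prob_space_sample_measure:
  assumes w: "square_density w"
  shows "prob_space (sample_measure w)"
proof
  note meas [measurable] = square_densityD(1)[OF w]
  obtain C where C: "\<And>x y. 0 \<le> x \<Longrightarrow> x \<le> 1 \<Longrightarrow> 0 \<le> y \<Longrightarrow> y \<le> 1 \<Longrightarrow> w x y \<le> C"
    using square_densityD(4)[OF w] by blast
  have int: "integrable (unif \<Otimes>\<^sub>M unif) (\<lambda>(x, y). w x y)"
  proof (rule unif2.integrable_const_bound[where B = C])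
    show "AE z in unif \<Otimes>\<^sub>M unif. norm (case z of (x, y) \<Rightarrow> w x y) \<le> C"
      using AE_unif2
    proof eventually_elim
      case (elim z)
      then show ?case
        using C[of "fst z" "snd z"] square_densityD(2)[OF w, of "fst z" "snd z"] by (simp add: case_prod_beta)
    qed
  qed measurable
  have nonneg: "AE z in unif \<Otimes>\<^sub>M unif. 0 \<le> (case z of (x, y) \<Rightarrow> w x y)"
    using AE_unif2
  proof eventually_elim
    case (elim z)
    then show ?case
      using square_densityD(2)[OF w, of "fst z" "snd z"] by (simp add: case_prod_beta)
  qed
  have "emeasure (sample_measure w) (space (sample_measure w)) = (\<integral>\<^sup>+z. ennreal (case z of (x, y) \<Rightarrow> w x y) \<partial>(unif \<Otimes>\<^sub>M unif))"
    unfolding sample_measure_def using sets.top[of "borel \<Otimes>\<^sub>M borel :: (real \<times> real) measure"]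
    by (subst emeasure_density) (auto intro!: nn_integral_cong simp: space_pair_measure)
  also have "\<dots> = ennreal (\<integral>z. (case z of (x, y) \<Rightarrow> w x y) \<partial>(unif \<Otimes>\<^sub>M unif))"
    by (rule nn_integral_eq_integral[OF int nonneg])
  also have "(\<integral>z. (case z of (x, y) \<Rightarrow> w x y) \<partial>(unif \<Otimes>\<^sub>M unif)) = 1"
    using unif2.integral_fst[OF int] square_densityD(3)[OF w] by simp
  finally show "emeasure (sample_measure w) (space (sample_measure w)) = 1"
    by simp
qed

abbreviation cube2 :: "nat set \<Rightarrow> ((nat \<Rightarrow> real) \<times> (nat \<Rightarrow> real)) measure" where
  "cube2 I \<equiv> cube I \<Otimes>\<^sub>M cube I"

abbreviation zip_points :: "nat set \<Rightarrow> (nat \<Rightarrow> real) \<times> (nat \<Rightarrow> real) \<Rightarrow> nat \<Rightarrow> real \<times> real" where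
  "zip_points I \<equiv> \<lambda>(x, y). \<lambda>i\<in>I. (x i, y i)"

lemma measurable_at_points:
  assumes f: "(\<lambda>(x, y). f x y) \<in> borel_measurable (borel \<Otimes>\<^sub>M borel)" and ij: "i \<in> I" "j \<in> I"
  shows "(\<lambda>z. f (fst z i) (snd z j)) \<in> borel_measurable (cube2 I)"
proof -
  have "(\<lambda>z. (fst z i, snd z j)) \<in> cube2 I \<rightarrow>\<^sub>M borel \<Otimes>\<^sub>M borel"
    by (intro measurable_Pair measurable_compose[OF measurable_fst measurable_cube_component[OF ij(1)]]
        measurable_compose[OF measurable_snd measurable_cube_component[OF ij(2)]])
  from measurable_compose[OF this f] show ?thesis by simp
qed

lemma measurable_zip:
  "(zip_points I) \<in> cube2 I \<rightarrow>\<^sub>M PiM I (\<lambda>_. borel \<Otimes>\<^sub>M borel)"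
  unfolding case_prod_beta
proof (rule measurable_restrict)
  fix i assume [measurable]: "i \<in> I"
  show "(\<lambda>z. (fst z i, snd z i)) \<in> cube2 I \<rightarrow>\<^sub>M borel \<Otimes>\<^sub>M borel"
    by measurable
qed

lemma measurable_prod_density:
  assumes w: "square_density w"
  shows "(\<lambda>(x, y). \<Prod>i\<in>I. ennreal (w (x i) (y i)))
    \<in> borel_measurable (cube2 I)"
  unfolding case_prod_beta
  by (intro borel_measurable_prod_ennreal measurable_compose[OF _ measurable_ennreal]
      measurable_at_points square_densityD(1)[OF w])

text \<open>Independent points with density w are pairs from two independent uniform vectors,
  reweighted by the product of the densities. This separates the coordinates, so that the second one
  can later be relabelled alone. On boxes the weight and the indicator combine into one factor per
  index, and both integrals factor.\<close>

lemma PiM_sample_measure: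
  assumes w: "square_density w" and I: "finite (I :: nat set)"
  shows "PiM I (\<lambda>_. sample_measure w) =
    distr (density (cube2 I) (\<lambda>(x, y). \<Prod>i\<in>I. ennreal (w (x i) (y i))))
      (PiM I (\<lambda>_. borel \<Otimes>\<^sub>M borel)) (zip_points I)" (is "_ = ?P")
proof (rule product_sigma_finite.PiM_eqI[symmetric, OF _ I])
  note meas [measurable] = square_densityD(1)[OF w]
  interpret pm: prob_space "sample_measure w"
    by (rule prob_space_sample_measure[OF w])
  show "product_sigma_finite (\<lambda>_::nat. sample_measure w)"
    by standard
  show "sets ?P = sets (PiM I (\<lambda>_. sample_measure w))"
    by (simp cong: sets_PiM_cong)
  fix A assume A: "\<And>i. i \<in> I \<Longrightarrow> A i \<in> sets (sample_measure w)"
  let ?U = "cube I"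
  have Am [measurable]: "A i \<in> sets (borel \<Otimes>\<^sub>M borel)" if "i \<in> I" for i
    using A[OF that] by simp
  have PiA: "Pi\<^sub>E I A \<in> sets (PiM I (\<lambda>_. borel \<Otimes>\<^sub>M borel))"
    using Am by (intro sets_PiM_I_finite I) auto
  define F where "F i x y = ennreal (w x y) * indicator (A i) (x, y)" for i x y
  have Fm [measurable]: "(\<lambda>(x, y). F i x y) \<in> borel_measurable (borel \<Otimes>\<^sub>M borel)" if [measurable]: "i \<in> I" for i
    unfolding F_def by measurable
  note Fmz = measurable_at_points[OF Fm]
  have "emeasure ?P (Pi\<^sub>E I A) = (\<integral>\<^sup>+z. (\<Prod>i\<in>I. ennreal (w (fst z i) (snd z i)))
      * indicator ((zip_points I) -` Pi\<^sub>E I A \<inter> space (cube2 I)) z \<partial>(cube2 I))"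
    using PiA measurable_zip[of I] measurable_prod_density[OF w, of I]
    by (subst emeasure_distr, simp, simp, subst emeasure_density)
      (auto simp: case_prod_beta intro!: measurable_sets[OF measurable_zip[unfolded case_prod_beta]])
  also have "\<dots> = (\<integral>\<^sup>+z. (\<Prod>i\<in>I. F i (fst z i) (snd z i)) \<partial>(cube2 I))"
  proof (rule nn_integral_cong)
    fix z assume z: "z \<in> space (cube2 I)"
    have "indicator ((zip_points I) -` Pi\<^sub>E I A \<inter> space (cube2 I)) z
        = (\<Prod>i\<in>I. indicator (A i) (fst z i, snd z i) :: ennreal)"
    proof (cases "\<forall>i\<in>I. (fst z i, snd z i) \<in> A i")
      case True
      then show ?thesis using z by (simp add: case_prod_beta PiE_iff)
    next
      case False
      then show ?thesis using I by (auto simp: case_prod_beta PiE_iff indicator_def intro!: prod_zero[symmetric])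
    qed
    then show "(\<Prod>i\<in>I. ennreal (w (fst z i) (snd z i)))
      * indicator ((zip_points I) -` Pi\<^sub>E I A \<inter> space (cube2 I)) z = (\<Prod>i\<in>I. F i (fst z i) (snd z i))"
      by (simp add: F_def prod.distrib)
  qed
  also have "\<dots> = (\<integral>\<^sup>+x. (\<integral>\<^sup>+y. (\<Prod>i\<in>I. F i (x i) (y i)) \<partial>?U) \<partial>?U)"
    using Fmz by (subst sigma_finite_measure.nn_integral_fst[OF prob_space_imp_sigma_finite[OF prob_space_cube], symmetric]) (auto intro!: borel_measurable_prod_ennreal)
  also have "\<dots> = (\<integral>\<^sup>+x. (\<Prod>i\<in>I. (\<integral>\<^sup>+y. F i (x i) y \<partial>unif)) \<partial>?U)"
  proof (rule nn_integral_cong)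
    fix x
    show "(\<integral>\<^sup>+y. (\<Prod>i\<in>I. F i (x i) (y i)) \<partial>?U) = (\<Prod>i\<in>I. (\<integral>\<^sup>+y. F i (x i) y \<partial>unif))"
      using Fm by (intro unif_prod.product_nn_integral_prod I) measurable
  qed
  also have "\<dots> = (\<Prod>i\<in>I. (\<integral>\<^sup>+x. (\<integral>\<^sup>+y. F i x y \<partial>unif) \<partial>unif))"
    by (rule unif_prod.product_nn_integral_prod[OF I]) (use Fm in measurable)
  also have "\<dots> = (\<Prod>i\<in>I. emeasure (sample_measure w) (A i))"
  proof (rule prod.cong[OF refl])
    fix i assume i: "i \<in> I"
    have "emeasure (sample_measure w) (A i) = (\<integral>\<^sup>+z. F i (fst z) (snd z) \<partial>(unif \<Otimes>\<^sub>M unif))"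
      unfolding sample_measure_def F_def using Am[OF i]
      by (subst emeasure_density) (auto simp: case_prod_beta intro!: nn_integral_cong)
    also have "\<dots> = (\<integral>\<^sup>+x. (\<integral>\<^sup>+y. F i x y \<partial>unif) \<partial>unif)"
      using Fm[OF i] by (subst unif.nn_integral_fst[symmetric]) (auto simp: case_prod_beta)
    finally show "(\<integral>\<^sup>+x. (\<integral>\<^sup>+y. F i x y \<partial>unif) \<partial>unif) = emeasure (sample_measure w) (A i)" ..
  qed
  finally show "emeasure ?P (Pi\<^sub>E I A) = (\<Prod>i\<in>I. emeasure (sample_measure w) (A i))" .
qed

text \<open>With all other coordinates fixed, equality restricts coordinate i to a single point, a
  null set of the uniform law.\<close>

lemma AE_cube_neq:
  assumes I: "finite I" "i \<in> I" "j \<in> I" "i \<noteq> (j::nat)"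
  shows "AE x in cube I. x i \<noteq> x j"
proof -
  define J where "J = I - {i}"
  have J: "finite J" "i \<notin> J" "I = insert i J" "j \<in> J"
    using I by (auto simp: J_def)
  let ?U = "cube (insert i J)"
  have "{x \<in> space ?U. x i = x j} \<in> sets ?U"
    using J by (intro borel_measurable_eq measurable_cube_component) auto
  then have N: "{x \<in> space ?U. \<not> x i \<noteq> x j} \<in> sets ?U"
    by simp
  have "emeasure ?U {x \<in> space ?U. \<not> x i \<noteq> x j} = (\<integral>\<^sup>+x. indicator {x \<in> space ?U. \<not> x i \<noteq> x j} x \<partial>?U)"
    using N by (simp only: nn_integral_indicator)
  also have "\<dots> = (\<integral>\<^sup>+x. (\<integral>\<^sup>+y. indicator {x \<in> space ?U. \<not> x i \<noteq> x j} (x(i := y)) \<partial>unif) \<partial>cube J)"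
    using N by (intro unif_prod.product_nn_integral_insert J) simp
  also have "\<dots> = (\<integral>\<^sup>+x. 0 \<partial>cube J)"
  proof (rule nn_integral_cong)
    fix x
    have "(\<integral>\<^sup>+y. indicator {x \<in> space ?U. \<not> x i \<noteq> x j} (x(i := y)) \<partial>unif) \<le> (\<integral>\<^sup>+y. indicator {x j} y \<partial>unif)"
      using J by (intro nn_integral_mono) (auto simp: indicator_def)
    also have "\<dots> = emeasure unif {x j}"
      by simp
    also have "\<dots> = 0"
      using AE_unif_neq[of "x j"] by (subst (asm) AE_iff_measurable[of "{x j}"]) auto
    finally show "(\<integral>\<^sup>+y. indicator {x \<in> space ?U. \<not> x i \<noteq> x j} (x(i := y)) \<partial>unif) = 0"
      by simp
  qed
  finally have "emeasure ?U {x \<in> space ?U. \<not> x i \<noteq> x j} = 0"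
    by simp
  then show ?thesis
    unfolding J(3) using N by (intro AE_I'[of "{x \<in> space ?U. \<not> x i \<noteq> x j}"]) auto
qed

lemma measurable_point_component:
  assumes "k \<in> I"
  shows "(\<lambda>z. fst (z k)) \<in> borel_measurable (PiM I (\<lambda>_. borel \<Otimes>\<^sub>M borel :: (real \<times> real) measure))"
    and "(\<lambda>z. snd (z k)) \<in> borel_measurable (PiM I (\<lambda>_. borel \<Otimes>\<^sub>M borel :: (real \<times> real) measure))"
  by (rule measurable_compose[OF measurable_component_singleton[OF assms, where M = "\<lambda>_. borel \<Otimes>\<^sub>M borel"]
        measurable_fst],
      rule measurable_compose[OF measurable_component_singleton[OF assms, where M = "\<lambda>_. borel \<Otimes>\<^sub>M borel"]
        measurable_snd])

lemma AE_points_neq: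
  assumes w: "square_density w" and I: "finite (I :: nat set)" and ij: "i \<in> I" "j \<in> I" "i \<noteq> j"
  shows "AE z in PiM I (\<lambda>_. sample_measure w). fst (z i) \<noteq> fst (z j) \<and> snd (z i) \<noteq> snd (z j)"
proof -
  let ?U = "cube I"
  let ?P = "PiM I (\<lambda>_::nat. borel \<Otimes>\<^sub>M borel :: (real \<times> real) measure)"
  have P: "{z \<in> space ?P. fst (z i) \<noteq> fst (z j) \<and> snd (z i) \<noteq> snd (z j)} \<in> sets ?P"
    using ij by (intro sets.sets_Collect_conj sets.sets_Collect_neg borel_measurable_eq measurable_point_component)
  have comp2: "(\<lambda>z. fst z k) \<in> borel_measurable (cube2 I)" "(\<lambda>z. snd z k) \<in> borel_measurable (cube2 I)" if "k \<in> I" for k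
    using measurable_compose[OF measurable_fst measurable_cube_component[OF that]]
      measurable_compose[OF measurable_snd measurable_cube_component[OF that]] by auto
  have "AE z in cube2 I. fst z i \<noteq> fst z j \<and> snd z i \<noteq> snd z j"
  proof (rule pair_sigma_finite.AE_pair_measure[OF pair_sigma_finite.intro])
    show "{z \<in> space (cube2 I). fst z i \<noteq> fst z j \<and> snd z i \<noteq> snd z j} \<in> sets (cube2 I)"
      using ij by (intro sets.sets_Collect_conj sets.sets_Collect_neg borel_measurable_eq comp2)
    show "AE x in ?U. AE y in ?U. fst (x, y) i \<noteq> fst (x, y) j \<and> snd (x, y) i \<noteq> snd (x, y) j"
      using AE_cube_neq[OF I ij]
    proof eventually_elim
      case (elim x)
      note x = this
      show ?case
        using AE_cube_neq[OF I ij] by eventually_elim (use x in simp)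
    qed
  qed (rule prob_space_imp_sigma_finite[OF prob_space_cube])+
  then have "AE z in density (cube2 I) (\<lambda>(x, y). \<Prod>i\<in>I. ennreal (w (x i) (y i))).
      fst z i \<noteq> fst z j \<and> snd z i \<noteq> snd z j"
    by (subst AE_density[OF measurable_prod_density[OF w]]) (rule eventually_mono, assumption, blast)
  then show ?thesis
    unfolding PiM_sample_measure[OF w I]
  proof (subst AE_distr_iff[OF _ P])
    show "(zip_points I) \<in> density (cube2 I) (\<lambda>(x, y). \<Prod>i\<in>I. ennreal (w (x i) (y i))) \<rightarrow>\<^sub>M ?P"
      using measurable_zip by simp
  qed (use ij in \<open>simp add: case_prod_beta\<close>)
qed

lemma AE_points_inj:
  assumes w: "square_density w" and I: "finite (I :: nat set)"
  shows "AE z in PiM I (\<lambda>_. sample_measure w). inj_on (\<lambda>i. fst (z i)) I \<and> inj_on (\<lambda>i. snd (z i)) I"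
proof -
  have "AE z in PiM I (\<lambda>_. sample_measure w). \<forall>i\<in>I. \<forall>j\<in>I. i \<noteq> j \<longrightarrow> fst (z i) \<noteq> fst (z j) \<and> snd (z i) \<noteq> snd (z j)"
  proof (rule AE_finite_allI[OF I], rule AE_finite_allI[OF I])
    fix i j assume "i \<in> I" "j \<in> I"
    then show "AE z in PiM I (\<lambda>_. sample_measure w). i \<noteq> j \<longrightarrow> fst (z i) \<noteq> fst (z j) \<and> snd (z i) \<noteq> snd (z j)"
      using AE_points_neq[OF w I, of i j] by (cases "i = j") simp_all
  qed
  then show ?thesis
  proof eventually_elim
    case (elim z)
    then show ?case unfolding inj_on_def by blast
  qed
qed

section \<open>The probability of a pattern\<close>

lemma sets_pattern_event:
  assumes "\<And>i. i < 4 \<Longrightarrow> (\<lambda>u. fst (Z u i)) \<in> borel_measurable M"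
    and "\<And>i. i < 4 \<Longrightarrow> (\<lambda>u. snd (Z u i)) \<in> borel_measurable M"
  shows "{u \<in> space M. pattern_event \<sigma> (Z u)} \<in> sets M"
proof -
  have ord: "{u \<in> space M. ordered4 (\<lambda>i. fst (Z u i))} \<in> sets M"
    unfolding ordered4_def by (intro sets.sets_Collect_conj borel_measurable_less assms(1); simp)
  have lt: "{u \<in> space M. snd (Z u i) < snd (Z u j) \<longleftrightarrow> \<sigma> ! i < \<sigma> ! j} \<in> sets M" if "i < 4" "j < 4" for i j
  proof -
    have "{u \<in> space M. snd (Z u i) < snd (Z u j)} \<in> sets M"
      by (intro borel_measurable_less assms(2) that)
    then have "{u \<in> space M. (snd (Z u i) < snd (Z u j)) = b} \<in> sets M" for b
      by (cases b) (simp_all only: simp_thms sets.sets_Collect_neg)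
    then show ?thesis .
  qed
  have "{u \<in> space M. \<forall>i\<in>{..<4}. \<forall>j\<in>{..<4}. snd (Z u i) < snd (Z u j) \<longleftrightarrow> \<sigma> ! i < \<sigma> ! j} \<in> sets M"
    by (rule sets.sets_Collect_finite_All, rule sets.sets_Collect_finite_All) (simp_all only: lt lessThan_iff finite_lessThan)
  from sets.sets_Collect_conj[OF this ord] show ?thesis
    unfolding pattern_event_def Ball_def lessThan_iff .
qed

lemma idx_bij:
  assumes "is_permutation \<sigma>" "length \<sigma> = 4"
  shows "bij_betw (idx \<sigma>) {..<4} {..<4}"
    and "\<And>i j. i < 4 \<Longrightarrow> j < 4 \<Longrightarrow> \<sigma> ! i < \<sigma> ! j \<longleftrightarrow> idx \<sigma> i < idx \<sigma> j"
proof -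
  have \<sigma>: "distinct \<sigma>" "set \<sigma> = {1..4}"
    using is_permutation_4[OF assms] by auto
  have nth: "\<sigma> ! i \<ge> 1" "\<sigma> ! i \<le> 4" if "i < 4" for i
    using nth_mem[of i \<sigma>] that assms(2) \<sigma>(2) by auto
  show "\<sigma> ! i < \<sigma> ! j \<longleftrightarrow> idx \<sigma> i < idx \<sigma> j" if "i < 4" "j < 4" for i j
    using nth(1)[OF that(1)] nth(1)[OF that(2)] by (auto simp: idx_def)
  have inj: "inj_on (idx \<sigma>) {..<4}"
  proof (rule inj_onI)
    fix i j assume ij: "i \<in> {..<4}" "j \<in> {..<4}" "idx \<sigma> i = idx \<sigma> j"
    then have "\<sigma> ! i = \<sigma> ! j"
      using nth(1)[of i] nth(1)[of j] unfolding idx_def lessThan_iff by linarith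
    then show "i = j"
      using ij nth_eq_iff_index_eq[OF \<sigma>(1), of i j] assms(2) by simp
  qed
  moreover have "idx \<sigma> ` {..<4} \<subseteq> {..<4}"
  proof
    fix k assume "k \<in> idx \<sigma> ` {..<4}"
    then obtain i where "i < 4" "k = \<sigma> ! i - 1" by (auto simp: idx_def)
    then show "k \<in> {..<4}" using nth[of i] by auto
  qed
  ultimately show "bij_betw (idx \<sigma>) {..<4} {..<4}"
    by (simp add: bij_betw_def endo_inj_surj)
qed

lemma ordered4_iff: "ordered4 y \<longleftrightarrow> (\<forall>a<4. \<forall>b<4. y a < y b \<longleftrightarrow> a < b)"
proof
  assume y: "ordered4 y"
  show "\<forall>a<4. \<forall>b<4. y a < y b \<longleftrightarrow> a < b"
  proof (intro allI impI)
    fix a b :: nat assume "a < 4" "b < 4"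
    then show "y a < y b \<longleftrightarrow> a < b"
      using y unfolding ordered4_def by (auto dest!: less_4_cases)
  qed
qed (simp add: ordered4_def)

text \<open>The heights of points in the pattern become increasing after relabelling them along
  \<open>idx \<sigma>\<close>. The event then says that both coordinate vectors are increasing, and
  the weight becomes that of \<open>pattern_wt\<close>. Passing from conditioning back to
  probability costs 1/24 for each vector, and 576 is the square of 24.\<close>

lemma prob_pattern_event:
  assumes w: "square_density w" and \<sigma>: "is_permutation \<sigma>" "length \<sigma> = 4"
  shows "measure (PiM {..<4} (\<lambda>_. sample_measure w)) {z \<in> space (PiM {..<4} (\<lambda>_. sample_measure w)). pattern_event \<sigma> z}
    = pattern_wt (idx \<sigma>) w / 576"
proof -
  let ?I = "{..<4::nat}" and ?s = "idx \<sigma>"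
  let ?U = "cube ?I"
  let ?P = "PiM ?I (\<lambda>_. borel \<Otimes>\<^sub>M borel :: (real \<times> real) measure)"
  let ?M = "PiM ?I (\<lambda>_. sample_measure w)"
  note meas = square_densityD(1)[OF w]
  note sf = prob_space_imp_sigma_finite[OF prob_space_cube]
  have s_lt: "?s i < 4" if "i < 4" for i
    using idx_bij(1)[OF \<sigma>] that by (auto simp: bij_betw_def)
  have sets_M: "sets ?M = sets ?P" by (simp cong: sets_PiM_cong)
  then have space_M: "space ?M = space ?P" by (rule sets_eq_imp_space_eq)
  define E where "E = {z \<in> space ?P. pattern_event \<sigma> z}"
  have E: "E \<in> sets ?P"
    unfolding E_def by (rule sets_pattern_event) (simp_all add: measurable_point_component)
  define ev where "ev x y \<longleftrightarrow> ordered4 x \<and> (\<forall>i<4. \<forall>j<4. y i < y j \<longleftrightarrow> \<sigma> ! i < \<sigma> ! j)" for x y :: "nat \<Rightarrow> real"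
  have wcomp: "(\<lambda>y. w a (y i)) \<in> borel_measurable ?U" if "i < 4" for a i
  proof -
    have "(\<lambda>y. (a, y i)) \<in> ?U \<rightarrow>\<^sub>M borel \<Otimes>\<^sub>M borel"
      by (intro measurable_Pair measurable_const measurable_cube_component) (use that in simp_all)
    from measurable_compose[OF this meas] show ?thesis by simp
  qed
  have wcomp2: "(\<lambda>z. w (fst z i) (snd z j)) \<in> borel_measurable (cube2 ?I)" if "i < 4" "j < 4" for i j
    using that by (intro measurable_at_points[OF meas]) auto
  define g where "g x y = (\<Prod>i<4. ennreal (w (x i) (y i)))" for x y :: "nat \<Rightarrow> real"
  let ?V = "{z \<in> space (cube2 ?I). ev (fst z) (snd z)}"
  have ev_sets: "?V \<in> sets (cube2 ?I)"
  proof -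
    have "{z \<in> space (cube2 ?I). pattern_event \<sigma> (\<lambda>i. (fst z i, snd z i))} \<in> sets (cube2 ?I)"
    proof (rule sets_pattern_event)
      fix i :: nat assume "i < 4"
      then have i: "i \<in> ?I" by simp
      show "(\<lambda>z. fst (fst z i, snd z i)) \<in> borel_measurable (cube2 ?I)"
        unfolding fst_conv by (rule measurable_compose[OF measurable_fst measurable_cube_component[OF i]])
      show "(\<lambda>z. snd (fst z i, snd z i)) \<in> borel_measurable (cube2 ?I)"
        unfolding snd_conv by (rule measurable_compose[OF measurable_snd measurable_cube_component[OF i]])
    qed
    then show ?thesis
      unfolding pattern_event_def ev_def fst_conv snd_conv .
  qed
  have zip_iff: "pattern_event \<sigma> (\<lambda>i\<in>?I. (x i, y i)) \<longleftrightarrow> ev x y" for x y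
    by (simp add: pattern_event_def ev_def ordered4_def)
  have gm: "(\<lambda>z. g (fst z) (snd z)) \<in> borel_measurable (cube2 ?I)"
    unfolding g_def using wcomp2 by (intro borel_measurable_prod_ennreal) auto
  have "emeasure ?M E = (\<integral>\<^sup>+z. g (fst z) (snd z) * indicator ?V z \<partial>(cube2 ?I))"
  proof -
    have vimage: "(zip_points ?I) -` E \<inter> space (cube2 ?I) = ?V"
    proof (rule equalityI; rule subsetI)
      fix z assume "z \<in> (zip_points ?I) -` E \<inter> space (cube2 ?I)"
      then show "z \<in> ?V"
        by (simp add: E_def case_prod_beta zip_iff)
    next
      fix z assume z: "z \<in> ?V"
      then have "(zip_points ?I) z \<in> space ?P"
        by (intro measurable_space[OF measurable_zip]) simp
      then show "z \<in> (zip_points ?I) -` E \<inter> space (cube2 ?I)"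
        using z by (simp add: E_def case_prod_beta zip_iff)
    qed
    have "emeasure ?M E = emeasure (density (cube2 ?I) (\<lambda>(x, y). \<Prod>i\<in>?I. ennreal (w (x i) (y i))))
        ?V"
      unfolding PiM_sample_measure[OF w finite_lessThan] using E measurable_zip[of ?I]
      by (subst emeasure_distr) (simp_all add: vimage)
    also have "\<dots> = (\<integral>\<^sup>+z. g (fst z) (snd z) * indicator ?V z \<partial>(cube2 ?I))"
      using measurable_prod_density[OF w, of ?I] ev_sets by (subst emeasure_density) (simp_all add: g_def case_prod_beta)
    finally show ?thesis .
  qed
  also have "\<dots> = (\<integral>\<^sup>+z. g (fst z) (snd z) * of_bool (ev (fst z) (snd z)) \<partial>(cube2 ?I))"
    by (intro nn_integral_cong) (auto simp: indicator_def)
  also have "\<dots> = (\<integral>\<^sup>+x. (\<integral>\<^sup>+y. g x y * of_bool (ev x y) \<partial>?U) \<partial>?U)"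
  proof -
    have "(\<lambda>z. g (fst z) (snd z) * of_bool (ev (fst z) (snd z))) \<in> borel_measurable (cube2 ?I)"
    proof (subst measurable_cong)
      show "g (fst z) (snd z) * of_bool (ev (fst z) (snd z)) = g (fst z) (snd z) * indicator ?V z"
        if "z \<in> space (cube2 ?I)" for z using that by (auto simp: indicator_def)
      show "(\<lambda>z. g (fst z) (snd z) * indicator ?V z) \<in> borel_measurable (cube2 ?I)"
        using gm ev_sets by (intro borel_measurable_times_ennreal borel_measurable_indicator)
    qed
    from sigma_finite_measure.nn_integral_fst[OF sf this] show ?thesis by simp
  qed
  also have "\<dots> = (\<integral>\<^sup>+x. (\<integral>\<^sup>+y. (\<Prod>i<4. ennreal (w (x i) (y (?s i)))) * of_bool (ordered4 x \<and> ordered4 y) \<partial>?U) \<partial>?U)"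
  proof (rule nn_integral_cong)
    fix x :: "nat \<Rightarrow> real"
    \<comment> \<open>The uniform cube is invariant under permuting coordinates. Substituting the
      relabelled vector for y turns the order prescribed by \<sigma> into the natural order and
      \<open>y i\<close> into \<open>y (idx \<sigma> i)\<close>.\<close>
    let ?r = "\<lambda>y. \<lambda>i\<in>?I. y (?s i)"
    have r: "distr ?U ?U ?r = ?U"
      using idx_bij(1)[OF \<sigma>] s_lt by (intro distr_PiM_reindex unif.prob_space_axioms) (auto simp: bij_betw_def)
    have rm: "?r \<in> ?U \<rightarrow>\<^sub>M ?U"
      using s_lt by (intro measurable_restrict measurable_component_singleton) auto
    have Gm: "(\<lambda>y. g x y * of_bool (ev x y)) \<in> borel_measurable ?U"
    proof (subst measurable_cong)
      show "g x y * of_bool (ev x y) = g x y * indicator {y \<in> space ?U. ev x y} y"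
        if "y \<in> space ?U" for y using that by (auto simp: indicator_def)
      have "{y \<in> space ?U. ev x y} \<in> sets ?U"
      proof -
        have "{y \<in> space ?U. pattern_event \<sigma> (\<lambda>i. (x i, y i))} \<in> sets ?U"
        proof (rule sets_pattern_event)
          fix i :: nat assume "i < 4"
          then have i: "i \<in> ?I" by simp
          show "(\<lambda>y. fst (x i, y i)) \<in> borel_measurable ?U"
            unfolding fst_conv by simp
          show "(\<lambda>y. snd (x i, y i)) \<in> borel_measurable ?U"
            unfolding snd_conv by (rule measurable_cube_component[OF i])
        qed
        then show ?thesis
          unfolding pattern_event_def ev_def fst_conv snd_conv .
      qed
      then show "(\<lambda>y. g x y * indicator {y \<in> space ?U. ev x y} y) \<in> borel_measurable ?U"
        unfolding g_def using wcomp
        by (intro borel_measurable_times_ennreal borel_measurable_indicator borel_measurable_prod_ennreal) auto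
    qed
    have ev_r: "ev x (?r y) \<longleftrightarrow> ordered4 x \<and> ordered4 y" for y
    proof -
      have "(\<forall>i<4. \<forall>j<4. y (?s i) < y (?s j) \<longleftrightarrow> ?s i < ?s j) \<longleftrightarrow> (\<forall>a<4. \<forall>b<4. y a < y b \<longleftrightarrow> a < b)"
      proof -
        have "(\<forall>a\<in>?s ` ?I. \<forall>b\<in>?s ` ?I. y a < y b \<longleftrightarrow> a < b) \<longleftrightarrow> (\<forall>i\<in>?I. \<forall>j\<in>?I. y (?s i) < y (?s j) \<longleftrightarrow> ?s i < ?s j)"
          by blast
        then show ?thesis
          unfolding bij_betw_imp_surj_on[OF idx_bij(1)[OF \<sigma>]] Ball_def lessThan_iff by blast
      qed
      then show ?thesis
        using idx_bij(2)[OF \<sigma>] by (simp add: ev_def ordered4_iff[of y])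
    qed
    have "(\<integral>\<^sup>+y. g x y * of_bool (ev x y) \<partial>?U) = (\<integral>\<^sup>+y. g x y * of_bool (ev x y) \<partial>distr ?U ?U ?r)"
      unfolding r ..
    also have "\<dots> = (\<integral>\<^sup>+y. g x (?r y) * of_bool (ev x (?r y)) \<partial>?U)"
      by (rule nn_integral_distr[OF rm]) (simp add: Gm)
    also have "\<dots> = (\<integral>\<^sup>+y. (\<Prod>i<4. ennreal (w (x i) (y (?s i)))) * of_bool (ordered4 x \<and> ordered4 y) \<partial>?U)"
      unfolding ev_r by (intro nn_integral_cong) (simp add: g_def)
    finally show "(\<integral>\<^sup>+y. g x y * of_bool (ev x y) \<partial>?U)
        = (\<integral>\<^sup>+y. (\<Prod>i<4. ennreal (w (x i) (y (?s i)))) * of_bool (ordered4 x \<and> ordered4 y) \<partial>?U)" .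
  qed
  finally have emE: "emeasure ?M E = (\<integral>\<^sup>+x. (\<integral>\<^sup>+y. (\<Prod>i<4. ennreal (w (x i) (y (?s i)))) * of_bool (ordered4 x \<and> ordered4 y) \<partial>?U) \<partial>?U)" .

  define G where "G x y = (\<Prod>i<4. ennreal (w (x i) (y (?s i))))" for x y :: "nat \<Rightarrow> real"
  have GmU: "G x \<in> borel_measurable ?U" for x
    unfolding G_def using wcomp s_lt by (intro borel_measurable_prod_ennreal) auto
  have Gm: "(\<lambda>z. G (fst z) (snd z)) \<in> borel_measurable (cube2 ?I)"
    unfolding G_def using wcomp2 s_lt by (intro borel_measurable_prod_ennreal) auto
  have sets_O: "sets order_stats = sets ?U"
    by (simp add: order_stats_eq_density)
  have Gm': "(\<lambda>z. G (fst z) (snd z)) \<in> borel_measurable order_stats2"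
    using Gm measurable_cong_sets[OF sets_pair_measure_cong[OF sets_O sets_O] refl] by blast
  obtain C where C: "\<And>x y. 0 \<le> x \<Longrightarrow> x \<le> 1 \<Longrightarrow> 0 \<le> y \<Longrightarrow> y \<le> 1 \<Longrightarrow> w x y \<le> C"
    using square_densityD(4)[OF w] by blast
  have int: "integrable order_stats2 (\<lambda>z. \<Prod>i<4. w (fst z i) (snd z (?s i)))"
    using s_lt C square_densityD(2)[OF w]
    by (intro integrable_order_stats2_prod[where C = C] meas) auto
  have nonneg: "AE z in order_stats2. 0 \<le> (\<Prod>i<4. w (fst z i) (snd z (?s i)))"
    using AE_order_stats2
  proof eventually_elim
    case (elim z)
    then show ?case
      using s_lt by (intro prod_nonneg square_densityD(2)[OF w]) auto
  qed
  have ord_m: "(\<lambda>x. ennreal (if ordered4 x then 24 else 0)) \<in> borel_measurable ?U"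
    by (rule measurable_compose[OF pred_ordered4]) simp
  have const: "ennreal (if P then 24 else 0) * (ennreal (if Q then 24 else 0) * r) = 576 * (r * of_bool (P \<and> Q))" for P Q r
  proof -
    have "(24 :: ennreal) * (24 * r) = 576 * r"
      by (simp add: mult.assoc[symmetric])
    then show ?thesis
      by (cases P; cases Q) simp_all
  qed
  have "ennreal (pattern_wt ?s w) = (\<integral>\<^sup>+z. ennreal (\<Prod>i<4. w (fst z i) (snd z (?s i))) \<partial>order_stats2)"
    unfolding pattern_wt_def by (rule nn_integral_eq_integral[symmetric, OF int nonneg])
  also have "\<dots> = (\<integral>\<^sup>+z. G (fst z) (snd z) \<partial>order_stats2)"
  proof (rule nn_integral_cong_AE)
    show "AE z in order_stats2. ennreal (\<Prod>i<4. w (fst z i) (snd z (?s i))) = G (fst z) (snd z)"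
      using AE_order_stats2
    proof eventually_elim
      case (elim z)
      then show ?case
        unfolding G_def using s_lt by (intro prod_ennreal[symmetric] square_densityD(2)[OF w]) auto
    qed
  qed
  also have "\<dots> = (\<integral>\<^sup>+x. (\<integral>\<^sup>+y. G x y \<partial>order_stats) \<partial>order_stats)"
    using order_stats.nn_integral_fst[OF Gm'] by simp
  also have "\<dots> = (\<integral>\<^sup>+x. ennreal (if ordered4 x then 24 else 0) * (\<integral>\<^sup>+y. ennreal (if ordered4 y then 24 else 0) * G x y \<partial>?U) \<partial>?U)"
  proof -
    have inner: "(\<integral>\<^sup>+y. G x y \<partial>order_stats) = (\<integral>\<^sup>+y. ennreal (if ordered4 y then 24 else 0) * G x y \<partial>?U)" for x
      unfolding order_stats_eq_density using ord_m GmU by (rule nn_integral_density)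
    have "(\<lambda>x. \<integral>\<^sup>+y. G x y \<partial>order_stats) \<in> borel_measurable order_stats"
      using order_stats.borel_measurable_nn_integral_fst[OF Gm'] by simp
    then have m: "(\<lambda>x. \<integral>\<^sup>+y. G x y \<partial>order_stats) \<in> borel_measurable ?U"
      using measurable_cong_sets[OF sets_O refl] by blast
    have "(\<integral>\<^sup>+x. (\<integral>\<^sup>+y. G x y \<partial>order_stats) \<partial>order_stats)
        = (\<integral>\<^sup>+x. (\<integral>\<^sup>+y. G x y \<partial>order_stats) \<partial>density ?U (\<lambda>x. ennreal (if ordered4 x then 24 else 0)))"
      by (simp only: order_stats_eq_density[symmetric])
    also have "\<dots> = (\<integral>\<^sup>+x. ennreal (if ordered4 x then 24 else 0) * (\<integral>\<^sup>+y. G x y \<partial>order_stats) \<partial>?U)"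
      using ord_m m by (rule nn_integral_density)
    finally show ?thesis
      unfolding inner .
  qed
  also have "\<dots> = (\<integral>\<^sup>+x. (\<integral>\<^sup>+y. 576 * (G x y * of_bool (ordered4 x \<and> ordered4 y)) \<partial>?U) \<partial>?U)"
  proof (rule nn_integral_cong)
    fix x
    have "ennreal (if ordered4 x then 24 else 0) * (\<integral>\<^sup>+y. ennreal (if ordered4 y then 24 else 0) * G x y \<partial>?U)
        = (\<integral>\<^sup>+y. ennreal (if ordered4 x then 24 else 0) * (ennreal (if ordered4 y then 24 else 0) * G x y) \<partial>?U)"
      using ord_m GmU by (intro nn_integral_cmult[symmetric] borel_measurable_times_ennreal)
    also have "\<dots> = (\<integral>\<^sup>+y. 576 * (G x y * of_bool (ordered4 x \<and> ordered4 y)) \<partial>?U)"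
      by (intro nn_integral_cong const)
    finally show "ennreal (if ordered4 x then 24 else 0) * (\<integral>\<^sup>+y. ennreal (if ordered4 y then 24 else 0) * G x y \<partial>?U)
        = (\<integral>\<^sup>+y. 576 * (G x y * of_bool (ordered4 x \<and> ordered4 y)) \<partial>?U)" .
  qed
  also have "\<dots> = 576 * emeasure ?M E"
  proof -
    let ?h = "\<lambda>z. G (fst z) (snd z) * of_bool (ordered4 (fst z) \<and> ordered4 (snd z))"
    have of: "(\<lambda>x. of_bool (ordered4 x) :: ennreal) \<in> borel_measurable ?U"
      by (rule measurable_compose[OF pred_ordered4]) simp
    have hm: "?h \<in> borel_measurable (cube2 ?I)"
      unfolding of_bool_conj
      using measurable_compose[OF measurable_fst of] measurable_compose[OF measurable_snd of]
      by (intro borel_measurable_times_ennreal Gm)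
    have hmx: "(\<lambda>y. G x y * of_bool (ordered4 x \<and> ordered4 y)) \<in> borel_measurable ?U" for x
      unfolding of_bool_conj using of GmU by (intro borel_measurable_times_ennreal borel_measurable_const)
    have "(\<integral>\<^sup>+x. (\<integral>\<^sup>+y. 576 * (G x y * of_bool (ordered4 x \<and> ordered4 y)) \<partial>?U) \<partial>?U)
        = (\<integral>\<^sup>+x. 576 * (\<integral>\<^sup>+y. G x y * of_bool (ordered4 x \<and> ordered4 y) \<partial>?U) \<partial>?U)"
      using hmx by (simp only: nn_integral_cmult)
    also have "\<dots> = 576 * (\<integral>\<^sup>+x. (\<integral>\<^sup>+y. G x y * of_bool (ordered4 x \<and> ordered4 y) \<partial>?U) \<partial>?U)"
      using sigma_finite_measure.borel_measurable_nn_integral_fst[OF sf hm] by (intro nn_integral_cmult) simp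
    finally show ?thesis unfolding emE G_def .
  qed
  finally have eq: "ennreal (pattern_wt ?s w) = 576 * emeasure ?M E" .
  interpret pm: prob_space "sample_measure w"
    by (rule prob_space_sample_measure[OF w])
  interpret M: prob_space ?M
    by (intro prob_space_PiM pm.prob_space_axioms)
  have "0 \<le> pattern_wt ?s w"
    unfolding pattern_wt_def by (rule integral_nonneg_AE[OF nonneg])
  moreover have "ennreal (pattern_wt ?s w) = ennreal (576 * measure ?M E)"
    unfolding eq M.emeasure_eq_measure by (simp add: ennreal_mult')
  ultimately have "pattern_wt ?s w = 576 * measure ?M E"
    by (subst (asm) ennreal_inj) auto
  then show ?thesis
    unfolding E_def space_M by simp
qed

section \<open>The second moment of the pattern count\<close>

lemma pattern_event_restrict: "pattern_event \<sigma> (\<lambda>k\<in>{..<4}. z k) \<longleftrightarrow> pattern_event \<sigma> z"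
  by (simp add: pattern_event_def ordered4_def)

abbreviation samples :: "(real \<Rightarrow> real \<Rightarrow> real) \<Rightarrow> nat set \<Rightarrow> (nat \<Rightarrow> real \<times> real) measure" where
  "samples w K \<equiv> PiM K (\<lambda>_. sample_measure w)"

lemma sets_pattern_event_points:
  assumes "\<And>k. k < 4 \<Longrightarrow> e k \<in> K"
  shows "{z \<in> space (samples w K). pattern_event \<sigma> (\<lambda>k. z (e k))} \<in> sets (samples w K)"
proof (rule sets_pattern_event)
  fix k :: nat assume k: "k < 4"
  have "(\<lambda>z. z (e k)) \<in> samples w K \<rightarrow>\<^sub>M sample_measure w"
    using assms[OF k] by (rule measurable_component_singleton)
  then have c: "(\<lambda>z. z (e k)) \<in> samples w K \<rightarrow>\<^sub>M borel \<Otimes>\<^sub>M borel"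
    using measurable_cong_sets[OF refl sets_sample_measure] by blast
  show "(\<lambda>z. fst (z (e k))) \<in> borel_measurable (samples w K)"
    by (rule measurable_compose[OF c measurable_fst])
  show "(\<lambda>z. snd (z (e k))) \<in> borel_measurable (samples w K)"
    by (rule measurable_compose[OF c measurable_snd])
qed

lemma borel_measurable_pattern_event:
  assumes "\<And>k. k < 4 \<Longrightarrow> e k \<in> K"
  shows "(\<lambda>z. of_bool (pattern_event \<sigma> (\<lambda>k. z (e k))) :: real) \<in> borel_measurable (samples w K)"
proof (subst measurable_cong)
  show "of_bool (pattern_event \<sigma> (\<lambda>k. z (e k)))
      = (indicator {z \<in> space (samples w K). pattern_event \<sigma> (\<lambda>k. z (e k))} z :: real)"
    if "z \<in> space (samples w K)" for z
    using that by (simp add: indicator_def)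
qed (intro borel_measurable_indicator sets_pattern_event_points assms)

definition event_prob :: "(real \<Rightarrow> real \<Rightarrow> real) \<Rightarrow> nat list \<Rightarrow> real" where
  "event_prob w \<sigma> = measure (samples w {..<4})
     {z \<in> space (samples w {..<4}). pattern_event \<sigma> z}"

lemma prob_space_points:
  assumes "square_density w"
  shows "prob_space (samples w K)"
  by (intro prob_space_PiM prob_space_sample_measure assms)

lemma event_prob_bounds:
  assumes "square_density w"
  shows "0 \<le> event_prob w \<sigma>" "event_prob w \<sigma> \<le> 1"
  unfolding event_prob_def using prob_space.prob_le_1[OF prob_space_points[OF assms]] by simp_all

text \<open>For an injective index tuple, the four selected points are again independent with
  density w, so the choice of the indices does not matter.\<close>

lemma integral_pattern_event:
  fixes K :: "nat set"
  assumes w: "square_density w" and e: "inj_on e {..<4}" "\<And>k. k < 4 \<Longrightarrow> e k \<in> K"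
  shows "(\<integral>z. of_bool (pattern_event \<sigma> (\<lambda>k. z (e k))) \<partial>samples w K) = event_prob w \<sigma>"
proof -
  let ?M = "\<lambda>K. samples w K"
  let ?T = "\<lambda>z. \<lambda>k\<in>{..<4}. z (e k)"
  let ?E = "{z \<in> space (?M {..<4}). pattern_event \<sigma> z}"
  have T: "?T \<in> ?M K \<rightarrow>\<^sub>M ?M {..<4}"
    using e(2) by (intro measurable_restrict measurable_component_singleton) auto
  have E: "?E \<in> sets (?M {..<4})"
    by (rule sets_pattern_event_points[of "\<lambda>k. k"]) simp
  have d: "distr (?M K) (?M {..<4}) ?T = ?M {..<4}"
    using e by (intro distr_PiM_reindex prob_space_sample_measure w) auto
  have "event_prob w \<sigma> = measure (distr (?M K) (?M {..<4}) ?T) ?E"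
    unfolding d event_prob_def ..
  also have "\<dots> = measure (?M K) (?T -` ?E \<inter> space (?M K))"
    by (rule measure_distr[OF T E])
  also have "?T -` ?E \<inter> space (?M K) = {z \<in> space (?M K). pattern_event \<sigma> (\<lambda>k. z (e k))}"
    using measurable_space[OF T] by (auto simp: pattern_event_restrict)
  also have "measure (?M K) \<dots> = (\<integral>z. indicator {z \<in> space (?M K). pattern_event \<sigma> (\<lambda>k. z (e k))} z \<partial>?M K)"
    by simp (rule arg_cong[where f = "measure (?M K)"], blast)
  also have "\<dots> = (\<integral>z. of_bool (pattern_event \<sigma> (\<lambda>k. z (e k))) \<partial>?M K)"
    by (intro Bochner_Integration.integral_cong) (auto simp: indicator_def)
  finally show ?thesis ..
qed

lemma integrable_points_bounded:
  fixes f :: "_ \<Rightarrow> real"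
  assumes "square_density w" "f \<in> borel_measurable (samples w K)" "\<And>z. \<bar>f z\<bar> \<le> B"
  shows "integrable (samples w K) f"
  using assms by (intro finite_measure.integrable_const_bound[where B = B]
      prob_space.finite_measure[OF prob_space_points]) auto

text \<open>Disjoint index sets allow the product measure to be split into two blocks, each carrying
  one of the events.\<close>

lemma integral_pattern_event_mult:
  fixes K :: "nat set"
  assumes w: "square_density w" and K: "finite K"
    and e: "inj_on e {..<4}" "\<And>k. k < 4 \<Longrightarrow> e k \<in> K"
    and e': "inj_on e' {..<4}" "\<And>k. k < 4 \<Longrightarrow> e' k \<in> K"
    and disj: "e ` {..<4} \<inter> e' ` {..<4} = {}"
  shows "(\<integral>z. of_bool (pattern_event \<sigma> (\<lambda>k. z (e k))) * of_bool (pattern_event \<sigma> (\<lambda>k. z (e' k)))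
      \<partial>samples w K) = event_prob w \<sigma> * event_prob w \<sigma>"
proof -
  let ?M = "\<lambda>K. samples w K"
  let ?a = "\<lambda>e z. of_bool (pattern_event \<sigma> (\<lambda>k. z (e k))) :: real"
  define I J where "I = e ` {..<4}" and "J = K - I"
  have IJ: "I \<inter> J = {}" "finite I" "finite J" "K = I \<union> J"
    using K e(2) by (auto simp: I_def J_def)
  have eI: "e k \<in> I" and e'J: "e' k \<in> J" if "k < 4" for k
    using that e'(2)[OF that] disj by (auto simp: I_def J_def)
  interpret pm: prob_space "sample_measure w"
    by (rule prob_space_sample_measure[OF w])
  interpret psf: product_sigma_finite "\<lambda>_::nat. sample_measure w"
    by standard
  have int: "integrable (?M (I \<union> J)) (\<lambda>z. ?a e z * ?a e' z)"
    using eI e'J by (intro integrable_points_bounded[OF w, where B = 1] borel_measurable_times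
        borel_measurable_pattern_event) auto
  have m: "?a e (merge I J (x, y)) = ?a e x" "?a e' (merge I J (x, y)) = ?a e' y" for x y
  proof -
    have "merge I J (x, y) (e k) = x (e k)" "merge I J (x, y) (e' k) = y (e' k)" if "k < 4" for k
      using eI[OF that] e'J[OF that] IJ(1) by (auto simp: merge_def)
    then show "?a e (merge I J (x, y)) = ?a e x" "?a e' (merge I J (x, y)) = ?a e' y"
      by (simp_all add: pattern_event_def ordered4_def)
  qed
  have "(\<integral>z. ?a e z * ?a e' z \<partial>?M K) = (\<integral>x. (\<integral>y. ?a e x * ?a e' y \<partial>?M J) \<partial>?M I)"
    unfolding IJ(4) psf.product_integral_fold[OF IJ(1-3) int] m ..
  also have "\<dots> = (\<integral>x. ?a e x \<partial>?M I) * (\<integral>y. ?a e' y \<partial>?M J)"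
    by (simp only: integral_mult_right_zero integral_mult_left_zero)
  also have "\<dots> = event_prob w \<sigma> * event_prob w \<sigma>"
    using integral_pattern_event[OF w e(1) eI] integral_pattern_event[OF w e'(1) e'J] by simp
  finally show ?thesis .
qed

lemma card_PiE_fixed:
  assumes "A \<subseteq> {..<4::nat}" "v < n"
  shows "card {e \<in> {..<4} \<rightarrow>\<^sub>E {..<n}. \<forall>k\<in>A. e k = v} = n ^ (4 - card A)"
proof -
  have "{e \<in> {..<4} \<rightarrow>\<^sub>E {..<n}. \<forall>k\<in>A. e k = v} = Pi\<^sub>E {..<4} (\<lambda>k. if k \<in> A then {v} else {..<n})"
  proof (intro equalityI subsetI)
    fix e assume "e \<in> {e \<in> {..<4} \<rightarrow>\<^sub>E {..<n}. \<forall>k\<in>A. e k = v}"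
    then show "e \<in> Pi\<^sub>E {..<4} (\<lambda>k. if k \<in> A then {v} else {..<n})"
      by (simp add: PiE_iff)
  next
    fix e assume e: "e \<in> Pi\<^sub>E {..<4} (\<lambda>k. if k \<in> A then {v} else {..<n})"
    have "e k = v" if "k \<in> A" for k
      using PiE_mem[OF e, of k] that assms(1) by auto
    moreover have "e k < n" if "k < 4" for k
      using PiE_mem[OF e, of k] that assms(2) by (cases "k \<in> A") auto
    ultimately show "e \<in> {e \<in> {..<4} \<rightarrow>\<^sub>E {..<n}. \<forall>k\<in>A. e k = v}"
      using e by (simp add: PiE_iff)
  qed
  then have "card {e \<in> {..<4} \<rightarrow>\<^sub>E {..<n}. \<forall>k\<in>A. e k = v} = (\<Prod>k<4. card (if k \<in> A then {v} else {..<n}))"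
    by (simp only: card_PiE[OF finite_lessThan])
  also have "\<dots> = (\<Prod>k\<in>{..<4} - A. n)"
    by (intro prod.mono_neutral_cong_right) auto
  also have "\<dots> = n ^ (4 - card A)"
    using assms(1) finite_subset[OF assms(1)] by (simp add: card_Diff_subset)
  finally show ?thesis .
qed

lemma sum_PiE_fixed:
  fixes j :: nat
  assumes "j < 4" "v < n"
  shows "(\<Sum>e\<in>{..<4} \<rightarrow>\<^sub>E {..<n}. of_bool (v = e j)) = (real n ^ 3)"
proof -
  have "(\<Sum>e\<in>{..<4} \<rightarrow>\<^sub>E {..<n}. of_bool (v = e j)) = real (card {e \<in> {..<4} \<rightarrow>\<^sub>E {..<n}. \<forall>k\<in>{j}. e k = v})"
    by (subst sum_of_bool_eq) (auto intro!: arg_cong[where f = card] simp: finite_PiE)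
  then show ?thesis
    using card_PiE_fixed[of "{j}" v n] assms by simp
qed

lemma sum_PiE_collision:
  fixes i j :: nat
  assumes "i < 4" "j < 4" "i \<noteq> j"
  shows "(\<Sum>e\<in>{..<4} \<rightarrow>\<^sub>E {..<n}. of_bool (e i = e j)) = (real n ^ 3)"
proof -
  have "(\<Sum>e\<in>{..<4} \<rightarrow>\<^sub>E {..<n}. of_bool (e i = e j)) = (\<Sum>e\<in>{..<4} \<rightarrow>\<^sub>E {..<n}. \<Sum>v<n. of_bool (\<forall>k\<in>{i, j}. e k = v) :: real)"
  proof (rule sum.cong[OF refl])
    fix e assume e: "e \<in> {..<4::nat} \<rightarrow>\<^sub>E {..<n}"
    have "(\<Sum>v<n. of_bool (\<forall>k\<in>{i, j}. e k = v) :: real) = (\<Sum>v<n. if v = e i then of_bool (e i = e j) else 0)"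
      by (intro sum.cong) auto
    also have "\<dots> = of_bool (e i = e j)"
      using PiE_mem[OF e, of i] assms by (subst sum.delta) auto
    finally show "of_bool (e i = e j) = (\<Sum>v<n. of_bool (\<forall>k\<in>{i, j}. e k = v) :: real)" ..
  qed
  also have "\<dots> = (\<Sum>v<n. \<Sum>e\<in>{..<4} \<rightarrow>\<^sub>E {..<n}. of_bool (\<forall>k\<in>{i, j}. e k = v))"
    by (rule sum.swap)
  also have "\<dots> = (\<Sum>v<n. real n ^ 2)"
  proof (rule sum.cong[OF refl])
    fix v assume "v \<in> {..<n}"
    then have "card {e \<in> {..<4} \<rightarrow>\<^sub>E {..<n}. \<forall>k\<in>{i, j}. e k = v} = n ^ 2"
      using card_PiE_fixed[of "{i, j}" v n] assms by simp
    moreover have "(\<Sum>e\<in>{..<4} \<rightarrow>\<^sub>E {..<n}. of_bool (\<forall>k\<in>{i, j}. e k = v))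
        = real (card {e \<in> {..<4} \<rightarrow>\<^sub>E {..<n}. \<forall>k\<in>{i, j}. e k = v})"
      by (subst sum_of_bool_eq) (auto intro!: arg_cong[where f = card] simp: finite_PiE)
    ultimately show "(\<Sum>e\<in>{..<4} \<rightarrow>\<^sub>E {..<n}. of_bool (\<forall>k\<in>{i, j}. e k = v)) = real n ^ 2"
      by simp
  qed
  also have "\<dots> = real n ^ 3"
    by (simp add: power3_eq_cube power2_eq_square)
  finally show ?thesis .
qed

text \<open>Index tuples without a common index give independent events; all but \<open>48 n\<^sup>7\<close> of the \<open>n\<^sup>8\<close> pairs of
  tuples are of this kind.\<close>

lemma second_moment_pattern_count:
  fixes \<sigma> :: "nat list" and n :: nat
  assumes w: "square_density w"
  defines "p \<equiv> event_prob w \<sigma>"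
  defines "f \<equiv> \<lambda>e z. of_bool (pattern_event \<sigma> (\<lambda>k. z (e k))) - p"
  shows "integrable (samples w {..<n}) (\<lambda>z. (\<Sum>e\<in>{..<4} \<rightarrow>\<^sub>E {..<n}. f e z)\<^sup>2)"
    and "(\<integral>z. (\<Sum>e\<in>{..<4} \<rightarrow>\<^sub>E {..<n}. f e z)\<^sup>2 \<partial>samples w {..<n}) \<le> 48 * real n ^ 7"
proof -
  let ?M = "samples w {..<n}"
  let ?S = "{..<4::nat} \<rightarrow>\<^sub>E {..<n}"
  interpret M: prob_space ?M by (rule prob_space_points[OF w])
  have p: "0 \<le> p" "p \<le> 1"
    using event_prob_bounds[OF w] by (auto simp: p_def)
  have mem: "e k \<in> {..<n}" if "e \<in> ?S" "k < 4" for e k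
    using PiE_mem[OF that(1), of k] that(2) by simp
  have fin: "finite ?S" by (simp add: finite_PiE)
  define a where "a e z = (of_bool (pattern_event \<sigma> (\<lambda>k. z (e k))) :: real)" for e and z :: "nat \<Rightarrow> real \<times> real"
  have f: "f e z = a e z - p" for e z
    by (simp add: f_def a_def)
  have a01: "0 \<le> a e z" "a e z \<le> 1" for e z
    by (simp_all add: a_def)
  have am: "a e \<in> borel_measurable ?M" if "e \<in> ?S" for e
    unfolding a_def using mem[OF that] by (rule borel_measurable_pattern_event)
  have aint: "integrable ?M (a e)" if "e \<in> ?S" for e
    using am[OF that] a01 by (intro integrable_points_bounded[OF w, where B = 1]) auto
  have aaint: "integrable ?M (\<lambda>z. a e z * a e' z)" if "e \<in> ?S" "e' \<in> ?S" for e e'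
    using am[OF that(1)] am[OF that(2)] a01
    by (intro integrable_points_bounded[OF w, where B = 1] borel_measurable_times) (auto simp: mult_le_one)
  have ff: "f e z * f e' z = a e z * a e' z - p * a e z - p * a e' z + p * p" for e e' z
    by (simp add: f algebra_simps)
  have ffint: "integrable ?M (\<lambda>z. f e z * f e' z)" if "e \<in> ?S" "e' \<in> ?S" for e e'
    unfolding ff using that
    by (intro Bochner_Integration.integrable_add Bochner_Integration.integrable_diff integrable_mult_right aint aaint M.integrable_const)
  have sq: "(\<Sum>e\<in>?S. f e z)\<^sup>2 = (\<Sum>e\<in>?S. \<Sum>e'\<in>?S. f e z * f e' z)" for z
    by (simp add: power2_eq_square sum_product)
  show "integrable ?M (\<lambda>z. (\<Sum>e\<in>?S. f e z)\<^sup>2)"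
    unfolding sq by (intro Bochner_Integration.integrable_sum ffint)
  define good where "good e e' \<longleftrightarrow> inj_on e {..<4::nat} \<and> inj_on e' {..<4::nat} \<and> e ` {..<4} \<inter> e' ` {..<4} = {}" for e e' :: "nat \<Rightarrow> nat"
  let ?h = "\<lambda>e e' i j. of_bool (i \<noteq> j \<and> e i = e j) + of_bool (i \<noteq> j \<and> e' i = e' j) + of_bool (e i = e' j) :: real"
  \<comment> \<open>A count of coincidences within and between the tuples. It is at least 1 for
    every pair that is not good, hence dominates the mean of the product, and it is easy to sum:
    each of the 16 choices of (i, j) contributes at most three times the seventh power of n, which
    explains 48.\<close>
  define bad where "bad e e' = (\<Sum>i<4. \<Sum>j<4. ?h e e' i j)"
    for e e' :: "nat \<Rightarrow> nat"
  have E_good: "(\<integral>z. f e z * f e' z \<partial>?M) = 0" if S: "e \<in> ?S" "e' \<in> ?S" and g: "good e e'" for e e'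
  proof -
    have "(\<integral>z. a e z \<partial>?M) = p" "(\<integral>z. a e' z \<partial>?M) = p"
      unfolding a_def p_def using g mem[OF S(1)] mem[OF S(2)]
      by (auto intro!: integral_pattern_event[OF w] simp: good_def)
    moreover have "(\<integral>z. a e z * a e' z \<partial>?M) = p * p"
      unfolding a_def p_def using g mem[OF S(1)] mem[OF S(2)]
      by (intro integral_pattern_event_mult[OF w]) (auto simp: good_def)
    moreover have "(\<integral>z. f e z * f e' z \<partial>?M)
        = (\<integral>z. a e z * a e' z \<partial>?M) - p * (\<integral>z. a e z \<partial>?M) - p * (\<integral>z. a e' z \<partial>?M) + (\<integral>z. p * p \<partial>?M)"
      unfolding ff using S
      by (simp only: Bochner_Integration.integral_add Bochner_Integration.integral_diff
          Bochner_Integration.integrable_diff integrable_mult_right aint aaint M.integrable_const integral_mult_right_zero)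
    ultimately show ?thesis
      by (simp add: M.prob_space)
  qed
  have bad_ge: "bad e e' \<ge> 1" if ng: "\<not> good e e'" for e e'
  proof -
    define h where "h i j = (?h e e' i j)" for i j
    obtain i j where ij: "i < 4" "j < 4" "(i \<noteq> j \<and> e i = e j) \<or> (i \<noteq> j \<and> e' i = e' j) \<or> e i = e' j"
      using ng unfolding good_def inj_on_def by blast
    have h0: "0 \<le> h k l" for k l by (simp add: h_def)
    have "1 \<le> h i j" using ij(3) by (auto simp: h_def)
    also have "\<dots> \<le> (\<Sum>l<4. h i l)"
      using ij h0 by (intro member_le_sum) auto
    also have "\<dots> \<le> (\<Sum>k<4. \<Sum>l<4. h k l)"
      using ij h0 by (intro member_le_sum[of i "{..<4}" "\<lambda>k. \<Sum>l<4. h k l"]) (auto intro: sum_nonneg)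
    finally show ?thesis by (simp add: bad_def h_def)
  qed
  have bad_nonneg: "bad e e' \<ge> 0" for e e'
    unfolding bad_def by (intro sum_nonneg add_nonneg_nonneg) auto
  have E_le: "(\<integral>z. f e z * f e' z \<partial>?M) \<le> bad e e'" if S: "e \<in> ?S" "e' \<in> ?S" for e e'
  proof (cases "good e e'")
    case True
    then show ?thesis using E_good[OF S] bad_nonneg by simp
  next
    case False
    have "f e z * f e' z \<le> 1" for z
    proof -
      have "\<bar>f e z\<bar> \<le> 1" "\<bar>f e' z\<bar> \<le> 1"
        unfolding f using a01[of e z] a01[of e' z] p by (auto simp: abs_le_iff)
      then have "\<bar>f e z\<bar> * \<bar>f e' z\<bar> \<le> 1 * 1"
        by (intro mult_mono) auto
      then show ?thesis unfolding abs_mult[symmetric] by linarith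
    qed
    then have "(\<integral>z. f e z * f e' z \<partial>?M) \<le> 1"
      by (intro M.integral_le_const ffint S) auto
    then show ?thesis using bad_ge[OF False] by simp
  qed
  have cardS: "real (card ?S) = real n ^ 4"
    by (simp add: card_PiE)
  have coll: "(\<Sum>e\<in>?S. of_bool (i \<noteq> j \<and> e i = e j)) \<le> real n ^ 3" if "i < 4" "j < 4" for i j
    using sum_PiE_collision[OF that, of n] by (cases "i = j") auto
  have "(\<integral>z. (\<Sum>e\<in>?S. f e z)\<^sup>2 \<partial>?M) = (\<Sum>e\<in>?S. \<Sum>e'\<in>?S. (\<integral>z. f e z * f e' z \<partial>?M))"
    unfolding sq using ffint
    by (simp add: Bochner_Integration.integral_sum Bochner_Integration.integrable_sum)
  also have "\<dots> \<le> (\<Sum>e\<in>?S. \<Sum>e'\<in>?S. bad e e')"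
    by (intro sum_mono E_le)
  also have "\<dots> = (\<Sum>e\<in>?S. \<Sum>i<4. \<Sum>j<4. \<Sum>e'\<in>?S. ?h e e' i j)"
    unfolding bad_def by (intro sum.cong refl) (subst sum.swap, intro sum.cong refl, rule sum.swap)
  also have "\<dots> = (\<Sum>i<4. \<Sum>j<4. \<Sum>e\<in>?S. \<Sum>e'\<in>?S. ?h e e' i j)"
    by (subst sum.swap, intro sum.cong refl, rule sum.swap)
  also have "\<dots> \<le> (\<Sum>i<4::nat. \<Sum>j<4::nat. 3 * real n ^ 7)"
  proof (intro sum_mono)
    fix i j :: nat assume ij: "i \<in> {..<4}" "j \<in> {..<4}"
    have 1: "(\<Sum>e\<in>?S. \<Sum>e'\<in>?S. of_bool (i \<noteq> j \<and> e i = e j) :: real) \<le> real n ^ 7"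
    proof -
      have "(\<Sum>e\<in>?S. \<Sum>e'\<in>?S. of_bool (i \<noteq> j \<and> e i = e j) :: real) = real n ^ 4 * (\<Sum>e\<in>?S. of_bool (i \<noteq> j \<and> e i = e j))"
        by (simp only: sum_constant cardS sum_distrib_left)
      also have "\<dots> \<le> real n ^ 4 * real n ^ 3"
        using coll[of i j] ij by (intro mult_left_mono) auto
      finally show ?thesis by (simp flip: power_add)
    qed
    have 2: "(\<Sum>e\<in>?S. \<Sum>e'\<in>?S. of_bool (i \<noteq> j \<and> e' i = e' j) :: real) \<le> real n ^ 7"
    proof -
      have "(\<Sum>e\<in>?S. \<Sum>e'\<in>?S. of_bool (i \<noteq> j \<and> e' i = e' j) :: real) = real n ^ 4 * (\<Sum>e\<in>?S. of_bool (i \<noteq> j \<and> e i = e j))"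
        by (simp only: sum_constant cardS)
      also have "\<dots> \<le> real n ^ 4 * real n ^ 3"
        using coll[of i j] ij by (intro mult_left_mono) auto
      finally show ?thesis by (simp flip: power_add)
    qed
    have 3: "(\<Sum>e\<in>?S. \<Sum>e'\<in>?S. of_bool (e i = e' j) :: real) = real n ^ 7"
    proof -
      have "(\<Sum>e\<in>?S. \<Sum>e'\<in>?S. of_bool (e i = e' j) :: real) = (\<Sum>e\<in>?S. real n ^ 3)"
        using ij mem by (intro sum.cong refl sum_PiE_fixed) auto
      also have "\<dots> = real n ^ 4 * real n ^ 3"
        by (simp only: sum_constant cardS)
      finally show ?thesis by (simp flip: power_add)
    qed
    show "(\<Sum>e\<in>?S. \<Sum>e'\<in>?S. ?h e e' i j) \<le> 3 * real n ^ 7"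
      unfolding sum.distrib using 1 2 3 by linarith
  qed
  also have "\<dots> = 48 * real n ^ 7"
    by simp
  finally show "(\<integral>z. (\<Sum>e\<in>?S. f e z)\<^sup>2 \<partial>?M) \<le> 48 * real n ^ 7" .
qed

section \<open>Sequences of permutations with prescribed limits\<close>

definition perms4 :: "nat list set" where
  "perms4 = {\<sigma>. is_permutation \<sigma> \<and> length \<sigma> = 4}"

lemma finite_perms4: "finite perms4"
proof (rule finite_subset)
  show "perms4 \<subseteq> {\<sigma>. set \<sigma> \<subseteq> {1..4} \<and> length \<sigma> = 4}"
    using is_permutation_4 by (auto simp: perms4_def)
  show "finite {\<sigma>. set \<sigma> \<subseteq> {1..4::nat} \<and> length \<sigma> = 4}"
    by (rule finite_lists_length_eq) simp
qed

text \<open>First-moment argument for the squared deviations, summed over all patterns so that one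
  point set serves them simultaneously. If every point set without ties exceeded C, the integral
  would be at least C, as ties have probability 0. The summand 1 in C makes the comparison
  strict.\<close>

lemma exists_typical_permutation:
  assumes w: "square_density w" and n: "n > 0"
  obtains \<pi> where "is_permutation \<pi>" "length \<pi> = n"
    "\<And>\<sigma>. \<sigma> \<in> perms4 \<Longrightarrow>
      (real (card (occurrences n \<pi> \<sigma>)) / real n ^ 4
        - pattern_wt (idx \<sigma>) w / 576)\<^sup>2 \<le> (48 * real (card perms4) + 1) / real n"
proof -
  let ?M = "samples w {..<n}"
  let ?S = "{..<4::nat} \<rightarrow>\<^sub>E {..<n}"
  interpret M: prob_space ?M by (rule prob_space_points[OF w])
  define D where "D \<sigma> z = (\<Sum>e\<in>?S. of_bool (pattern_event \<sigma> (\<lambda>k. z (e k))) - event_prob w \<sigma>)" for \<sigma> and z :: "nat \<Rightarrow> real \<times> real"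
  define C where "C = (48 * real (card perms4) + 1) * real n ^ 7"
  have int: "integrable ?M (\<lambda>z. (D \<sigma> z)\<^sup>2)" and le: "(\<integral>z. (D \<sigma> z)\<^sup>2 \<partial>?M) \<le> 48 * real n ^ 7" for \<sigma>
    unfolding D_def by (rule second_moment_pattern_count[OF w])+
  have intS: "integrable ?M (\<lambda>z. \<Sum>\<sigma>\<in>perms4. (D \<sigma> z)\<^sup>2)"
    by (intro Bochner_Integration.integrable_sum int)
  have "(\<integral>z. (\<Sum>\<sigma>\<in>perms4. (D \<sigma> z)\<^sup>2) \<partial>?M) = (\<Sum>\<sigma>\<in>perms4. (\<integral>z. (D \<sigma> z)\<^sup>2 \<partial>?M))"
    using int by (intro Bochner_Integration.integral_sum)
  also have "\<dots> \<le> (\<Sum>\<sigma>\<in>perms4. 48 * real n ^ 7)"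
    by (intro sum_mono le)
  also have "\<dots> < C"
    using n by (simp add: C_def algebra_simps)
  finally have lt: "(\<integral>z. (\<Sum>\<sigma>\<in>perms4. (D \<sigma> z)\<^sup>2) \<partial>?M) < C" .
  obtain z where z: "inj_on (\<lambda>i. fst (z i)) {..<n}" "inj_on (\<lambda>i. snd (z i)) {..<n}" "(\<Sum>\<sigma>\<in>perms4. (D \<sigma> z)\<^sup>2) \<le> C"
  proof (rule ccontr)
    assume *: "\<not> thesis"
    have "AE z in ?M. C \<le> (\<Sum>\<sigma>\<in>perms4. (D \<sigma> z)\<^sup>2)"
      using AE_points_inj[OF w finite_lessThan]
    proof eventually_elim
      case (elim z)
      then show ?case using * that[of z] by linarith
    qed
    then have "C \<le> (\<integral>z. (\<Sum>\<sigma>\<in>perms4. (D \<sigma> z)\<^sup>2) \<partial>?M)"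
      by (intro M.integral_ge_const intS)
    with lt show False by simp
  qed
  obtain \<pi> where \<pi>: "is_permutation \<pi>" "length \<pi> = n"
    "\<And>\<sigma>. length \<sigma> = 4 \<Longrightarrow>
      card (occurrences n \<pi> \<sigma>)
        = card {e \<in> ?S. pattern_event \<sigma> (\<lambda>k. z (e k))}"
    using pattern_count_of_points[OF z(1,2)] by blast
  show thesis
  proof (rule that[OF \<pi>(1,2)])
    fix \<sigma> assume \<sigma>: "\<sigma> \<in> perms4"
    define c where "c = real (card (occurrences n \<pi> \<sigma>))"
    have \<sigma>': "is_permutation \<sigma>" "length \<sigma> = 4"
      using \<sigma> by (auto simp: perms4_def)
    have p: "event_prob w \<sigma> = pattern_wt (idx \<sigma>) w / 576"
      unfolding event_prob_def by (rule prob_pattern_event[OF w \<sigma>'])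
    have "D \<sigma> z = (\<Sum>e\<in>?S. of_bool (pattern_event \<sigma> (\<lambda>k. z (e k)))) - real (card ?S) * event_prob w \<sigma>"
      by (simp add: D_def sum_subtractf)
    also have "(\<Sum>e\<in>?S. of_bool (pattern_event \<sigma> (\<lambda>k. z (e k)))) = c"
      unfolding c_def \<pi>(3)[OF \<sigma>'(2)]
      by (subst sum_of_bool_eq) (auto intro!: arg_cong[where f = card] simp: finite_PiE)
    also have "real (card ?S) = real n ^ 4"
      by (simp add: card_PiE)
    finally have D: "D \<sigma> z = real n ^ 4 * (c / real n ^ 4 - pattern_wt (idx \<sigma>) w / 576)"
      using n unfolding p by (simp add: right_diff_distrib)
    have "(D \<sigma> z)\<^sup>2 \<le> (\<Sum>\<sigma>\<in>perms4. (D \<sigma> z)\<^sup>2)"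
      using \<sigma> finite_perms4 by (intro member_le_sum[of \<sigma> perms4 "\<lambda>\<sigma>. (D \<sigma> z)\<^sup>2"]) auto
    also have "\<dots> \<le> C" by (rule z(3))
    also have "C = real n ^ 8 * ((48 * real (card perms4) + 1) / real n)"
      using n power_Suc2[of "real n" 7] by (simp add: C_def)
    finally have le: "real n ^ 8 * (c / real n ^ 4 - pattern_wt (idx \<sigma>) w / 576)\<^sup>2 \<le> real n ^ 8 * ((48 * real (card perms4) + 1) / real n)"
      unfolding D power_mult_distrib power_mult[symmetric] by simp
    have "real n ^ 8 > 0" using n by simp
    from le this show "(real (card (occurrences n \<pi> \<sigma>)) / real n ^ 4
        - pattern_wt (idx \<sigma>) w / 576)\<^sup>2 \<le> (48 * real (card perms4) + 1) / real n"
      unfolding c_def[symmetric] by (rule mult_left_le_imp_le)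
  qed
qed

lemma binomial_4_ratio: "(\<lambda>n. real (Suc n) ^ 4 / real (Suc n choose 4)) \<longlonglongrightarrow> 24"
proof -
  have "real (Suc n choose 4) = real (Suc n) * (real (Suc n) - 1) * (real (Suc n) - 2) * (real (Suc n) - 3) / 24" for n
    unfolding binomial_gbinomial
    by (simp add: gbinomial_prod_rev eval_nat_numeral fact_reduce)
  then have "(\<lambda>n. real (Suc n) ^ 4 / real (Suc n choose 4))
     = (\<lambda>n. real (Suc n) ^ 4 / (real (Suc n) * (real (Suc n) - 1) * (real (Suc n) - 2) * (real (Suc n) - 3) / 24))"
    by presburger
  also have "\<dots> \<longlonglongrightarrow> 24"
    by real_asymp
  finally show ?thesis .
qed

text \<open>The error bound of order 1/n is available for each size separately, so permutations can
  be chosen size by size and no almost sure convergence of a random sequence is involved. Replacing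
  the fourth power of n by the binomial coefficient multiplies the limit N/576 by 24.\<close>

theorem exists_permutations_with_densities:
  assumes w: "square_density w"
  obtains \<pi> where "\<And>n. is_permutation (\<pi> n)" "\<And>n. length (\<pi> n) = Suc n"
    "\<And>\<sigma>. \<sigma> \<in> perms4 \<Longrightarrow> (\<lambda>n. pattern_density \<sigma> (\<pi> n)) \<longlonglongrightarrow> pattern_wt (idx \<sigma>) w / 24"
proof -
  define cnt where "cnt \<pi> \<sigma> = real (card (occurrences (length \<pi>) \<pi> \<sigma>))" for \<pi> \<sigma>
  define K where "K = 48 * real (card perms4) + 1"
  have "\<exists>\<pi>. is_permutation \<pi> \<and> length \<pi> = Suc n \<and>
      (\<forall>\<sigma>\<in>perms4. (cnt \<pi> \<sigma> / real (Suc n) ^ 4 - pattern_wt (idx \<sigma>) w / 576)\<^sup>2 \<le> K / real (Suc n))" for n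
  proof -
    obtain \<pi> where "is_permutation \<pi>" "length \<pi> = Suc n"
      "\<And>\<sigma>. \<sigma> \<in> perms4 \<Longrightarrow>
      (real (card (occurrences (Suc n) \<pi> \<sigma>)) / real (Suc n) ^ 4
        - pattern_wt (idx \<sigma>) w / 576)\<^sup>2 \<le> (48 * real (card perms4) + 1) / real (Suc n)"
      using exists_typical_permutation[OF w zero_less_Suc[of n]] by blast
    then show ?thesis
      unfolding cnt_def K_def by (intro exI[of _ \<pi>] conjI ballI) simp_all
  qed
  then have "\<exists>\<pi>. \<forall>n. is_permutation (\<pi> n) \<and> length (\<pi> n) = Suc n \<and>
      (\<forall>\<sigma>\<in>perms4. (cnt (\<pi> n) \<sigma> / real (Suc n) ^ 4 - pattern_wt (idx \<sigma>) w / 576)\<^sup>2 \<le> K / real (Suc n))"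
    by (intro choice allI)
  then obtain \<pi> where \<pi>: "\<And>n. is_permutation (\<pi> n)" "\<And>n. length (\<pi> n) = Suc n"
    "\<And>n \<sigma>. \<sigma> \<in> perms4 \<Longrightarrow> (cnt (\<pi> n) \<sigma> / real (Suc n) ^ 4 - pattern_wt (idx \<sigma>) w / 576)\<^sup>2 \<le> K / real (Suc n)"
    by blast
  show thesis
  proof (rule that[of \<pi>, OF \<pi>(1,2)])
    fix \<sigma> assume \<sigma>: "\<sigma> \<in> perms4"
    define d where "d n = cnt (\<pi> n) \<sigma> / real (Suc n) ^ 4 - pattern_wt (idx \<sigma>) w / 576" for n
    have "(\<lambda>n. (d n)\<^sup>2) \<longlonglongrightarrow> 0"
    proof (rule tendsto_sandwich[of "\<lambda>_. 0" _ _ "\<lambda>n. K / real (Suc n)"])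
      show "\<forall>\<^sub>F n in sequentially. (d n)\<^sup>2 \<le> K / real (Suc n)"
        unfolding d_def by (intro always_eventually allI \<pi>(3)[OF \<sigma>])
      show "(\<lambda>n. K / real (Suc n)) \<longlonglongrightarrow> 0"
        by real_asymp
    qed simp_all
    then have "(\<lambda>n. sqrt ((d n)\<^sup>2)) \<longlonglongrightarrow> sqrt 0"
      by (rule tendsto_real_sqrt)
    then have "d \<longlonglongrightarrow> 0"
      by (simp add: tendsto_rabs_zero_iff)
    then have "(\<lambda>n. d n + pattern_wt (idx \<sigma>) w / 576) \<longlonglongrightarrow> 0 + pattern_wt (idx \<sigma>) w / 576"
      by (intro tendsto_intros)
    then have "(\<lambda>n. (d n + pattern_wt (idx \<sigma>) w / 576) * (real (Suc n) ^ 4 / real (Suc n choose 4)))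
        \<longlonglongrightarrow> (0 + pattern_wt (idx \<sigma>) w / 576) * 24"
      by (intro tendsto_mult binomial_4_ratio)
    moreover have "(d n + pattern_wt (idx \<sigma>) w / 576) * (real (Suc n) ^ 4 / real (Suc n choose 4)) = pattern_density \<sigma> (\<pi> n)" for n
      using \<sigma> unfolding pattern_density_def \<pi>(2) by (simp add: d_def cnt_def \<pi>(2) perms4_def)
    ultimately show "(\<lambda>n. pattern_density \<sigma> (\<pi> n)) \<longlonglongrightarrow> pattern_wt (idx \<sigma>) w / 24"
      by simp
  qed
qed

lemma not_quasirandom_forcing_if_density:
  assumes w: "nonuniform_density w" and S: "S \<subseteq> perms4" and one: "\<And>\<sigma>. \<sigma> \<in> S \<Longrightarrow> pattern_wt (idx \<sigma>) w = 1"
  shows "\<not> quasirandom_forcing S"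
proof
  assume forcing: "quasirandom_forcing S"
  have sq: "square_density w" using w by (simp add: nonuniform_density_def)
  obtain \<tau> where \<tau>: "\<tau> \<in> perms4" "pattern_wt (idx \<tau>) w \<noteq> 1"
    using w by (auto simp: nonuniform_density_def perms4_def)
  obtain \<pi> where \<pi>: "\<And>n. is_permutation (\<pi> n)" "\<And>n. length (\<pi> n) = Suc n"
    "\<And>\<sigma>. \<sigma> \<in> perms4 \<Longrightarrow> (\<lambda>n. pattern_density \<sigma> (\<pi> n)) \<longlonglongrightarrow> pattern_wt (idx \<sigma>) w / 24"
    using exists_permutations_with_densities[OF sq] by blast
  have fact4: "fact (length \<sigma>) = (24 :: real)" if "\<sigma> \<in> perms4" for \<sigma>
    using that by (simp add: perms4_def fact_numeral)
  have "filterlim (\<lambda>n. length (\<pi> n)) at_top sequentially"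
    unfolding \<pi>(2) by (rule filterlim_Suc)
  moreover have "\<forall>\<sigma>\<in>S. (\<lambda>n. pattern_density \<sigma> (\<pi> n)) \<longlonglongrightarrow> 1 / fact (length \<sigma>)"
  proof
    fix \<sigma> assume "\<sigma> \<in> S"
    then show "(\<lambda>n. pattern_density \<sigma> (\<pi> n)) \<longlonglongrightarrow> 1 / fact (length \<sigma>)"
      using \<pi>(3)[of \<sigma>] S one[of \<sigma>] fact4[of \<sigma>] by auto
  qed
  ultimately have "(\<lambda>n. pattern_density \<tau> (\<pi> n)) \<longlonglongrightarrow> 1 / fact (length \<tau>)"
    using forcing \<pi>(1) \<tau>(1) unfolding quasirandom_forcing_def perms4_def by blast
  then have "(\<lambda>n. pattern_density \<tau> (\<pi> n)) \<longlonglongrightarrow> 1 / 24"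
    using fact4[OF \<tau>(1)] by simp
  with \<pi>(3)[OF \<tau>(1)] have "pattern_wt (idx \<tau>) w / 24 = 1 / 24"
    by (rule LIMSEQ_unique)
  with \<tau>(2) show False by simp
qed

section \<open>The relation between the permutation matrices\<close>

lemma perm_matrix_nth:
  assumes "length \<pi> = 4" "i < 4" "j < 4"
  shows "perm_matrix \<pi> $$ (i, j) = of_bool (\<pi> ! i = Suc j)"
  using assms by (simp add: perm_matrix_def)

text \<open>Row i of the matrix relation says that the first two permutations take the same two
  values at i, with multiplicity, as the last two.\<close>

lemma perm_matrix_relation:
  assumes perm: "is_permutation \<pi>1" "is_permutation \<pi>2" "is_permutation \<pi>3" "is_permutation \<pi>4"
    and len: "length \<pi>1 = 4" "length \<pi>2 = 4" "length \<pi>3 = 4" "length \<pi>4 = 4"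
    and rel: "perm_matrix \<pi>1 + perm_matrix \<pi>2 - perm_matrix \<pi>3 - perm_matrix \<pi>4 = 0\<^sub>m 4 4"
    and i: "i < 4"
  shows "\<pi>3 ! i = \<pi>1 ! i \<and> \<pi>4 ! i = \<pi>2 ! i \<or> \<pi>3 ! i = \<pi>2 ! i \<and> \<pi>4 ! i = \<pi>1 ! i"
proof -
  have dim: "perm_matrix \<pi> \<in> carrier_mat 4 4" if "length \<pi> = 4" for \<pi>
    using that by (simp add: perm_matrix_def)
  have eq: "of_bool (\<pi>1 ! i = v) + of_bool (\<pi>2 ! i = v) = (of_bool (\<pi>3 ! i = v) + of_bool (\<pi>4 ! i = v) :: real)"
    if v: "1 \<le> v" "v \<le> 4" for v
  proof -
    obtain j where j: "v = Suc j" "j < 4" using v by (cases v) auto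
    have "(perm_matrix \<pi>1 + perm_matrix \<pi>2 - perm_matrix \<pi>3 - perm_matrix \<pi>4) $$ (i, j) = 0"
      unfolding rel using i j by simp
    then show ?thesis
      using i j dim[OF len(1)] dim[OF len(2)] dim[OF len(3)] dim[OF len(4)]
      by (simp add: perm_matrix_nth len)
  qed
  have range: "1 \<le> \<pi> ! i" "\<pi> ! i \<le> 4" if "is_permutation \<pi>" "length \<pi> = 4" for \<pi>
    using is_permutation_4[OF that] nth_mem[of i \<pi>] i that(2) by auto
  show ?thesis
    using eq[OF range[OF perm(1) len(1)]] eq[OF range[OF perm(2) len(2)]]
      eq[OF range[OF perm(3) len(3)]] eq[OF range[OF perm(4) len(4)]]
    by (auto simp: of_bool_def split: if_splits)
qed

text \<open>Injectivity of s3 forces it to follow the same one of s1 and s2 along each cycle of the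
  permutation comparing s1 with s2. The cycle of a follows s1, that of c follows s2, and neither is
  a fixed point; two different cycles of length at least 2 on four positions are transpositions. The
  proof finds b and d as the positions where s3 takes the values \<open>s2 a\<close> and
  \<open>s1 c\<close>.\<close>

lemma forced_block_structure:
  fixes s1 s2 s3 s4 :: "nat \<Rightarrow> nat"
  assumes bij: "bij_betw s1 {..<4} {..<4}" "bij_betw s2 {..<4} {..<4}" "bij_betw s3 {..<4} {..<4}"
    and rel: "\<And>i. i < 4 \<Longrightarrow> s3 i = s1 i \<and> s4 i = s2 i \<or> s3 i = s2 i \<and> s4 i = s1 i"
    and a: "a < 4" "s3 a \<noteq> s2 a" and c: "c < 4" "s3 c \<noteq> s1 c"
  obtains b d A B C D where "distinct [a, b, c, d]" "b < 4" "d < 4"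
    "distinct [A, B, C, D]" "A < 4" "B < 4" "C < 4" "D < 4"
    "s1 a = A" "s1 b = B" "s1 c = C" "s1 d = D"
    "s2 a = B" "s2 b = A" "s2 c = D" "s2 d = C"
    "s3 a = A" "s3 b = B" "s3 c = D" "s3 d = C"
    "s4 a = B" "s4 b = A" "s4 c = C" "s4 d = D"
proof -
  have inj: "i = j" if "i < 4" "j < 4" "s1 i = s1 j \<or> s2 i = s2 j \<or> s3 i = s3 j" for i j
    using that bij by (auto simp: bij_betw_def inj_on_def)
  have lt: "s1 i < 4" "s2 i < 4" "s3 i < 4" if "i < 4" for i
    using that bij by (auto simp: bij_betw_def)
  have surj: "\<exists>i<4. s i = v" if "bij_betw s {..<4} {..<4}" "v < 4" for s and v :: nat
  proof -
    have "v \<in> s ` {..<4}" using that by (simp add: bij_betw_def)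
    then show ?thesis by auto
  qed
  have a': "s3 a = s1 a" "s4 a = s2 a" and c': "s3 c = s2 c" "s4 c = s1 c"
    using rel[OF a(1)] rel[OF c(1)] a(2) c(2) by auto
  obtain b where b: "b < 4" "s3 b = s2 a"
    using surj[OF bij(3) lt(2)[OF a(1)]] by blast
  have ab: "a \<noteq> b" using b a by auto
  have b': "s3 b = s1 b" "s4 b = s2 b" "s1 b = s2 a"
    using rel[OF b(1)] b(2) inj[OF b(1) a(1)] ab by auto
  obtain d where d: "d < 4" "s3 d = s1 c"
    using surj[OF bij(3) lt(1)[OF c(1)]] by blast
  have cd: "c \<noteq> d" using d c by auto
  have d': "s3 d = s2 d" "s4 d = s1 d" "s2 d = s1 c"
    using rel[OF d(1)] d(2) inj[OF d(1) c(1)] cd by auto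
  have "s2 b \<noteq> s2 a" "s1 d \<noteq> s1 c"
    using inj[OF b(1) a(1)] inj[OF d(1) c(1)] ab cd by auto
  then have "b \<noteq> c" "b \<noteq> d" "a \<noteq> c" "a \<noteq> d"
    using a a' b' c c' d' by auto
  then have dist: "distinct [a, b, c, d]"
    using ab cd by auto
  have s1_dist: "distinct [s1 a, s1 b, s1 c, s1 d]"
    using dist inj a(1) b(1) c(1) d(1) by auto
  have s3_dist: "distinct [s3 a, s3 b, s3 c, s3 d]"
    using dist inj a(1) b(1) c(1) d(1) by auto
  have s2_dist: "distinct [s2 a, s2 b, s2 c, s2 d]"
    using dist inj a(1) b(1) c(1) d(1) by auto
  have all: "v = s1 a \<or> v = s1 b \<or> v = s1 c \<or> v = s1 d" if "v < 4" for v
    using distinct4_eq[OF s1_dist] lt a(1) b(1) c(1) d(1) that by blast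
  have s2c: "s2 c = s1 d"
    using all[OF lt(2)[OF c(1)]] s3_dist a' b' c' d' by auto
  have s2b: "s2 b = s1 a"
    using all[OF lt(2)[OF b(1)]] s2_dist s2c b' d' by auto
  show thesis
    by (rule that[of b d "s1 a" "s1 b" "s1 c" "s1 d"])
      (use dist s1_dist b(1) d(1) lt a(1) c(1) s2c s2b a' b' c' d' in auto)
qed

lemma perm4_eqI:
  assumes "length \<sigma> = 4" "length \<tau> = 4" "\<And>i. i < 4 \<Longrightarrow> \<sigma> ! i = \<tau> ! i"
  shows "\<sigma> = \<tau>"
  using assms by (intro nth_equalityI) auto

lemma perm4_nth_ge_1:
  assumes "is_permutation \<pi>" "length \<pi> = 4" "i < 4"
  shows "\<pi> ! i \<ge> 1"
proof -
  have "\<pi> ! i \<in> {1..4}"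
    using is_permutation_4[OF assms(1,2)] nth_mem[of i \<pi>] assms(2,3) by simp
  then show ?thesis by simp
qed

lemma pair_not_quasirandom_forcing:
  assumes "\<sigma> \<in> perms4" "\<tau> \<in> perms4"
  shows "\<not> quasirandom_forcing {\<sigma>, \<tau>}"
proof -
  \<comment> \<open>\<open>density_for_pair\<close> needs two different patterns. If both given ones
    coincide, an arbitrary second pattern is supplied, and its weight is prescribed as well.\<close>
  define \<tau>' where "\<tau>' = (if \<tau> \<noteq> \<sigma> then \<tau> else if \<sigma> = [1, 2, 3, 4] then [4, 3, 2, 1] else [1, 2, 3, 4])"
  have "[1, 2, 3, 4] \<in> perms4" "[4, 3, 2, 1] \<in> perms4"
    unfolding perms4_def using witness_permutations(1,5) by simp_all
  then have "\<tau>' \<in> perms4"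
    unfolding \<tau>'_def using assms(2) by presburger
  moreover have "[4, 3, 2, 1] \<noteq> [1, 2, 3, 4 :: nat]"
    by simp
  then have "\<tau>' \<noteq> \<sigma>"
    unfolding \<tau>'_def by presburger
  moreover have "\<tau> = \<sigma> \<or> \<tau> = \<tau>'"
    unfolding \<tau>'_def by presburger
  ultimately have \<tau>': "\<tau>' \<in> perms4" "\<tau>' \<noteq> \<sigma>" "\<tau> = \<sigma> \<or> \<tau> = \<tau>'"
    by simp_all
  have len: "length \<sigma> = 4" "length \<tau>' = 4" and perm: "is_permutation \<sigma>" "is_permutation \<tau>'"
    using assms(1) \<tau>'(1) by (simp_all add: perms4_def)
  have "\<exists>k<4. \<sigma> ! k \<noteq> \<tau>' ! k"
  proof (rule ccontr)
    assume "\<not> (\<exists>k<4. \<sigma> ! k \<noteq> \<tau>' ! k)"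
    then have "\<sigma> = \<tau>'" by (intro perm4_eqI len) simp
    with \<tau>'(2) show False by simp
  qed
  then obtain k where k: "k < 4" "\<sigma> ! k \<noteq> \<tau>' ! k" by fast
  have "\<sigma> ! k \<ge> 1" "\<tau>' ! k \<ge> 1"
    by (rule perm4_nth_ge_1; fact)+
  then have idx: "idx \<sigma> k \<noteq> idx \<tau>' k"
    using k(2) unfolding idx_def by linarith
  have lt: "idx \<sigma> i < 4" "idx \<tau>' i < 4" if "i < 4" for i
    using bij_betwE[OF idx_bij(1)[OF perm(1) len(1)]] bij_betwE[OF idx_bij(1)[OF perm(2) len(2)]] that by simp_all
  obtain w where w: "nonuniform_density w" "pattern_wt (idx \<sigma>) w = 1" "pattern_wt (idx \<tau>') w = 1"
    using density_for_pair[of "idx \<sigma>" "idx \<tau>'", OF lt(1) lt(2) k(1) idx] by blast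
  show ?thesis
  proof (rule not_quasirandom_forcing_if_density[OF w(1)])
    show "{\<sigma>, \<tau>} \<subseteq> perms4" using assms by simp
    show "pattern_wt (idx \<rho>) w = 1" if "\<rho> \<in> {\<sigma>, \<tau>}" for \<rho>
      using that \<tau>'(3) w(2,3) by auto
  qed
qed

theorem theorem15:
  fixes \<pi>\<^sub>1 \<pi>\<^sub>2 \<pi>\<^sub>3 \<pi>\<^sub>4 :: "nat list"
  assumes "is_permutation \<pi>\<^sub>1" "is_permutation \<pi>\<^sub>2" "is_permutation \<pi>\<^sub>3" "is_permutation \<pi>\<^sub>4"
    and "length \<pi>\<^sub>1 = 4" "length \<pi>\<^sub>2 = 4" "length \<pi>\<^sub>3 = 4" "length \<pi>\<^sub>4 = 4"
    and "perm_matrix \<pi>\<^sub>1 + perm_matrix \<pi>\<^sub>2 - perm_matrix \<pi>\<^sub>3 - perm_matrix \<pi>\<^sub>4 = 0\<^sub>m 4 4"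
  shows "\<not> quasirandom_forcing {\<pi>\<^sub>1, \<pi>\<^sub>2, \<pi>\<^sub>3, \<pi>\<^sub>4}"
proof -
  note perm = assms(1-4) and len = assms(5-8)
  note rel = perm_matrix_relation[OF perm len assms(9)]
  have S: "{\<pi>\<^sub>1, \<pi>\<^sub>2, \<pi>\<^sub>3, \<pi>\<^sub>4} \<subseteq> perms4"
    using perm len by (auto simp: perms4_def)
  show ?thesis
  proof (cases "\<pi>\<^sub>3 = \<pi>\<^sub>1 \<or> \<pi>\<^sub>3 = \<pi>\<^sub>2")
    case True
    have "\<pi>\<^sub>4 = \<pi>\<^sub>2 \<or> \<pi>\<^sub>4 = \<pi>\<^sub>1"
    proof (cases "\<pi>\<^sub>3 = \<pi>\<^sub>1")
      case True
      have "\<pi>\<^sub>4 ! i = \<pi>\<^sub>2 ! i" if "i < 4" for i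
        using rel[OF that] True by auto
      then show ?thesis using perm4_eqI[OF len(4) len(2)] by blast
    next
      case False
      have "\<pi>\<^sub>4 ! i = \<pi>\<^sub>1 ! i" if "i < 4" for i
        using rel[OF that] False \<open>\<pi>\<^sub>3 = \<pi>\<^sub>1 \<or> \<pi>\<^sub>3 = \<pi>\<^sub>2\<close> by auto
      then show ?thesis using perm4_eqI[OF len(4) len(1)] by blast
    qed
    then have "{\<pi>\<^sub>1, \<pi>\<^sub>2, \<pi>\<^sub>3, \<pi>\<^sub>4} = {\<pi>\<^sub>1, \<pi>\<^sub>2}" using True by auto
    then show ?thesis
      using pair_not_quasirandom_forcing[of \<pi>\<^sub>1 \<pi>\<^sub>2] S by auto
  next
    case False
    have idx_eq: "idx \<sigma> i = idx \<tau> i \<longleftrightarrow> \<sigma> ! i = \<tau> ! i"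
      if "is_permutation \<sigma>" "length \<sigma> = 4" "is_permutation \<tau>" "length \<tau> = 4" "i < 4" for \<sigma> \<tau> i
      using perm4_nth_ge_1[OF that(1,2,5)] perm4_nth_ge_1[OF that(3,4,5)] unfolding idx_def by linarith
    \<comment> \<open>By \<open>rel\<close>, the third permutation follows the first one at a and
      the second one at c, so both choices really occur.\<close>
    obtain a where a: "a < 4" "\<pi>\<^sub>3 ! a \<noteq> \<pi>\<^sub>2 ! a"
      using False perm4_eqI[OF len(3) len(2)] by blast
    obtain c where c: "c < 4" "\<pi>\<^sub>3 ! c \<noteq> \<pi>\<^sub>1 ! c"
      using False perm4_eqI[OF len(3) len(1)] by blast
    have idx_rel: "idx \<pi>\<^sub>3 i = idx \<pi>\<^sub>1 i \<and> idx \<pi>\<^sub>4 i = idx \<pi>\<^sub>2 i \<or> idx \<pi>\<^sub>3 i = idx \<pi>\<^sub>2 i \<and> idx \<pi>\<^sub>4 i = idx \<pi>\<^sub>1 i"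
      if "i < 4" for i
      using rel[OF that] by (auto simp: idx_def)
    have ia: "idx \<pi>\<^sub>3 a \<noteq> idx \<pi>\<^sub>2 a" and ic: "idx \<pi>\<^sub>3 c \<noteq> idx \<pi>\<^sub>1 c"
      using a c idx_eq perm len by auto
    obtain b d A B C D where st: "distinct [a, b, c, d]" "b < 4" "d < 4"
      "distinct [A, B, C, D]" "A < 4" "B < 4" "C < 4" "D < 4"
      "idx \<pi>\<^sub>1 a = A" "idx \<pi>\<^sub>1 b = B" "idx \<pi>\<^sub>1 c = C" "idx \<pi>\<^sub>1 d = D"
      "idx \<pi>\<^sub>2 a = B" "idx \<pi>\<^sub>2 b = A" "idx \<pi>\<^sub>2 c = D" "idx \<pi>\<^sub>2 d = C"
      "idx \<pi>\<^sub>3 a = A" "idx \<pi>\<^sub>3 b = B" "idx \<pi>\<^sub>3 c = D" "idx \<pi>\<^sub>3 d = C"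
      "idx \<pi>\<^sub>4 a = B" "idx \<pi>\<^sub>4 b = A" "idx \<pi>\<^sub>4 c = C" "idx \<pi>\<^sub>4 d = D"
      by (rule forced_block_structure[of "idx \<pi>\<^sub>1" "idx \<pi>\<^sub>2" "idx \<pi>\<^sub>3" "idx \<pi>\<^sub>4" a c,
            OF idx_bij(1)[OF perm(1) len(1)] idx_bij(1)[OF perm(2) len(2)]
            idx_bij(1)[OF perm(3) len(3)] idx_rel a(1) ia c(1) ic])
    obtain w where w: "nonuniform_density w" "pattern_wt (idx \<pi>\<^sub>1) w = 1" "pattern_wt (idx \<pi>\<^sub>2) w = 1"
      "pattern_wt (idx \<pi>\<^sub>3) w = 1" "pattern_wt (idx \<pi>\<^sub>4) w = 1"
      by (rule density_for_quadruple[of a b c d A B C D "idx \<pi>\<^sub>1" "idx \<pi>\<^sub>2" "idx \<pi>\<^sub>3" "idx \<pi>\<^sub>4",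
            OF st(1) a(1) st(2) c(1) st(3) st(4-24)])
    show ?thesis
      using w(2-5) by (intro not_quasirandom_forcing_if_density[OF w(1) S]) auto
  qed
qed

end
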